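(* Let $\mathcal{S}$ be a small category with binary products, endowed with a distinguished subcategory $\mathcal{S}^{sm}$ of smooth morphisms stable under base change, and let $\mathbb{H}$ be a geometric $\mathcal{S}$-fibered category. Let $(\otimes,m^i)$ be an internal tensor structure on $\mathbb{H}$ and let $(\boxtimes,m^e)$ be an external tensor structure on $\mathbb{H}$ corresponding to it, i.e. equivalent to $E(\otimes,m^i)$ (so that $(\otimes,m^i)$ is equivalent to $I(\boxtimes,m^e)$). Then $(\otimes,m^i)$ is geometric if and only if $(\boxtimes,m^e)$ is geometric.
   Context: **Fibered categories.** An $\mathcal{S}$-fibered category $\mathbb{H}$ consists of a category $\mathbb{H}(S)$ for each object $S$, a functor $f^*:\mathbb{H}(S)\to\mathbb{H}(T)$ for each $f:T\to S$, and a natural isomorphism $\mathrm{conn}_{f,g}:(gf)^*A\to f^*g^*A$ for each composable pair $f:T\to S$, $g:S\to V$, such that $\mathrm{id}_S^*=\mathrm{id}_{\mathbb{H}(S)}$; $\mathrm{conn}_{f,g}$ is the identity if $f$ or $g$ is an identity (strict unitality); and $f^*(\mathrm{conn}_{g,h})\circ\mathrm{conn}_{f,hg}=\mathrm{conn}_{f,g}\circ\mathrm{conn}_{gf,h}$ for composable $f,g,h$. These connection isomorphisms are written as equalities. $pr^{12}_i:S_1\times S_2\to S_i$ denote projections, $\Delta_S:S\to S\times S$ the diagonal. **Smooth morphisms.** $\mathcal{S}^{sm}\subseteq\mathcal{S}$ is a subcategory such that, for every Cartesian square in $\mathcal{S}$ with $p:P\to S$, $g:S'\to S$, $p':P'\to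 S'$, $g':P'\to P$ ($pg'=gp'$), if $p$ is in $\mathcal{S}^{sm}$ then so is $p'$. Morphisms of $\mathcal{S}^{sm}$ are called smooth. **Geometric fibered category.** $\mathbb{H}$ is geometric if (0) for every smooth $p:P\to S$, the functor $p^*$ has a left adjoint $p_\#:\mathbb{H}(P)\to\mathbb{H}(S)$ (unit $\eta$, counit $\epsilon$); (1) for every Cartesian square in $\mathcal{S}$ with $p:P\to S$, $g:S'\to S$, $p':P'\to S'$, $g':P'\to P$ ($pg'=gp'$) and with $p$ smooth, the natural transformation $p'_\#g'^*A\xrightarrow{\eta}p'_\#g'^*p^*p_\#A=p'_\#p'^*g^*p_\#A\xrightarrow{\epsilon}g^*p_\#A$ is invertible. **Internal tensor structures.** An internal tensor structure $(\otimes,m)$ on $\mathbb{H}$: functors $\otimes_S:\mathbb{H}(S)\times\mathbb{H}(S)\to\mathbb{H}(S)$ and, for $f:T\to S$, natural isomorphisms $m_f:f^*A\otimes f^*B\to f^*(A\otimes B)$ with $m_{gf}=f^*(m_g)\circ m_f$ modulo connection isomorphisms. An equivalence $e:(\otimes,m)\to(\otimes',m')$ is a family of natural isomorphisms $e_S:A\otimes B\to A\otimes'B$ with $f^*(e_S)\circ m_f=m'_f\circ e_T$. It is geometric if for every smooth $p:P\to S$ the natural transformations $p_\#(A\otimes p^*B)\xrightarrow{\eta}p_\#(p^*p_\#A\otimes p^*B)\xrightarrow{m}p_\#p^*(p_\#A\otimes B)\xrightarrow{\epsilon}p_\#A\otimes B$ (on $\mathbb{H}(P)\times\mathbb{H}(S)$)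 and $p_\#(p^*A\otimes B)\xrightarrow{\eta}p_\#(p^*A\otimes p^*p_\#B)\xrightarrow{m}p_\#p^*(A\otimes p_\#B)\xrightarrow{\epsilon}A\otimes p_\#B$ (on $\mathbb{H}(S)\times\mathbb{H}(P)$) are invertible. **External tensor structures.** An external tensor structure $(\boxtimes,m)$ on $\mathbb{H}$: functors $\boxtimes_{S_1,S_2}:\mathbb{H}(S_1)\times\mathbb{H}(S_2)\to\mathbb{H}(S_1\times S_2)$ and, for $f_i:T_i\to S_i$ ($i=1,2$), natural isomorphisms $m_{f_1,f_2}:f_1^*A_1\boxtimes f_2^*A_2\to(f_1\times f_2)^*(A_1\boxtimes A_2)$ with $m_{g_1f_1,g_2f_2}=(f_1\times f_2)^*(m_{g_1,g_2})\circ m_{f_1,f_2}$ modulo connection isomorphisms. An equivalence $e:(\boxtimes,m)\to(\boxtimes',m')$ is a family of natural isomorphisms $e_{S_1,S_2}:A_1\boxtimes A_2\to A_1\boxtimes'A_2$ with $(f_1\times f_2)^*(e)\circ m=m'\circ e$. It is geometric if for all smooth $p_i:P_i\to S_i$, $i=1,2$, the natural transformations $(p_1\times\mathrm{id}_{S_2})_\#(A_1\boxtimes A_2)\xrightarrow{\eta}(p_1\times\mathrm{id}_{S_2})_\#(p_1^*p_{1,\#}A_1\boxtimes A_2)\xrightarrow{m}(p_1\times\mathrm{id}_{S_2})_\#(p_1\times\mathrm{id}_{S_2})^*(p_{1,\#}A_1\boxtimes A_2)\xrightarrow{\epsilon}p_{1,\#}A_1\boxtimes A_2$ (on $\mathbb{H}(P_1)\times\mathbb{H}(S_2)$)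 and $(\mathrm{id}_{S_1}\times p_2)_\#(A_1\boxtimes A_2)\xrightarrow{\eta}(\mathrm{id}_{S_1}\times p_2)_\#(A_1\boxtimes p_2^*p_{2,\#}A_2)\xrightarrow{m}(\mathrm{id}_{S_1}\times p_2)_\#(\mathrm{id}_{S_1}\times p_2)^*(A_1\boxtimes p_{2,\#}A_2)\xrightarrow{\epsilon}A_1\boxtimes p_{2,\#}A_2$ (on $\mathbb{H}(S_1)\times\mathbb{H}(P_2)$) are invertible. **Construction $E$**: $E(\otimes,m)=(\boxtimes,m^e)$ with $A_1\boxtimes A_2:=pr^{12,*}_1A_1\otimes pr^{12,*}_2A_2$ and $m^e_{f_1,f_2}:pr_1^{12,*}f_1^*A_1\otimes pr_2^{12,*}f_2^*A_2=(f_1\times f_2)^*pr_1^{12,*}A_1\otimes(f_1\times f_2)^*pr_2^{12,*}A_2\xrightarrow{m_{f_1\times f_2}}(f_1\times f_2)^*(A_1\boxtimes A_2)$. **Construction $I$**: $I(\boxtimes,m)=(\otimes,m^i)$ with $A\otimes B:=\Delta_S^*(A\boxtimes B)$ and $m^i_f:\Delta_T^*(f^*A\boxtimes f^*B)\xrightarrow{m_{f,f}}\Delta_T^*(f\times f)^*(A\boxtimes B)=f^*\Delta_S^*(A\boxtimes B)$. These induce mutually inverse bijections between equivalence classes of internal and external tensor structures on $\mathbb{H}$. *)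

theory Defs
  imports Main
begin

section \<open>Categories, functors, natural transformations\<close>

text \<open>
  Categories are arrow-based with carrier sets, so that arrows carry their domain and codomain.
  All conditions are relativised to the carriers; values outside of them are irrelevant.
  Composition is in applicative order: \<open>g \<cdot> f\<close> is \<open>g\<close> after \<open>f\<close>.
\<close>

record ('o, 'a) cat =
  Ob  :: "'o set"
  Ar  :: "'a set"
  Dom :: "'a \<Rightarrow> 'o"
  Cod :: "'a \<Rightarrow> 'o"
  Id  :: "'o \<Rightarrow> 'a"
  Cmp :: "'a \<Rightarrow> 'a \<Rightarrow> 'a" (infixr "\<cdot>\<index>" 70)

definition hom :: "('o, 'a) cat \<Rightarrow> 'o \<Rightarrow> 'o \<Rightarrow> 'a set" where
  "hom C A B = {f \<in> Ar C. Dom C f = A \<and> Cod C f = B}"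

locale category =
  fixes C :: "('o, 'a) cat" (structure)
  assumes dom_cod: "f \<in> Ar C \<Longrightarrow> Dom C f \<in> Ob C \<and> Cod C f \<in> Ob C"
    and id_in_hom: "A \<in> Ob C \<Longrightarrow> Id C A \<in> hom C A A"
    and comp_in_hom: "f \<in> hom C A B \<Longrightarrow> g \<in> hom C B D \<Longrightarrow> g \<cdot> f \<in> hom C A D"
    and id_comp: "f \<in> hom C A B \<Longrightarrow> Id C B \<cdot> f = f"
    and comp_id: "f \<in> hom C A B \<Longrightarrow> f \<cdot> Id C A = f"
    and comp_assoc: "f \<in> hom C A B \<Longrightarrow> g \<in> hom C B D \<Longrightarrow> h \<in> hom C D E \<Longrightarrow>
      (h \<cdot> g) \<cdot> f = h \<cdot> (g \<cdot> f)"

definition inverse_arrows :: "('o, 'a) cat \<Rightarrow> 'a \<Rightarrow> 'a \<Rightarrow> bool" where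
  "inverse_arrows C f g \<longleftrightarrow>
     f \<in> hom C (Dom C f) (Cod C f) \<and> g \<in> hom C (Cod C f) (Dom C f) \<and>
     g \<cdot>\<^bsub>C\<^esub> f = Id C (Dom C f) \<and> f \<cdot>\<^bsub>C\<^esub> g = Id C (Cod C f)"

definition iso :: "('o, 'a) cat \<Rightarrow> 'a \<Rightarrow> bool" where
  "iso C f \<longleftrightarrow> (\<exists>g. inverse_arrows C f g)"

definition inv_ar :: "('o, 'a) cat \<Rightarrow> 'a \<Rightarrow> 'a" where
  "inv_ar C f = (THE g. inverse_arrows C f g)"

record ('o, 'a, 'p, 'b) funct =
  ob :: "'o \<Rightarrow> 'p"
  ar :: "'a \<Rightarrow> 'b"

locale is_functor =
  C: category C + D: category D
  for C :: "('o, 'a) cat" and D :: "('p, 'b) cat" and F :: "('o, 'a, 'p, 'b) funct" +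
  assumes ob_in: "A \<in> Ob C \<Longrightarrow> ob F A \<in> Ob D"
    and ar_in: "f \<in> hom C A B \<Longrightarrow> ar F f \<in> hom D (ob F A) (ob F B)"
    and ar_id: "A \<in> Ob C \<Longrightarrow> ar F (Id C A) = Id D (ob F A)"
    and ar_comp: "f \<in> hom C A B \<Longrightarrow> g \<in> hom C B E \<Longrightarrow>
      ar F (g \<cdot>\<^bsub>C\<^esub> f) = ar F g \<cdot>\<^bsub>D\<^esub> ar F f"

definition id_funct :: "('o, 'a, 'o, 'a) funct" where
  "id_funct = \<lparr>ob = \<lambda>A. A, ar = \<lambda>f. f\<rparr>"

definition comp_funct ::
  "('p, 'b, 'q, 'c) funct \<Rightarrow> ('o, 'a, 'p, 'b) funct \<Rightarrow> ('o, 'a, 'q, 'c) funct" (infixr "\<circ>\<^sub>F" 60)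
  where "G \<circ>\<^sub>F F = \<lparr>ob = \<lambda>A. ob G (ob F A), ar = \<lambda>f. ar G (ar F f)\<rparr>"

definition prod_cat :: "('o, 'a) cat \<Rightarrow> ('p, 'b) cat \<Rightarrow> ('o \<times> 'p, 'a \<times> 'b) cat"
    (infixr "\<times>\<^sub>C" 65)
  where "C \<times>\<^sub>C D =
    \<lparr>Ob = Ob C \<times> Ob D, Ar = Ar C \<times> Ar D,
     Dom = \<lambda>(f, g). (Dom C f, Dom D g), Cod = \<lambda>(f, g). (Cod C f, Cod D g),
     Id = \<lambda>(A, B). (Id C A, Id D B),
     Cmp = \<lambda>(f', g') (f, g). (f' \<cdot>\<^bsub>C\<^esub> f, g' \<cdot>\<^bsub>D\<^esub> g)\<rparr>"

definition prod_funct ::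
  "('o, 'a, 'q, 'c) funct \<Rightarrow> ('p, 'b, 'r, 'd) funct \<Rightarrow>
   ('o \<times> 'p, 'a \<times> 'b, 'q \<times> 'r, 'c \<times> 'd) funct" (infixr "\<times>\<^sub>F" 65)
  where "F \<times>\<^sub>F G =
    \<lparr>ob = \<lambda>(A, B). (ob F A, ob G B), ar = \<lambda>(f, g). (ar F f, ar G g)\<rparr>"

locale natural_transformation =
  F: is_functor C D F + G: is_functor C D G
  for C :: "('o, 'a) cat" and D :: "('p, 'b) cat"
    and F :: "('o, 'a, 'p, 'b) funct" and G :: "('o, 'a, 'p, 'b) funct"
    and \<tau> :: "'o \<Rightarrow> 'b" +
  assumes component_in: "A \<in> Ob C \<Longrightarrow> \<tau> A \<in> hom D (ob F A) (ob G A)"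
    and naturality: "f \<in> hom C A B \<Longrightarrow> ar G f \<cdot>\<^bsub>D\<^esub> \<tau> A = \<tau> B \<cdot>\<^bsub>D\<^esub> ar F f"

locale natural_isomorphism = natural_transformation +
  assumes component_iso: "A \<in> Ob C \<Longrightarrow> iso D (\<tau> A)"

locale adjunction =
  unit: natural_transformation C C id_funct "R \<circ>\<^sub>F L" \<eta> +
  counit: natural_transformation D D "L \<circ>\<^sub>F R" id_funct \<epsilon> +
  L: is_functor C D L + R: is_functor D C R
  for C :: "('o, 'a) cat" and D :: "('p, 'b) cat"
    and L :: "('o, 'a, 'p, 'b) funct" and R :: "('p, 'b, 'o, 'a) funct"
    and \<eta> :: "'o \<Rightarrow> 'a" and \<epsilon> :: "'p \<Rightarrow> 'b" +
  assumes triangle_left: "A \<in> Ob C \<Longrightarrow> \<epsilon> (ob L A) \<cdot>\<^bsub>D\<^esub> ar L (\<eta> A) = Id D (ob L A)"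
    and triangle_right: "B \<in> Ob D \<Longrightarrow> ar R (\<epsilon> B) \<cdot>\<^bsub>C\<^esub> \<eta> (ob R B) = Id C (ob R B)"


section \<open>Binary products, Cartesian squares, smooth morphisms\<close>

record ('s, 'm) products =
  prd :: "'s \<Rightarrow> 's \<Rightarrow> 's"
  pr1 :: "'s \<Rightarrow> 's \<Rightarrow> 'm"
  pr2 :: "'s \<Rightarrow> 's \<Rightarrow> 'm"

text \<open>The products \<open>S\<^sub>1 \<times> S\<^sub>2\<close> and their projections are an arbitrary choice, part of the data.\<close>

locale binary_products =
  category S for S :: "('s, 'm) cat" and X :: "('s, 'm) products" +
  assumes prd_in: "S1 \<in> Ob S \<Longrightarrow> S2 \<in> Ob S \<Longrightarrow> prd X S1 S2 \<in> Ob S"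
    and pr1_in: "S1 \<in> Ob S \<Longrightarrow> S2 \<in> Ob S \<Longrightarrow> pr1 X S1 S2 \<in> hom S (prd X S1 S2) S1"
    and pr2_in: "S1 \<in> Ob S \<Longrightarrow> S2 \<in> Ob S \<Longrightarrow> pr2 X S1 S2 \<in> hom S (prd X S1 S2) S2"
    and universal: "f1 \<in> hom S T S1 \<Longrightarrow> f2 \<in> hom S T S2 \<Longrightarrow>
      \<exists>!h. h \<in> hom S T (prd X S1 S2) \<and> pr1 X S1 S2 \<cdot>\<^bsub>S\<^esub> h = f1 \<and> pr2 X S1 S2 \<cdot>\<^bsub>S\<^esub> h = f2"

definition prd_ar :: "('s, 'm) cat \<Rightarrow> ('s, 'm) products \<Rightarrow> 'm \<Rightarrow> 'm \<Rightarrow> 'm" where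
  "prd_ar S X f1 f2 =
     (let T1 = Dom S f1; T2 = Dom S f2; S1 = Cod S f1; S2 = Cod S f2 in
      THE h. h \<in> hom S (prd X T1 T2) (prd X S1 S2) \<and>
             pr1 X S1 S2 \<cdot>\<^bsub>S\<^esub> h = f1 \<cdot>\<^bsub>S\<^esub> pr1 X T1 T2 \<and>
             pr2 X S1 S2 \<cdot>\<^bsub>S\<^esub> h = f2 \<cdot>\<^bsub>S\<^esub> pr2 X T1 T2)"

definition cartesian_square ::
  "('s, 'm) cat \<Rightarrow> 'm \<Rightarrow> 'm \<Rightarrow> 'm \<Rightarrow> 'm \<Rightarrow> bool" where
  "cartesian_square S p g p' g' \<longleftrightarrow>
     {p, g, p', g'} \<subseteq> Ar S \<and>
     Cod S p = Cod S g \<and> Dom S p' = Dom S g' \<and> Cod S g' = Dom S p \<and> Cod S p' = Dom S g \<and>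
     p \<cdot>\<^bsub>S\<^esub> g' = g \<cdot>\<^bsub>S\<^esub> p' \<and>
     (\<forall>Q a b. a \<in> hom S Q (Dom S p) \<and> b \<in> hom S Q (Dom S g) \<and> p \<cdot>\<^bsub>S\<^esub> a = g \<cdot>\<^bsub>S\<^esub> b \<longrightarrow>
        (\<exists>!h. h \<in> hom S Q (Dom S g') \<and> g' \<cdot>\<^bsub>S\<^esub> h = a \<and> p' \<cdot>\<^bsub>S\<^esub> h = b))"

text \<open>
  A subcategory is given by its set of arrows; its objects are those whose identity belongs to it.
  It need not contain all objects of \<open>S\<close>.
\<close>

locale smooth_subcategory =
  category S for S :: "('s, 'm) cat" and Sm :: "'m set" +
  assumes sm_ar: "Sm \<subseteq> Ar S"
    and sm_id: "p \<in> Sm \<Longrightarrow> Id S (Dom S p) \<in> Sm \<and> Id S (Cod S p) \<in> Sm"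
    and sm_comp: "p \<in> Sm \<Longrightarrow> q \<in> Sm \<Longrightarrow> Dom S q = Cod S p \<Longrightarrow> q \<cdot>\<^bsub>S\<^esub> p \<in> Sm"
    and sm_base_change: "cartesian_square S p g p' g' \<Longrightarrow> p \<in> Sm \<Longrightarrow> p' \<in> Sm"


section \<open>Fibered categories\<close>

text \<open>
  The fibres share one type of objects and one type of arrows, but have their own carriers.
  For \<open>f : T \<rightarrow> S\<close> and \<open>g : S \<rightarrow> V\<close>, \<open>conn H f g A : (g f)\<^sup>*A \<rightarrow> f\<^sup>*g\<^sup>*A\<close>.
\<close>

record ('s, 'm, 'o, 'a) fibered =
  fib  :: "'s \<Rightarrow> ('o, 'a) cat"
  pull :: "'m \<Rightarrow> ('o, 'a, 'o, 'a) funct"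
  conn :: "'m \<Rightarrow> 'm \<Rightarrow> 'o \<Rightarrow> 'a"

locale fibered_category =
  category S for S :: "('s, 'm) cat" and H :: "('s, 'm, 'o, 'a) fibered" +
  assumes fib_category: "T \<in> Ob S \<Longrightarrow> category (fib H T)"
    and pull_functor: "f \<in> hom S T U \<Longrightarrow> is_functor (fib H U) (fib H T) (pull H f)"
    and conn_iso: "f \<in> hom S T U \<Longrightarrow> g \<in> hom S U V \<Longrightarrow>
      natural_isomorphism (fib H V) (fib H T)
        (pull H (g \<cdot>\<^bsub>S\<^esub> f)) (pull H f \<circ>\<^sub>F pull H g) (conn H f g)"
    and pull_id_ob: "T \<in> Ob S \<Longrightarrow> A \<in> Ob (fib H T) \<Longrightarrow> ob (pull H (Id S T)) A = A"
    and pull_id_ar: "T \<in> Ob S \<Longrightarrow> u \<in> Ar (fib H T) \<Longrightarrow> ar (pull H (Id S T)) u = u"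
    and conn_id_left: "f \<in> hom S T U \<Longrightarrow> A \<in> Ob (fib H U) \<Longrightarrow>
      conn H (Id S T) f A = Id (fib H T) (ob (pull H f) A)"
    and conn_id_right: "f \<in> hom S T U \<Longrightarrow> A \<in> Ob (fib H U) \<Longrightarrow>
      conn H f (Id S U) A = Id (fib H T) (ob (pull H f) A)"
    and conn_cocycle: "f \<in> hom S T U \<Longrightarrow> g \<in> hom S U V \<Longrightarrow> h \<in> hom S V W \<Longrightarrow>
      A \<in> Ob (fib H W) \<Longrightarrow>
      ar (pull H f) (conn H g h A) \<cdot>\<^bsub>fib H T\<^esub> conn H f (h \<cdot>\<^bsub>S\<^esub> g) A =
      conn H f g (ob (pull H h) A) \<cdot>\<^bsub>fib H T\<^esub> conn H (g \<cdot>\<^bsub>S\<^esub> f) h A"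

text \<open>
  For a commutative square \<open>b a = d c\<close>, the isomorphism \<open>a\<^sup>*b\<^sup>*A \<rightarrow> c\<^sup>*d\<^sup>*A\<close> made of connection
  isomorphisms, usually written as an equality.
\<close>

definition exch ::
  "('s, 'm) cat \<Rightarrow> ('s, 'm, 'o, 'a) fibered \<Rightarrow> 'm \<Rightarrow> 'm \<Rightarrow> 'm \<Rightarrow> 'm \<Rightarrow> 'o \<Rightarrow> 'a" where
  "exch S H a b c d A =
     (let K = fib H (Dom S a) in conn H c d A \<cdot>\<^bsub>K\<^esub> inv_ar K (conn H a b A))"

text \<open>
  A chosen left adjoint \<open>p\<^sub>#\<close> (\<open>push\<close>) of \<open>p\<^sup>*\<close> with unit and counit; only the values at smooth
  \<open>p\<close> matter.
\<close>

record ('m, 'o, 'a) adjoints =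
  push :: "'m \<Rightarrow> ('o, 'a, 'o, 'a) funct"
  eta  :: "'m \<Rightarrow> 'o \<Rightarrow> 'a"
  eps  :: "'m \<Rightarrow> 'o \<Rightarrow> 'a"

definition base_change ::
  "('s, 'm) cat \<Rightarrow> ('s, 'm, 'o, 'a) fibered \<Rightarrow> ('m, 'o, 'a) adjoints \<Rightarrow>
   'm \<Rightarrow> 'm \<Rightarrow> 'm \<Rightarrow> 'm \<Rightarrow> 'o \<Rightarrow> 'a" where
  "base_change S H L p g p' g' A =
     (let K = fib H (Cod S p') in
      eps L p' (ob (pull H g) (ob (push L p) A)) \<cdot>\<^bsub>K\<^esub>
      ar (push L p') (exch S H g' p p' g (ob (push L p) A)) \<cdot>\<^bsub>K\<^esub>
      ar (push L p') (ar (pull H g') (eta L p A)))"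

locale geometric_fibered_category =
  fibered_category S H + smooth_subcategory S Sm
  for S :: "('s, 'm) cat" and Sm :: "'m set"
    and H :: "('s, 'm, 'o, 'a) fibered" and L :: "('m, 'o, 'a) adjoints" +
  assumes push_adjoint: "p \<in> Sm \<Longrightarrow>
      adjunction (fib H (Dom S p)) (fib H (Cod S p)) (push L p) (pull H p) (eta L p) (eps L p)"
    and base_change_iso: "cartesian_square S p g p' g' \<Longrightarrow> p \<in> Sm \<Longrightarrow>
      natural_isomorphism (fib H (Dom S p)) (fib H (Dom S g))
        (push L p' \<circ>\<^sub>F pull H g') (pull H g \<circ>\<^sub>F push L p) (base_change S H L p g p' g')"


section \<open>Internal tensor structures\<close>

record ('s, 'm, 'o, 'a) internal =
  itens :: "'s \<Rightarrow> ('o \<times> 'o, 'a \<times> 'a, 'o, 'a) funct"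
  imon  :: "'m \<Rightarrow> 'o \<times> 'o \<Rightarrow> 'a"

locale internal_tensor_structure =
  fibered_category S H
  for S :: "('s, 'm) cat" and H :: "('s, 'm, 'o, 'a) fibered"
    and N :: "('s, 'm, 'o, 'a) internal" +
  assumes itens_functor: "T \<in> Ob S \<Longrightarrow>
      is_functor (fib H T \<times>\<^sub>C fib H T) (fib H T) (itens N T)"
    and imon_iso: "f \<in> hom S T U \<Longrightarrow>
      natural_isomorphism (fib H U \<times>\<^sub>C fib H U) (fib H T)
        (itens N T \<circ>\<^sub>F (pull H f \<times>\<^sub>F pull H f)) (pull H f \<circ>\<^sub>F itens N U) (imon N f)"
    and imon_comp: "f \<in> hom S T U \<Longrightarrow> g \<in> hom S U V \<Longrightarrow>
      A \<in> Ob (fib H V) \<Longrightarrow> B \<in> Ob (fib H V) \<Longrightarrow>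
      conn H f g (ob (itens N V) (A, B)) \<cdot>\<^bsub>fib H T\<^esub> imon N (g \<cdot>\<^bsub>S\<^esub> f) (A, B) =
      ar (pull H f) (imon N g (A, B)) \<cdot>\<^bsub>fib H T\<^esub>
      imon N f (ob (pull H g) A, ob (pull H g) B) \<cdot>\<^bsub>fib H T\<^esub>
      ar (itens N T) (conn H f g A, conn H f g B)"

definition projection_left ::
  "('s, 'm) cat \<Rightarrow> ('s, 'm, 'o, 'a) fibered \<Rightarrow> ('m, 'o, 'a) adjoints \<Rightarrow>
   ('s, 'm, 'o, 'a) internal \<Rightarrow> 'm \<Rightarrow> 'o \<times> 'o \<Rightarrow> 'a" where
  "projection_left S H L N p = (\<lambda>(A, B).
     let P = Dom S p; K = fib H (Cod S p) in
     eps L p (ob (itens N (Cod S p)) (ob (push L p) A, B)) \<cdot>\<^bsub>K\<^esub>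
     ar (push L p) (imon N p (ob (push L p) A, B)) \<cdot>\<^bsub>K\<^esub>
     ar (push L p) (ar (itens N P) (eta L p A, Id (fib H P) (ob (pull H p) B))))"

definition projection_right ::
  "('s, 'm) cat \<Rightarrow> ('s, 'm, 'o, 'a) fibered \<Rightarrow> ('m, 'o, 'a) adjoints \<Rightarrow>
   ('s, 'm, 'o, 'a) internal \<Rightarrow> 'm \<Rightarrow> 'o \<times> 'o \<Rightarrow> 'a" where
  "projection_right S H L N p = (\<lambda>(A, B).
     let P = Dom S p; K = fib H (Cod S p) in
     eps L p (ob (itens N (Cod S p)) (A, ob (push L p) B)) \<cdot>\<^bsub>K\<^esub>
     ar (push L p) (imon N p (A, ob (push L p) B)) \<cdot>\<^bsub>K\<^esub>
     ar (push L p) (ar (itens N P) (Id (fib H P) (ob (pull H p) A), eta L p B)))"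

definition geometric_internal ::
  "('s, 'm) cat \<Rightarrow> 'm set \<Rightarrow> ('s, 'm, 'o, 'a) fibered \<Rightarrow> ('m, 'o, 'a) adjoints \<Rightarrow>
   ('s, 'm, 'o, 'a) internal \<Rightarrow> bool" where
  "geometric_internal S Sm H L N \<longleftrightarrow> (\<forall>p \<in> Sm. let P = Dom S p; U = Cod S p in
     natural_isomorphism (fib H P \<times>\<^sub>C fib H U) (fib H U)
       (push L p \<circ>\<^sub>F itens N P \<circ>\<^sub>F (id_funct \<times>\<^sub>F pull H p))
       (itens N U \<circ>\<^sub>F (push L p \<times>\<^sub>F id_funct))
       (projection_left S H L N p) \<and>
     natural_isomorphism (fib H U \<times>\<^sub>C fib H P) (fib H U)
       (push L p \<circ>\<^sub>F itens N P \<circ>\<^sub>F (pull H p \<times>\<^sub>F id_funct))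
       (itens N U \<circ>\<^sub>F (id_funct \<times>\<^sub>F push L p))
       (projection_right S H L N p))"


section \<open>External tensor structures\<close>

record ('s, 'm, 'o, 'a) external =
  etens :: "'s \<Rightarrow> 's \<Rightarrow> ('o \<times> 'o, 'a \<times> 'a, 'o, 'a) funct"
  emon  :: "'m \<Rightarrow> 'm \<Rightarrow> 'o \<times> 'o \<Rightarrow> 'a"

locale external_tensor_structure =
  fibered_category S H + binary_products S X
  for S :: "('s, 'm) cat" and X :: "('s, 'm) products"
    and H :: "('s, 'm, 'o, 'a) fibered" and M :: "('s, 'm, 'o, 'a) external" +
  assumes etens_functor: "S1 \<in> Ob S \<Longrightarrow> S2 \<in> Ob S \<Longrightarrow>
      is_functor (fib H S1 \<times>\<^sub>C fib H S2) (fib H (prd X S1 S2)) (etens M S1 S2)"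
    and emon_iso: "f1 \<in> hom S T1 S1 \<Longrightarrow> f2 \<in> hom S T2 S2 \<Longrightarrow>
      natural_isomorphism (fib H S1 \<times>\<^sub>C fib H S2) (fib H (prd X T1 T2))
        (etens M T1 T2 \<circ>\<^sub>F (pull H f1 \<times>\<^sub>F pull H f2))
        (pull H (prd_ar S X f1 f2) \<circ>\<^sub>F etens M S1 S2)
        (emon M f1 f2)"
    and emon_comp: "f1 \<in> hom S T1 S1 \<Longrightarrow> f2 \<in> hom S T2 S2 \<Longrightarrow>
      g1 \<in> hom S S1 V1 \<Longrightarrow> g2 \<in> hom S S2 V2 \<Longrightarrow>
      A1 \<in> Ob (fib H V1) \<Longrightarrow> A2 \<in> Ob (fib H V2) \<Longrightarrow>
      conn H (prd_ar S X f1 f2) (prd_ar S X g1 g2) (ob (etens M V1 V2) (A1, A2))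
        \<cdot>\<^bsub>fib H (prd X T1 T2)\<^esub> emon M (g1 \<cdot>\<^bsub>S\<^esub> f1) (g2 \<cdot>\<^bsub>S\<^esub> f2) (A1, A2) =
      ar (pull H (prd_ar S X f1 f2)) (emon M g1 g2 (A1, A2)) \<cdot>\<^bsub>fib H (prd X T1 T2)\<^esub>
      emon M f1 f2 (ob (pull H g1) A1, ob (pull H g2) A2) \<cdot>\<^bsub>fib H (prd X T1 T2)\<^esub>
      ar (etens M T1 T2) (conn H f1 g1 A1, conn H f2 g2 A2)"

definition external_equivalence ::
  "('s, 'm) cat \<Rightarrow> ('s, 'm) products \<Rightarrow> ('s, 'm, 'o, 'a) fibered \<Rightarrow>
   ('s, 'm, 'o, 'a) external \<Rightarrow> ('s, 'm, 'o, 'a) external \<Rightarrow>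
   ('s \<Rightarrow> 's \<Rightarrow> 'o \<times> 'o \<Rightarrow> 'a) \<Rightarrow> bool" where
  "external_equivalence S X H M M' e \<longleftrightarrow>
     (\<forall>S1 \<in> Ob S. \<forall>S2 \<in> Ob S.
        natural_isomorphism (fib H S1 \<times>\<^sub>C fib H S2) (fib H (prd X S1 S2))
          (etens M S1 S2) (etens M' S1 S2) (e S1 S2)) \<and>
     (\<forall>T1 S1 T2 S2. \<forall>f1 \<in> hom S T1 S1. \<forall>f2 \<in> hom S T2 S2.
        \<forall>A1 \<in> Ob (fib H S1). \<forall>A2 \<in> Ob (fib H S2).
        ar (pull H (prd_ar S X f1 f2)) (e S1 S2 (A1, A2))
          \<cdot>\<^bsub>fib H (prd X T1 T2)\<^esub> emon M f1 f2 (A1, A2) =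
        emon M' f1 f2 (A1, A2)
          \<cdot>\<^bsub>fib H (prd X T1 T2)\<^esub> e T1 T2 (ob (pull H f1) A1, ob (pull H f2) A2))"

definition external_equivalent ::
  "('s, 'm) cat \<Rightarrow> ('s, 'm) products \<Rightarrow> ('s, 'm, 'o, 'a) fibered \<Rightarrow>
   ('s, 'm, 'o, 'a) external \<Rightarrow> ('s, 'm, 'o, 'a) external \<Rightarrow> bool" where
  "external_equivalent S X H M M' \<longleftrightarrow> (\<exists>e. external_equivalence S X H M M' e)"

text \<open>
  In the two maps below, the source of \<open>m\<^bsub>p,id\<^esub>\<close> (resp.\ \<open>m\<^bsub>id,p\<^esub>\<close>) involves \<open>id\<^sup>*\<close>, which is the
  identity functor by strict unitality.
\<close>

definition external_projection_left ::
  "('s, 'm) cat \<Rightarrow> ('s, 'm) products \<Rightarrow> ('s, 'm, 'o, 'a) fibered \<Rightarrow> ('m, 'o, 'a) adjoints \<Rightarrow>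
   ('s, 'm, 'o, 'a) external \<Rightarrow> 'm \<Rightarrow> 's \<Rightarrow> 'o \<times> 'o \<Rightarrow> 'a" where
  "external_projection_left S X H L M p S2 = (\<lambda>(A1, A2).
     let P = Dom S p; S1 = Cod S p; q = prd_ar S X p (Id S S2); K = fib H (prd X S1 S2) in
     eps L q (ob (etens M S1 S2) (ob (push L p) A1, A2)) \<cdot>\<^bsub>K\<^esub>
     ar (push L q) (emon M p (Id S S2) (ob (push L p) A1, A2)) \<cdot>\<^bsub>K\<^esub>
     ar (push L q) (ar (etens M P S2) (eta L p A1, Id (fib H S2) A2)))"

definition external_projection_right ::
  "('s, 'm) cat \<Rightarrow> ('s, 'm) products \<Rightarrow> ('s, 'm, 'o, 'a) fibered \<Rightarrow> ('m, 'o, 'a) adjoints \<Rightarrow>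
   ('s, 'm, 'o, 'a) external \<Rightarrow> 's \<Rightarrow> 'm \<Rightarrow> 'o \<times> 'o \<Rightarrow> 'a" where
  "external_projection_right S X H L M S1 p = (\<lambda>(A1, A2).
     let P = Dom S p; S2 = Cod S p; q = prd_ar S X (Id S S1) p; K = fib H (prd X S1 S2) in
     eps L q (ob (etens M S1 S2) (A1, ob (push L p) A2)) \<cdot>\<^bsub>K\<^esub>
     ar (push L q) (emon M (Id S S1) p (A1, ob (push L p) A2)) \<cdot>\<^bsub>K\<^esub>
     ar (push L q) (ar (etens M S1 P) (Id (fib H S1) A1, eta L p A2)))"

definition geometric_external ::
  "('s, 'm) cat \<Rightarrow> ('s, 'm) products \<Rightarrow> 'm set \<Rightarrow> ('s, 'm, 'o, 'a) fibered \<Rightarrow>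
   ('m, 'o, 'a) adjoints \<Rightarrow> ('s, 'm, 'o, 'a) external \<Rightarrow> bool" where
  "geometric_external S X Sm H L M \<longleftrightarrow> (\<forall>p1 \<in> Sm. \<forall>p2 \<in> Sm.
     let P1 = Dom S p1; S1 = Cod S p1; P2 = Dom S p2; S2 = Cod S p2 in
     natural_isomorphism (fib H P1 \<times>\<^sub>C fib H S2) (fib H (prd X S1 S2))
       (push L (prd_ar S X p1 (Id S S2)) \<circ>\<^sub>F etens M P1 S2)
       (etens M S1 S2 \<circ>\<^sub>F (push L p1 \<times>\<^sub>F id_funct))
       (external_projection_left S X H L M p1 S2) \<and>
     natural_isomorphism (fib H S1 \<times>\<^sub>C fib H P2) (fib H (prd X S1 S2))
       (push L (prd_ar S X (Id S S1) p2) \<circ>\<^sub>F etens M S1 P2)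
       (etens M S1 S2 \<circ>\<^sub>F (id_funct \<times>\<^sub>F push L p2))
       (external_projection_right S X H L M S1 p2))"


section \<open>The external tensor structure attached to an internal one\<close>

definition ext_of_int ::
  "('s, 'm) cat \<Rightarrow> ('s, 'm) products \<Rightarrow> ('s, 'm, 'o, 'a) fibered \<Rightarrow>
   ('s, 'm, 'o, 'a) internal \<Rightarrow> ('s, 'm, 'o, 'a) external" where
  "ext_of_int S X H N =
     \<lparr>etens = \<lambda>S1 S2. itens N (prd X S1 S2) \<circ>\<^sub>F (pull H (pr1 X S1 S2) \<times>\<^sub>F pull H (pr2 X S1 S2)),
      emon = \<lambda>f1 f2 (A1, A2).
        let T1 = Dom S f1; T2 = Dom S f2; S1 = Cod S f1; S2 = Cod S f2; f = prd_ar S X f1 f2 in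
        imon N f (ob (pull H (pr1 X S1 S2)) A1, ob (pull H (pr2 X S1 S2)) A2)
          \<cdot>\<^bsub>fib H (prd X T1 T2)\<^esub>
        ar (itens N (prd X T1 T2))
          (exch S H (pr1 X T1 T2) f1 f (pr1 X S1 S2) A1,
           exch S H (pr2 X T1 T2) f2 f (pr2 X S1 S2) A2)\<rparr>"

end

theory Submission
  imports Defs
begin

text \<open>
  All natural transformations in the two definitions of being geometric have one shape: an arrow
  \<open>\<phi> : A \<rightarrow> p\<^sup>*Y\<close> is sent to its transpose \<open>p\<^sub># A \<rightarrow> p\<^sub># p\<^sup>*Y \<rightarrow> Y\<close>. Call \<open>\<phi>\<close> universal when this transpose is
  invertible, that is, when \<open>Y\<close> with \<open>\<phi>\<close> is a value of the left adjoint \<open>p\<^sub>#\<close> at \<open>A\<close>. The base change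
  axiom then says that pulling back along a Cartesian square preserves universal arrows
  (\<open>universal_base_change\<close>), and a tensor structure is geometric iff certain products of a unit
  \<open>A \<rightarrow> p\<^sup>*p\<^sub># A\<close> with an identity are universal (\<open>geometric_internal_iff\<close>, \<open>geometric_external_iff\<close>).
  Universality does not change when isomorphisms are inserted at either end (\<open>universal_cong\<close>), so
  everything reduces to identities between arrows of the form \<open>A \<rightarrow> p\<^sup>*Y\<close>.
  
  An equivalence of external structures only inserts such isomorphisms, so \<open>\<boxtimes>\<close> may be replaced by
  \<open>pr\<^sub>1\<^sup>*(_) \<otimes> pr\<^sub>2\<^sup>*(_)\<close> (\<open>universal_epairing_iff\<close>).
  
  From internal to external: for smooth \<open>p : P \<rightarrow> U\<close> the map \<open>q = p \<times> id\<^sub>W\<close> is the base change of \<open>p\<close> along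
  \<open>pr\<^sub>1 : U \<times> W \<rightarrow> U\<close>. Hence the unit of \<open>p\<close>, pulled back to \<open>P \<times> W\<close>, is a \<open>q\<close>-universal arrow, and its internal
  product with the isomorphism \<open>pr\<^sub>2\<^sup>*A\<^sub>2 \<rightarrow> q\<^sup>*pr\<^sub>2\<^sup>*A\<^sub>2\<close> is universal by the projection formula for \<open>q\<close>.
  
  From external to internal: \<open>p\<close> is in turn the base change of \<open>p \<times> id\<^sub>U\<close> along the diagonal of \<open>U\<close>, by way
  of the graph \<open>(id, p) : P \<rightarrow> P \<times> U\<close>. Pulling back the universal arrow on \<open>P \<times> U\<close> along the graph yields,
  up to coherence isomorphisms, the arrow \<open>A \<otimes> p\<^sup>*B \<rightarrow> p\<^sup>*(p\<^sub># A \<otimes> B)\<close> of the internal projection formula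
  (\<open>universal_diagonal_restriction\<close>). The coherence isomorphisms match because internal products
  commute with pullback along commutative squares (\<open>pairing_base_change\<close>) and because pulling back along
  two pasted squares agrees with pulling back along the outer one (\<open>exch_restrict_twice\<close>).
\<close>

section \<open>Isomorphisms and product categories\<close>

context category
begin

lemma isoI:
  assumes "f \<in> hom C A B" "g \<in> hom C B A" "g \<cdot> f = Id C A" "f \<cdot> g = Id C B"
  shows "iso C f"
  using assms unfolding iso_def inverse_arrows_def hom_def by auto

lemma isoE:
  assumes "f \<in> hom C A B" "iso C f"
  obtains g where "g \<in> hom C B A" "g \<cdot> f = Id C A" "f \<cdot> g = Id C B"
  using assms unfolding iso_def inverse_arrows_def hom_def by auto

lemma hom_Ob: "f \<in> hom C A B \<Longrightarrow> A \<in> Ob C \<and> B \<in> Ob C"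
  using dom_cod unfolding hom_def by auto

lemma iso_Id: "A \<in> Ob C \<Longrightarrow> iso C (Id C A)"
  using isoI id_in_hom id_comp by metis

lemma inverse_arrows_unique:
  assumes "inverse_arrows C f g" "inverse_arrows C f h"
  shows "g = h"
proof -
  let ?A = "Dom C f" and ?B = "Cod C f"
  have f: "f \<in> hom C ?A ?B" and g: "g \<in> hom C ?B ?A" and h: "h \<in> hom C ?B ?A"
    and "g \<cdot> f = Id C ?A" "f \<cdot> h = Id C ?B"
    using assms unfolding inverse_arrows_def by auto
  then have "g = g \<cdot> (f \<cdot> h)" using comp_id by simp
  also have "\<dots> = h" using comp_assoc[OF h f g] \<open>g \<cdot> f = _\<close> id_comp[OF h] by simp
  finally show ?thesis .
qed

lemma inv_ar_inverse:
  assumes "f \<in> hom C A B" "iso C f"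
  shows "inv_ar C f \<in> hom C B A \<and> inv_ar C f \<cdot> f = Id C A \<and> f \<cdot> inv_ar C f = Id C B"
proof -
  obtain g where g: "inverse_arrows C f g" using assms(2) unfolding iso_def by blast
  have "inverse_arrows C f (inv_ar C f)"
    unfolding inv_ar_def using theI[of "inverse_arrows C f", OF g] inverse_arrows_unique[OF _ g]
    by blast
  then show ?thesis using assms(1) unfolding inverse_arrows_def hom_def by auto
qed

lemma iso_inv_ar:
  assumes "f \<in> hom C A B" "iso C f"
  shows "iso C (inv_ar C f)"
  using inv_ar_inverse[OF assms] assms(1) isoI by blast

lemma iso_comp:
  assumes f: "f \<in> hom C A B" "iso C f" and g: "g \<in> hom C B D" "iso C g"
  shows "iso C (g \<cdot> f)"
proof -
  obtain f' where f': "f' \<in> hom C B A" "f' \<cdot> f = Id C A" "f \<cdot> f' = Id C B"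
    using isoE[OF f] .
  obtain g' where g': "g' \<in> hom C D B" "g' \<cdot> g = Id C B" "g \<cdot> g' = Id C D"
    using isoE[OF g] .
  have gf: "g \<cdot> f \<in> hom C A D" and fg: "f' \<cdot> g' \<in> hom C D A"
    using comp_in_hom f g f' g' by blast+
  have "(f' \<cdot> g') \<cdot> (g \<cdot> f) = f' \<cdot> (g' \<cdot> (g \<cdot> f))"
    using comp_assoc[OF gf g'(1) f'(1)] .
  also have "\<dots> = f' \<cdot> f" using comp_assoc[OF f(1) g(1) g'(1)] g' id_comp[OF f(1)] by simp
  finally have 1: "(f' \<cdot> g') \<cdot> (g \<cdot> f) = Id C A" using f' by simp
  have "(g \<cdot> f) \<cdot> (f' \<cdot> g') = g \<cdot> (f \<cdot> (f' \<cdot> g'))"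
    using comp_assoc[OF fg f(1) g(1)] .
  also have "\<dots> = g \<cdot> g'" using comp_assoc[OF g'(1) f'(1) f(1)] f' id_comp[OF g'(1)] by simp
  finally have 2: "(g \<cdot> f) \<cdot> (f' \<cdot> g') = Id C D" using g' by simp
  show ?thesis using isoI[OF gf fg 1 2] .
qed

lemma iso_comp_left_iff:
  assumes f: "f \<in> hom C A B" and g: "g \<in> hom C B D" "iso C g"
  shows "iso C (g \<cdot> f) \<longleftrightarrow> iso C f"
proof
  assume gf: "iso C (g \<cdot> f)"
  obtain g' where g': "g' \<in> hom C D B" "g' \<cdot> g = Id C B" "g \<cdot> g' = Id C D"
    using isoE[OF g] .
  have "iso C (g' \<cdot> (g \<cdot> f))"
    using iso_comp[OF comp_in_hom[OF f g(1)] gf g'(1)] isoI[OF g'(1) g(1) g'(3,2)] by blast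
  then show "iso C f" using comp_assoc[OF f g(1) g'(1)] g' id_comp[OF f] by simp
qed (use iso_comp assms in blast)

lemma iso_comp_right_iff:
  assumes f: "f \<in> hom C A B" "iso C f" and g: "g \<in> hom C B D"
  shows "iso C (g \<cdot> f) \<longleftrightarrow> iso C g"
proof
  assume gf: "iso C (g \<cdot> f)"
  obtain f' where f': "f' \<in> hom C B A" "f' \<cdot> f = Id C A" "f \<cdot> f' = Id C B"
    using isoE[OF f] .
  have "iso C ((g \<cdot> f) \<cdot> f')"
    using iso_comp[OF f'(1) _ comp_in_hom[OF f(1) g] gf] isoI[OF f'(1) f(1) f'(3,2)] by blast
  then show "iso C g" using comp_assoc[OF f'(1) f(1) g] f' comp_id[OF g] by simp
qed (use iso_comp assms in blast)

lemma iso_epi: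
  assumes f: "f \<in> hom C A B" "iso C f" and g: "g \<in> hom C B D" "g' \<in> hom C B D"
    and eq: "g \<cdot> f = g' \<cdot> f"
  shows "g = g'"
proof -
  obtain f' where f': "f' \<in> hom C B A" "f \<cdot> f' = Id C B" using isoE[OF f] by metis
  have "h = (h \<cdot> f) \<cdot> f'" if "h \<in> hom C B D" for h
    using comp_assoc[OF f'(1) f(1) that] f' comp_id[OF that] by simp
  then show ?thesis using g eq by metis
qed

lemma homD: "f \<in> hom C A B \<Longrightarrow> f \<in> Ar C" "f \<in> hom C A B \<Longrightarrow> Dom C f = A"
  "f \<in> hom C A B \<Longrightarrow> Cod C f = B"
  by (auto simp: hom_def)

lemma comp_typing:
  assumes "f \<in> Ar C" "g \<in> Ar C" "Dom C g = Cod C f"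
  shows "g \<cdot> f \<in> Ar C" "Dom C (g \<cdot> f) = Dom C f" "Cod C (g \<cdot> f) = Cod C g"
  using comp_in_hom[of f "Dom C f" "Cod C f" g "Cod C g"] assms by (auto simp: hom_def)

lemma comp_assoc_Ar:
  "f \<in> Ar C \<Longrightarrow> g \<in> Ar C \<Longrightarrow> h \<in> Ar C \<Longrightarrow> Dom C g = Cod C f \<Longrightarrow> Dom C h = Cod C g \<Longrightarrow>
    (h \<cdot> g) \<cdot> f = h \<cdot> (g \<cdot> f)"
  using comp_assoc by (auto simp: hom_def)

end

lemma (in is_functor) iso_ar:
  assumes f: "f \<in> hom C A B" and "iso C f"
  shows "iso D (ar F f)"
proof -
  obtain g where g: "g \<in> hom C B A" "g \<cdot>\<^bsub>C\<^esub> f = Id C A" "f \<cdot>\<^bsub>C\<^esub> g = Id C B"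
    using C.isoE[OF assms] .
  show ?thesis
    using D.isoI[OF ar_in[OF f] ar_in[OF g(1)]] ar_comp[OF f g(1)] ar_comp[OF g(1) f] g
      ar_id C.hom_Ob[OF f] by simp
qed

lemma comp_funct_simps [simp]:
  "ob (G \<circ>\<^sub>F F) A = ob G (ob F A)" "ar (G \<circ>\<^sub>F F) f = ar G (ar F f)"
  "ob id_funct A = A" "ar id_funct f = f"
  "ob (F1 \<times>\<^sub>F F2) (A1, A2) = (ob F1 A1, ob F2 A2)"
  "ar (F1 \<times>\<^sub>F F2) (f1, f2) = (ar F1 f1, ar F2 f2)"
  by (auto simp: comp_funct_def id_funct_def prod_funct_def)

lemma prod_cat_simps [simp]:
  "Ob (C \<times>\<^sub>C D) = Ob C \<times> Ob D"
  "Id (C \<times>\<^sub>C D) (A, B) = (Id C A, Id D B)"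
  "(f', g') \<cdot>\<^bsub>C \<times>\<^sub>C D\<^esub> (f, g) = (f' \<cdot>\<^bsub>C\<^esub> f, g' \<cdot>\<^bsub>D\<^esub> g)"
  "(f, g) \<in> hom (C \<times>\<^sub>C D) (A, B) (A', B') \<longleftrightarrow> f \<in> hom C A A' \<and> g \<in> hom D B B'"
  by (auto simp: prod_cat_def hom_def)

lemma category_prod:
  assumes "category C" "category D"
  shows "category (C \<times>\<^sub>C D)"
proof -
  interpret C: category C by fact
  interpret D: category D by fact
  show ?thesis
  proof (unfold_locales, goal_cases)
    case (1 f)
    then show ?case using C.dom_cod D.dom_cod by (auto simp: prod_cat_def)
  next
    case (2 A)
    then show ?case using C.id_in_hom D.id_in_hom by auto
  next
    case (3 f A B g E)
    then show ?case using C.comp_in_hom D.comp_in_hom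
      by (cases f; cases g; cases A; cases B; cases E) auto
  next
    case (4 f A B)
    then show ?case using C.id_comp D.id_comp by (cases f; cases A; cases B) auto
  next
    case (5 f A B)
    then show ?case using C.comp_id D.comp_id by (cases f; cases A; cases B) auto
  next
    case (6 f A B g E h G)
    then show ?case using C.comp_assoc D.comp_assoc
      by (cases f; cases g; cases h; cases A; cases B; cases E; cases G) auto
  qed
qed

lemma is_functor_id: "category C \<Longrightarrow> is_functor C C id_funct"
  by (simp add: is_functor_def is_functor_axioms_def)

lemma is_functor_comp:
  assumes "is_functor C D F" "is_functor D E G"
  shows "is_functor C E (G \<circ>\<^sub>F F)"
proof -
  interpret F: is_functor C D F by fact
  interpret G: is_functor D E G by fact
  show ?thesis
    by unfold_locales
      (simp_all add: F.ob_in G.ob_in F.ar_in G.ar_in F.ar_id G.ar_id F.ar_comp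
        G.ar_comp[OF F.ar_in F.ar_in])
qed

lemma is_functor_prod:
  assumes "is_functor C1 D1 F1" "is_functor C2 D2 F2"
  shows "is_functor (C1 \<times>\<^sub>C C2) (D1 \<times>\<^sub>C D2) (F1 \<times>\<^sub>F F2)"
proof -
  interpret F1: is_functor C1 D1 F1 by fact
  interpret F2: is_functor C2 D2 F2 by fact
  interpret C: category "C1 \<times>\<^sub>C C2" by (rule category_prod) unfold_locales
  interpret D: category "D1 \<times>\<^sub>C D2" by (rule category_prod) unfold_locales
  show ?thesis
    apply unfold_locales
    using F1.ob_in F2.ob_in F1.ar_in F2.ar_in F1.ar_id F2.ar_id F1.ar_comp F2.ar_comp by auto
qed

lemma iso_prod:
  assumes "category C" "category D"
    and "f \<in> hom C A A'" "g \<in> hom D B B'" "iso C f" "iso D g"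
  shows "iso (C \<times>\<^sub>C D) (f, g)"
proof -
  interpret P: category "C \<times>\<^sub>C D" using category_prod assms by blast
  obtain f' where f': "f' \<in> hom C A' A" "f' \<cdot>\<^bsub>C\<^esub> f = Id C A" "f \<cdot>\<^bsub>C\<^esub> f' = Id C A'"
    using category.isoE assms(1,3,5) by metis
  obtain g' where g': "g' \<in> hom D B' B" "g' \<cdot>\<^bsub>D\<^esub> g = Id D B" "g \<cdot>\<^bsub>D\<^esub> g' = Id D B'"
    using category.isoE assms(2,4,6) by metis
  show ?thesis
    by (rule P.isoI[of _ "(A, B)" "(A', B')" "(f', g')"]) (use assms f' g' in auto)
qed

lemma natural_isomorphism_iff:
  assumes "is_functor C D F" "is_functor C D G"
  shows "natural_isomorphism C D F G \<tau> \<longleftrightarrow>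
    (\<forall>A \<in> Ob C. \<tau> A \<in> hom D (ob F A) (ob G A) \<and> iso D (\<tau> A)) \<and>
    (\<forall>f A B. f \<in> hom C A B \<longrightarrow> ar G f \<cdot>\<^bsub>D\<^esub> \<tau> A = \<tau> B \<cdot>\<^bsub>D\<^esub> ar F f)"
  using assms unfolding natural_isomorphism_def natural_isomorphism_axioms_def
    natural_transformation_def natural_transformation_axioms_def by blast

section \<open>Universal arrows of an adjunction\<close>

context adjunction
begin

lemma unit_in: "A \<in> Ob C \<Longrightarrow> \<eta> A \<in> hom C A (ob R (ob L A))"
  and unit_natural: "f \<in> hom C A B \<Longrightarrow> ar R (ar L f) \<cdot>\<^bsub>C\<^esub> \<eta> A = \<eta> B \<cdot>\<^bsub>C\<^esub> f"
  and counit_in: "Y \<in> Ob D \<Longrightarrow> \<epsilon> Y \<in> hom D (ob L (ob R Y)) Y"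
  and counit_natural: "g \<in> hom D Y Y' \<Longrightarrow> g \<cdot>\<^bsub>D\<^esub> \<epsilon> Y = \<epsilon> Y' \<cdot>\<^bsub>D\<^esub> ar L (ar R g)"
  using unit.component_in[of A] unit.naturality[of f A B] counit.component_in[of Y]
    counit.naturality[of g Y Y'] by auto

definition transpose :: "'p \<Rightarrow> 'a \<Rightarrow> 'b" where
  "transpose Y \<phi> = \<epsilon> Y \<cdot>\<^bsub>D\<^esub> ar L \<phi>"

lemma transpose_in:
  assumes "\<phi> \<in> hom C A (ob R Y)" "Y \<in> Ob D"
  shows "transpose Y \<phi> \<in> hom D (ob L A) Y"
  unfolding transpose_def using assms L.ar_in counit_in counit.F.C.comp_in_hom by blast

lemma transpose_unit: "A \<in> Ob C \<Longrightarrow> transpose (ob L A) (\<eta> A) = Id D (ob L A)"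
  unfolding transpose_def by (rule triangle_left)

lemma untranspose:
  assumes \<phi>: "\<phi> \<in> hom C A (ob R Y)" and Y: "Y \<in> Ob D"
  shows "ar R (transpose Y \<phi>) \<cdot>\<^bsub>C\<^esub> \<eta> A = \<phi>"
proof -
  note hs = unit_in[of A] R.ar_in[OF L.ar_in[OF \<phi>]] R.ar_in[OF counit_in[OF Y]]
  have A: "A \<in> Ob C" and RY: "ob R Y \<in> Ob C" using unit.F.C.hom_Ob[OF \<phi>] by auto
  have "ar R (transpose Y \<phi>) \<cdot>\<^bsub>C\<^esub> \<eta> A = ar R (\<epsilon> Y) \<cdot>\<^bsub>C\<^esub> (ar R (ar L \<phi>) \<cdot>\<^bsub>C\<^esub> \<eta> A)"
    unfolding transpose_def R.ar_comp[OF L.ar_in[OF \<phi>] counit_in[OF Y]]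
    using unit.F.C.comp_assoc hs A by blast
  also have "\<dots> = (ar R (\<epsilon> Y) \<cdot>\<^bsub>C\<^esub> \<eta> (ob R Y)) \<cdot>\<^bsub>C\<^esub> \<phi>"
    unfolding unit_natural[OF \<phi>]
    using unit.F.C.comp_assoc[OF \<phi> unit_in[OF RY] R.ar_in[OF counit_in[OF Y]]] by simp
  also have "\<dots> = \<phi>" using triangle_right[OF Y] unit.F.C.id_comp[OF \<phi>] by simp
  finally show ?thesis .
qed

lemma transpose_natural:
  assumes \<phi>: "\<phi> \<in> hom C A (ob R Y)" and \<phi>': "\<phi>' \<in> hom C A' (ob R Y')"
    and x: "x \<in> hom C A A'" and y: "y \<in> hom D Y Y'"
    and eq: "\<phi>' \<cdot>\<^bsub>C\<^esub> x = ar R y \<cdot>\<^bsub>C\<^esub> \<phi>"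
  shows "transpose Y' \<phi>' \<cdot>\<^bsub>D\<^esub> ar L x = y \<cdot>\<^bsub>D\<^esub> transpose Y \<phi>"
proof -
  have Y: "Y \<in> Ob D" and Y': "Y' \<in> Ob D" using counit.F.C.hom_Ob[OF y] by auto
  have "transpose Y' \<phi>' \<cdot>\<^bsub>D\<^esub> ar L x = \<epsilon> Y' \<cdot>\<^bsub>D\<^esub> ar L (\<phi>' \<cdot>\<^bsub>C\<^esub> x)"
    unfolding transpose_def L.ar_comp[OF x \<phi>']
    by (rule counit.F.C.comp_assoc[OF L.ar_in[OF x] L.ar_in[OF \<phi>'] counit_in[OF Y']])
  also have "\<dots> = (\<epsilon> Y' \<cdot>\<^bsub>D\<^esub> ar L (ar R y)) \<cdot>\<^bsub>D\<^esub> ar L \<phi>"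
    unfolding eq L.ar_comp[OF \<phi> R.ar_in[OF y]]
    using counit.F.C.comp_assoc[OF L.ar_in[OF \<phi>] L.ar_in[OF R.ar_in[OF y]] counit_in[OF Y']] by simp
  also have "\<dots> = y \<cdot>\<^bsub>D\<^esub> transpose Y \<phi>"
    unfolding transpose_def counit_natural[OF y, symmetric]
    by (rule counit.F.C.comp_assoc[OF L.ar_in[OF \<phi>] counit_in[OF Y] y])
  finally show ?thesis .
qed

text \<open>
  Equivalent to \<open>\<phi>\<close> being initial among the arrows from a given object to the functor \<open>R\<close>; invertibility of
  the transpose is the form in which the conditions on tensor structures and on base change are given.
\<close>

definition universal :: "'p \<Rightarrow> 'a \<Rightarrow> bool" where
  "universal Y \<phi> \<longleftrightarrow> iso D (transpose Y \<phi>)"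

lemma universal_unit: "A \<in> Ob C \<Longrightarrow> universal (ob L A) (\<eta> A)"
  unfolding universal_def transpose_unit using counit.F.C.iso_Id L.ob_in by simp

lemma universalE:
  assumes \<phi>: "\<phi> \<in> hom C A (ob R Y)" and Y: "Y \<in> Ob D" and univ: "universal Y \<phi>"
  obtains y where "y \<in> hom D (ob L A) Y" "iso D y" "ar R y \<cdot>\<^bsub>C\<^esub> \<eta> A = \<phi>"
  using transpose_in[OF \<phi> Y] untranspose[OF \<phi> Y] univ unfolding universal_def by blast

text \<open>
  Transposition turns the square into one with the invertible sides \<open>L x\<close> and \<open>y\<close>, whose other two
  sides are the transposes of \<open>\<phi>\<close> and \<open>\<phi>'\<close>.
\<close>

lemma universal_cong:
  assumes \<phi>: "\<phi> \<in> hom C A (ob R Y)" and \<phi>': "\<phi>' \<in> hom C A' (ob R Y')"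
    and x: "x \<in> hom C A A'" "iso C x" and y: "y \<in> hom D Y Y'" "iso D y"
    and eq: "\<phi>' \<cdot>\<^bsub>C\<^esub> x = ar R y \<cdot>\<^bsub>C\<^esub> \<phi>"
  shows "universal Y \<phi> \<longleftrightarrow> universal Y' \<phi>'"
proof -
  have Y: "Y \<in> Ob D" and Y': "Y' \<in> Ob D" using counit.F.C.hom_Ob[OF y(1)] by auto
  show ?thesis
    unfolding universal_def
    using transpose_natural[OF \<phi> \<phi>' x(1) y(1) eq]
      counit.F.C.iso_comp_left_iff[OF transpose_in[OF \<phi> Y] y]
      counit.F.C.iso_comp_right_iff[OF L.ar_in[OF x(1)] L.iso_ar[OF x] transpose_in[OF \<phi>' Y']]
    by simp
qed

text \<open>
  Naturality of a transpose is automatic, so only the universality of the single arrows remains of the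
  requirement that it be a natural isomorphism.
\<close>

lemma natural_isomorphism_transpose_iff:
  assumes F: "is_functor B C F" and G: "is_functor B D G"
    and \<phi>: "\<And>Z. Z \<in> Ob B \<Longrightarrow> \<phi> Z \<in> hom C (ob F Z) (ob R (ob G Z))"
    and nat: "\<And>z Z Z'. z \<in> hom B Z Z' \<Longrightarrow>
      \<phi> Z' \<cdot>\<^bsub>C\<^esub> ar F z = ar R (ar G z) \<cdot>\<^bsub>C\<^esub> \<phi> Z"
    and \<tau>: "\<And>Z. Z \<in> Ob B \<Longrightarrow> \<tau> Z = transpose (ob G Z) (\<phi> Z)"
  shows "natural_isomorphism B D (L \<circ>\<^sub>F F) G \<tau> \<longleftrightarrow> (\<forall>Z \<in> Ob B. universal (ob G Z) (\<phi> Z))"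
proof -
  interpret F: is_functor B C F by fact
  interpret G: is_functor B D G by fact
  have LF: "is_functor B D (L \<circ>\<^sub>F F)" using is_functor_comp[OF F] L.is_functor_axioms by blast
  show ?thesis
    unfolding natural_isomorphism_iff[OF LF G] universal_def
    using transpose_in[OF \<phi>] G.ob_in
      transpose_natural[OF \<phi> \<phi> F.ar_in G.ar_in nat] F.C.hom_Ob
    by (auto simp: \<tau>)
qed

end

section \<open>Products of arrows into pullbacks\<close>

text \<open>
  The product of \<open>\<phi>1 : X1 \<rightarrow> F1 Y1\<close> and \<open>\<phi>2 : X2 \<rightarrow> F2 Y2\<close> as an arrow into a pullback of \<open>Y1 \<otimes> Y2\<close>, where \<open>\<mu>\<close>
  compares the product of the pullbacks with the pullback of the product.
\<close>

definition pairing ::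
  "('o, 'a) cat \<Rightarrow> ('p \<times> 'q, 'b \<times> 'c, 'o, 'a) funct \<Rightarrow> ('y \<times> 'z \<Rightarrow> 'a) \<Rightarrow>
   'y \<Rightarrow> 'z \<Rightarrow> 'b \<Rightarrow> 'c \<Rightarrow> 'a" where
  "pairing C T \<mu> Y1 Y2 \<phi>1 \<phi>2 = \<mu> (Y1, Y2) \<cdot>\<^bsub>C\<^esub> ar T (\<phi>1, \<phi>2)"

text \<open>
  One map, or one pair of maps, of a tensor structure. For an internal structure all three of \<open>F1\<close>,
  \<open>F2\<close>, \<open>R\<close> are \<open>f\<^sup>*\<close> and \<open>\<mu>\<close> is \<open>m\<^sub>f\<close>; for an external one they are \<open>f\<^sub>1\<^sup>*\<close>, \<open>f\<^sub>2\<^sup>*\<close>, \<open>(f\<^sub>1 \<times> f\<^sub>2)\<^sup>*\<close>. The functors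
  \<open>T\<close> and \<open>U\<close> are the tensor products upstairs and downstairs.
\<close>

locale tensor_pullback =
  F1: is_functor D1 C1 F1 + F2: is_functor D2 C2 F2 + R: is_functor D C R +
  T: is_functor "C1 \<times>\<^sub>C C2" C T + U: is_functor "D1 \<times>\<^sub>C D2" D U +
  \<mu>: natural_isomorphism "D1 \<times>\<^sub>C D2" C "T \<circ>\<^sub>F (F1 \<times>\<^sub>F F2)" "R \<circ>\<^sub>F U" \<mu>
  for C1 :: "('o1, 'a1) cat" and C2 :: "('o2, 'a2) cat" and C :: "('o, 'a) cat"
    and D1 :: "('p1, 'b1) cat" and D2 :: "('p2, 'b2) cat" and D :: "('p, 'b) cat"
    and F1 F2 R T U \<mu>
begin

lemma tensor_in:
  "\<phi>1 \<in> hom C1 X1 X1' \<Longrightarrow> \<phi>2 \<in> hom C2 X2 X2' \<Longrightarrow>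
    ar T (\<phi>1, \<phi>2) \<in> hom C (ob T (X1, X2)) (ob T (X1', X2'))"
  using T.ar_in[of "(\<phi>1, \<phi>2)" "(X1, X2)" "(X1', X2')"] by simp

lemma tensor_comp:
  "\<phi>1 \<in> hom C1 X1 X1' \<Longrightarrow> \<phi>2 \<in> hom C2 X2 X2' \<Longrightarrow>
   \<psi>1 \<in> hom C1 X1' X1'' \<Longrightarrow> \<psi>2 \<in> hom C2 X2' X2'' \<Longrightarrow>
    ar T (\<psi>1, \<psi>2) \<cdot>\<^bsub>C\<^esub> ar T (\<phi>1, \<phi>2) = ar T (\<psi>1 \<cdot>\<^bsub>C1\<^esub> \<phi>1, \<psi>2 \<cdot>\<^bsub>C2\<^esub> \<phi>2)"
  using T.ar_comp[of "(\<phi>1, \<phi>2)" "(X1, X2)" "(X1', X2')" "(\<psi>1, \<psi>2)" "(X1'', X2'')"] by simp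

lemma tensor_iso:
  "\<phi>1 \<in> hom C1 X1 X1' \<Longrightarrow> \<phi>2 \<in> hom C2 X2 X2' \<Longrightarrow> iso C1 \<phi>1 \<Longrightarrow> iso C2 \<phi>2 \<Longrightarrow>
    iso C (ar T (\<phi>1, \<phi>2))"
  using T.iso_ar[of "(\<phi>1, \<phi>2)" "(X1, X2)" "(X1', X2')"]
    iso_prod[OF F1.D.category_axioms F2.D.category_axioms] by simp

lemma mon_in:
  "Y1 \<in> Ob D1 \<Longrightarrow> Y2 \<in> Ob D2 \<Longrightarrow>
    \<mu> (Y1, Y2) \<in> hom C (ob T (ob F1 Y1, ob F2 Y2)) (ob R (ob U (Y1, Y2)))"
  using \<mu>.component_in[of "(Y1, Y2)"] by simp

lemma mon_natural:
  "y1 \<in> hom D1 Y1 Y1' \<Longrightarrow> y2 \<in> hom D2 Y2 Y2' \<Longrightarrow>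
    ar R (ar U (y1, y2)) \<cdot>\<^bsub>C\<^esub> \<mu> (Y1, Y2) = \<mu> (Y1', Y2') \<cdot>\<^bsub>C\<^esub> ar T (ar F1 y1, ar F2 y2)"
  using \<mu>.naturality[of "(y1, y2)" "(Y1, Y2)" "(Y1', Y2')"] by simp

lemma target_in:
  "y1 \<in> hom D1 Y1 Y1' \<Longrightarrow> y2 \<in> hom D2 Y2 Y2' \<Longrightarrow>
    ar U (y1, y2) \<in> hom D (ob U (Y1, Y2)) (ob U (Y1', Y2'))"
  using U.ar_in[of "(y1, y2)" "(Y1, Y2)" "(Y1', Y2')"] by simp

lemma target_iso:
  "y1 \<in> hom D1 Y1 Y1' \<Longrightarrow> y2 \<in> hom D2 Y2 Y2' \<Longrightarrow> iso D1 y1 \<Longrightarrow> iso D2 y2 \<Longrightarrow>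
    iso D (ar U (y1, y2))"
  using U.iso_ar[of "(y1, y2)" "(Y1, Y2)" "(Y1', Y2')"]
    iso_prod[OF F1.C.category_axioms F2.C.category_axioms] by simp

abbreviation pair where "pair \<equiv> pairing C T \<mu>"

lemma pairing_in:
  assumes "\<phi>1 \<in> hom C1 X1 (ob F1 Y1)" "\<phi>2 \<in> hom C2 X2 (ob F2 Y2)" "Y1 \<in> Ob D1" "Y2 \<in> Ob D2"
  shows "pair Y1 Y2 \<phi>1 \<phi>2 \<in> hom C (ob T (X1, X2)) (ob R (ob U (Y1, Y2)))"
  unfolding pairing_def using R.D.comp_in_hom[OF tensor_in mon_in] assms by blast

lemma pairing_natural:
  assumes \<phi>: "\<phi>1 \<in> hom C1 X1 (ob F1 Y1)" "\<phi>2 \<in> hom C2 X2 (ob F2 Y2)"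
    and \<phi>': "\<phi>1' \<in> hom C1 X1' (ob F1 Y1')" "\<phi>2' \<in> hom C2 X2' (ob F2 Y2')"
    and x: "x1 \<in> hom C1 X1 X1'" "x2 \<in> hom C2 X2 X2'"
    and y: "y1 \<in> hom D1 Y1 Y1'" "y2 \<in> hom D2 Y2 Y2'"
    and eq: "\<phi>1' \<cdot>\<^bsub>C1\<^esub> x1 = ar F1 y1 \<cdot>\<^bsub>C1\<^esub> \<phi>1" "\<phi>2' \<cdot>\<^bsub>C2\<^esub> x2 = ar F2 y2 \<cdot>\<^bsub>C2\<^esub> \<phi>2"
  shows "pair Y1' Y2' \<phi>1' \<phi>2' \<cdot>\<^bsub>C\<^esub> ar T (x1, x2) = ar R (ar U (y1, y2)) \<cdot>\<^bsub>C\<^esub> pair Y1 Y2 \<phi>1 \<phi>2"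
proof -
  have Y: "Y1 \<in> Ob D1" "Y1' \<in> Ob D1" "Y2 \<in> Ob D2" "Y2' \<in> Ob D2"
    using F1.C.hom_Ob[OF y(1)] F2.C.hom_Ob[OF y(2)] by auto
  have "pair Y1' Y2' \<phi>1' \<phi>2' \<cdot>\<^bsub>C\<^esub> ar T (x1, x2)
      = \<mu> (Y1', Y2') \<cdot>\<^bsub>C\<^esub> (ar T (\<phi>1', \<phi>2') \<cdot>\<^bsub>C\<^esub> ar T (x1, x2))"
    unfolding pairing_def
    by (rule R.D.comp_assoc[OF tensor_in[OF x] tensor_in[OF \<phi>'] mon_in[OF Y(2,4)]])
  also have "\<dots> = \<mu> (Y1', Y2') \<cdot>\<^bsub>C\<^esub> (ar T (ar F1 y1, ar F2 y2) \<cdot>\<^bsub>C\<^esub> ar T (\<phi>1, \<phi>2))"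
    using tensor_comp[OF x \<phi>'] tensor_comp[OF \<phi> F1.ar_in[OF y(1)] F2.ar_in[OF y(2)]] eq by simp
  also have "\<dots> = (\<mu> (Y1', Y2') \<cdot>\<^bsub>C\<^esub> ar T (ar F1 y1, ar F2 y2)) \<cdot>\<^bsub>C\<^esub> ar T (\<phi>1, \<phi>2)"
    by (rule R.D.comp_assoc[symmetric,
          OF tensor_in[OF \<phi>] tensor_in[OF F1.ar_in[OF y(1)] F2.ar_in[OF y(2)]] mon_in[OF Y(2,4)]])
  also have "\<dots> = ar R (ar U (y1, y2)) \<cdot>\<^bsub>C\<^esub> pair Y1 Y2 \<phi>1 \<phi>2"
    unfolding pairing_def mon_natural[OF y, symmetric]
    by (rule R.D.comp_assoc[OF tensor_in[OF \<phi>] mon_in[OF Y(1,3)] R.ar_in[OF target_in[OF y]]])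
  finally show ?thesis .
qed

end

locale adjoint_tensor_pullback =
  tensor_pullback C1 C2 C D1 D2 D F1 F2 R T U \<mu> + adj: adjunction C D L R \<eta> \<epsilon>
  for C1 :: "('o1, 'a1) cat" and C2 :: "('o2, 'a2) cat" and C :: "('o, 'a) cat"
    and D1 :: "('p1, 'b1) cat" and D2 :: "('p2, 'b2) cat" and D :: "('p, 'b) cat"
    and F1 F2 R T U \<mu> L \<eta> \<epsilon>
begin

lemma universal_pairing_cong:
  assumes \<phi>: "\<phi>1 \<in> hom C1 X1 (ob F1 Y1)" "\<phi>2 \<in> hom C2 X2 (ob F2 Y2)"
    and \<phi>': "\<phi>1' \<in> hom C1 X1' (ob F1 Y1')" "\<phi>2' \<in> hom C2 X2' (ob F2 Y2')"
    and x: "x1 \<in> hom C1 X1 X1'" "x2 \<in> hom C2 X2 X2'" "iso C1 x1" "iso C2 x2"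
    and y: "y1 \<in> hom D1 Y1 Y1'" "y2 \<in> hom D2 Y2 Y2'" "iso D1 y1" "iso D2 y2"
    and eq: "\<phi>1' \<cdot>\<^bsub>C1\<^esub> x1 = ar F1 y1 \<cdot>\<^bsub>C1\<^esub> \<phi>1" "\<phi>2' \<cdot>\<^bsub>C2\<^esub> x2 = ar F2 y2 \<cdot>\<^bsub>C2\<^esub> \<phi>2"
  shows "adj.universal (ob U (Y1, Y2)) (pair Y1 Y2 \<phi>1 \<phi>2) \<longleftrightarrow>
    adj.universal (ob U (Y1', Y2')) (pair Y1' Y2' \<phi>1' \<phi>2')"
proof -
  have Y: "Y1 \<in> Ob D1" "Y1' \<in> Ob D1" "Y2 \<in> Ob D2" "Y2' \<in> Ob D2"
    using F1.C.hom_Ob[OF y(1)] F2.C.hom_Ob[OF y(2)] by auto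
  show ?thesis
    by (rule adj.universal_cong[OF pairing_in[OF \<phi> Y(1,3)] pairing_in[OF \<phi>' Y(2,4)]
          tensor_in[OF x(1,2)] tensor_iso[OF x] target_in[OF y(1,2)] target_iso[OF y]
          pairing_natural[OF \<phi> \<phi>' x(1,2) y(1,2) eq]])
qed

text \<open>
  Common form of the four projection maps: \<open>\<phi>1 Z\<close> and \<open>\<phi>2 Z\<close> are a unit and an identity, in one order or
  the other, and \<open>B\<close> is the product of the two fibres from which the objects are taken. The functor \<open>F\<close> is
  described by its values because it is \<open>T\<close> itself in the external case, where \<open>id\<^sup>*\<close> is left out, and \<open>T\<close>
  after a pullback in the internal case.
\<close>

lemma natural_isomorphism_pairing_iff:
  assumes F: "is_functor B C F" and G: "is_functor B D G"
    and F_eq: "\<And>Z. Z \<in> Ob B \<Longrightarrow> ob F Z = ob T (X1 Z, X2 Z)"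
      "\<And>z. ar F z = ar T (x1 z, x2 z)"
    and G_eq: "\<And>Z. Z \<in> Ob B \<Longrightarrow> ob G Z = ob U (Y1 Z, Y2 Z)"
      "\<And>z. ar G z = ar U (y1 z, y2 z)"
    and Y: "\<And>Z. Z \<in> Ob B \<Longrightarrow> Y1 Z \<in> Ob D1 \<and> Y2 Z \<in> Ob D2"
    and \<phi>: "\<And>Z. Z \<in> Ob B \<Longrightarrow> \<phi>1 Z \<in> hom C1 (X1 Z) (ob F1 (Y1 Z))"
      "\<And>Z. Z \<in> Ob B \<Longrightarrow> \<phi>2 Z \<in> hom C2 (X2 Z) (ob F2 (Y2 Z))"
    and x: "\<And>z Z Z'. z \<in> hom B Z Z' \<Longrightarrow> x1 z \<in> hom C1 (X1 Z) (X1 Z')"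
      "\<And>z Z Z'. z \<in> hom B Z Z' \<Longrightarrow> x2 z \<in> hom C2 (X2 Z) (X2 Z')"
    and y: "\<And>z Z Z'. z \<in> hom B Z Z' \<Longrightarrow> y1 z \<in> hom D1 (Y1 Z) (Y1 Z')"
      "\<And>z Z Z'. z \<in> hom B Z Z' \<Longrightarrow> y2 z \<in> hom D2 (Y2 Z) (Y2 Z')"
    and nat: "\<And>z Z Z'. z \<in> hom B Z Z' \<Longrightarrow> \<phi>1 Z' \<cdot>\<^bsub>C1\<^esub> x1 z = ar F1 (y1 z) \<cdot>\<^bsub>C1\<^esub> \<phi>1 Z"
      "\<And>z Z Z'. z \<in> hom B Z Z' \<Longrightarrow> \<phi>2 Z' \<cdot>\<^bsub>C2\<^esub> x2 z = ar F2 (y2 z) \<cdot>\<^bsub>C2\<^esub> \<phi>2 Z"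
    and \<tau>: "\<And>Z. Z \<in> Ob B \<Longrightarrow> \<tau> Z = \<epsilon> (ob U (Y1 Z, Y2 Z)) \<cdot>\<^bsub>D\<^esub>
      ar L (\<mu> (Y1 Z, Y2 Z)) \<cdot>\<^bsub>D\<^esub> ar L (ar T (\<phi>1 Z, \<phi>2 Z))"
  shows "natural_isomorphism B D (L \<circ>\<^sub>F F) G \<tau> \<longleftrightarrow>
    (\<forall>Z \<in> Ob B. adj.universal (ob U (Y1 Z, Y2 Z)) (pair (Y1 Z) (Y2 Z) (\<phi>1 Z) (\<phi>2 Z)))"
proof -
  interpret F: is_functor B C F by fact
  let ?\<phi> = "\<lambda>Z. pair (Y1 Z) (Y2 Z) (\<phi>1 Z) (\<phi>2 Z)"
  have "natural_isomorphism B D (L \<circ>\<^sub>F F) G \<tau> \<longleftrightarrow>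
      (\<forall>Z \<in> Ob B. adj.universal (ob G Z) (?\<phi> Z))"
  proof (rule adj.natural_isomorphism_transpose_iff[OF F G])
    show "?\<phi> Z \<in> hom C (ob F Z) (ob R (ob G Z))" if "Z \<in> Ob B" for Z
      using pairing_in \<phi> Y F_eq G_eq that by simp
    show "?\<phi> Z' \<cdot>\<^bsub>C\<^esub> ar F z = ar R (ar G z) \<cdot>\<^bsub>C\<^esub> ?\<phi> Z" if z: "z \<in> hom B Z Z'" for z Z Z'
      using pairing_natural[OF \<phi> \<phi> x[OF z] y[OF z] nat[OF z]] F.C.hom_Ob[OF z] F_eq G_eq
      by simp
    show "\<tau> Z = adj.transpose (ob G Z) (?\<phi> Z)" if Z: "Z \<in> Ob B" for Z
      unfolding \<tau>[OF Z] adj.transpose_def pairing_def G_eq(1)[OF Z]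
      using adj.L.ar_comp[OF tensor_in[OF \<phi>[OF Z]] mon_in] Y[OF Z] by simp
  qed
  then show ?thesis using G_eq by simp
qed

end

section \<open>Exchange isomorphisms\<close>

context fibered_category
begin

context
  fixes f g T U V
  assumes f: "f \<in> hom S T U" and g: "g \<in> hom S U V"
begin

interpretation conn: natural_isomorphism "fib H V" "fib H T" "pull H (g \<cdot>\<^bsub>S\<^esub> f)"
  "pull H f \<circ>\<^sub>F pull H g" "conn H f g"
  by (rule conn_iso[OF f g])

lemma conn_in: "A \<in> Ob (fib H V) \<Longrightarrow>
    conn H f g A \<in> hom (fib H T) (ob (pull H (g \<cdot>\<^bsub>S\<^esub> f)) A) (ob (pull H f) (ob (pull H g) A))"
  using conn.component_in by simp

lemma iso_conn: "A \<in> Ob (fib H V) \<Longrightarrow> iso (fib H T) (conn H f g A)"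
  using conn.component_iso by simp

lemma conn_natural: "u \<in> hom (fib H V) A B \<Longrightarrow>
    ar (pull H f) (ar (pull H g) u) \<cdot>\<^bsub>fib H T\<^esub> conn H f g A =
    conn H f g B \<cdot>\<^bsub>fib H T\<^esub> ar (pull H (g \<cdot>\<^bsub>S\<^esub> f)) u"
  using conn.naturality by simp

end

lemma pull_ob: "f \<in> hom S T U \<Longrightarrow> A \<in> Ob (fib H U) \<Longrightarrow> ob (pull H f) A \<in> Ob (fib H T)"
  and pull_ar: "f \<in> hom S T U \<Longrightarrow> u \<in> hom (fib H U) A B \<Longrightarrow>
    ar (pull H f) u \<in> hom (fib H T) (ob (pull H f) A) (ob (pull H f) B)"
  and pull_comp: "f \<in> hom S T U \<Longrightarrow> u \<in> hom (fib H U) A B \<Longrightarrow> v \<in> hom (fib H U) B D \<Longrightarrow>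
    ar (pull H f) (v \<cdot>\<^bsub>fib H U\<^esub> u) = ar (pull H f) v \<cdot>\<^bsub>fib H T\<^esub> ar (pull H f) u"
  and pull_id: "f \<in> hom S T U \<Longrightarrow> A \<in> Ob (fib H U) \<Longrightarrow>
    ar (pull H f) (Id (fib H U) A) = Id (fib H T) (ob (pull H f) A)"
  and pull_iso: "f \<in> hom S T U \<Longrightarrow> u \<in> hom (fib H U) A B \<Longrightarrow> iso (fib H U) u \<Longrightarrow>
    iso (fib H T) (ar (pull H f) u)"
  using pull_functor is_functor.ob_in is_functor.ar_in is_functor.ar_comp is_functor.ar_id
    is_functor.iso_ar by metis+

context
  fixes a b c d P Q R V
  assumes a: "a \<in> hom S P Q" and b: "b \<in> hom S Q V"
    and c: "c \<in> hom S P R" and d: "d \<in> hom S R V"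
    and commutes: "b \<cdot>\<^bsub>S\<^esub> a = d \<cdot>\<^bsub>S\<^esub> c"
begin

interpretation P: category "fib H P" by (rule fib_category) (use hom_Ob[OF a] in blast)

lemma exch_eq: "exch S H a b c d A = conn H c d A \<cdot>\<^bsub>fib H P\<^esub> inv_ar (fib H P) (conn H a b A)"
  using a by (simp add: exch_def Let_def hom_def)

context
  fixes A
  assumes A: "A \<in> Ob (fib H V)"
begin

lemma exch_in: "exch S H a b c d A \<in>
    hom (fib H P) (ob (pull H a) (ob (pull H b) A)) (ob (pull H c) (ob (pull H d) A))"
  unfolding exch_eq
  using P.comp_in_hom P.inv_ar_inverse[OF conn_in[OF a b A] iso_conn[OF a b A]]
    conn_in[OF c d A, folded commutes] by blast

lemma iso_exch: "iso (fib H P) (exch S H a b c d A)"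
  unfolding exch_eq
  using P.inv_ar_inverse[OF conn_in[OF a b A] iso_conn[OF a b A]]
    P.iso_inv_ar[OF conn_in[OF a b A] iso_conn[OF a b A]]
    P.iso_comp[OF _ _ conn_in[OF c d A, folded commutes] iso_conn[OF c d A]] by blast

lemma exch_conn: "exch S H a b c d A \<cdot>\<^bsub>fib H P\<^esub> conn H a b A = conn H c d A"
proof -
  let ?i = "inv_ar (fib H P) (conn H a b A)"
  note i = P.inv_ar_inverse[OF conn_in[OF a b A] iso_conn[OF a b A]]
  have "exch S H a b c d A \<cdot>\<^bsub>fib H P\<^esub> conn H a b A
      = conn H c d A \<cdot>\<^bsub>fib H P\<^esub> (?i \<cdot>\<^bsub>fib H P\<^esub> conn H a b A)"
    unfolding exch_eq
    using P.comp_assoc[OF conn_in[OF a b A]] i conn_in[OF c d A] commutes by metis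
  then show ?thesis using i P.comp_id conn_in[OF c d A] commutes by simp
qed

end

lemma exch_natural:
  assumes u: "u \<in> hom (fib H V) A B"
  shows "ar (pull H c) (ar (pull H d) u) \<cdot>\<^bsub>fib H P\<^esub> exch S H a b c d A =
    exch S H a b c d B \<cdot>\<^bsub>fib H P\<^esub> ar (pull H a) (ar (pull H b) u)"
proof -
  interpret V: category "fib H V" by (rule fib_category) (use hom_Ob[OF b] in blast)
  have A: "A \<in> Ob (fib H V)" and B: "B \<in> Ob (fib H V)" using V.hom_Ob[OF u] by auto
  note cA = conn_in[OF a b A] and cB = conn_in[OF a b B]
  note eA = exch_in[OF A] and eB = exch_in[OF B]
  note ab = pull_ar[OF a pull_ar[OF b u]] and cd = pull_ar[OF c pull_ar[OF d u]]
  note ba = pull_ar[OF comp_in_hom[OF a b] u]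
  show ?thesis
  proof (rule P.iso_epi[OF cA iso_conn[OF a b A]])
    have "(ar (pull H c) (ar (pull H d) u) \<cdot>\<^bsub>fib H P\<^esub> exch S H a b c d A) \<cdot>\<^bsub>fib H P\<^esub> conn H a b A
        = ar (pull H c) (ar (pull H d) u) \<cdot>\<^bsub>fib H P\<^esub> conn H c d A"
      using P.comp_assoc[OF cA eA cd] exch_conn[OF A] by simp
    also have "\<dots> = conn H c d B \<cdot>\<^bsub>fib H P\<^esub> ar (pull H (b \<cdot>\<^bsub>S\<^esub> a)) u"
      using conn_natural[OF c d u] commutes by simp
    also have "\<dots> = exch S H a b c d B \<cdot>\<^bsub>fib H P\<^esub>
        (ar (pull H a) (ar (pull H b) u) \<cdot>\<^bsub>fib H P\<^esub> conn H a b A)"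
      using P.comp_assoc[OF ba cB eB] exch_conn[OF B] conn_natural[OF a b u] by simp
    also have "\<dots> = (exch S H a b c d B \<cdot>\<^bsub>fib H P\<^esub> ar (pull H a) (ar (pull H b) u))
        \<cdot>\<^bsub>fib H P\<^esub> conn H a b A"
      using P.comp_assoc[OF cA ab eB] by simp
    finally show "(ar (pull H c) (ar (pull H d) u) \<cdot>\<^bsub>fib H P\<^esub> exch S H a b c d A)
        \<cdot>\<^bsub>fib H P\<^esub> conn H a b A = \<dots>" .
  qed (use P.comp_in_hom ab cd eA eB in blast)+
qed

end

text \<open>
  Two pasted squares, \<open>f r' = r q\<close> and \<open>q \<gamma> = \<delta> p\<close>. Both sides are the canonical isomorphism from the pullback
  along \<open>f r' \<gamma> = r \<delta> p\<close> to \<open>p\<^sup>*\<delta>\<^sup>*r\<^sup>*\<close>: the cocycle identity is used once for each of the ways \<open>f r' \<gamma>\<close>,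
  \<open>r q \<gamma>\<close> and \<open>r \<delta> p\<close> of writing this map.
\<close>

lemma exch_pasting:
  assumes f: "f \<in> hom S T V" and r: "r \<in> hom S W V" and r': "r' \<in> hom S Q T"
    and q: "q \<in> hom S Q W" and \<gamma>: "\<gamma> \<in> hom S P Q" and p: "p \<in> hom S P U" and \<delta>: "\<delta> \<in> hom S U W"
    and eq: "f \<cdot>\<^bsub>S\<^esub> r' = r \<cdot>\<^bsub>S\<^esub> q" "q \<cdot>\<^bsub>S\<^esub> \<gamma> = \<delta> \<cdot>\<^bsub>S\<^esub> p"
    and Y: "Y \<in> Ob (fib H V)"
  shows "exch S H \<gamma> q p \<delta> (ob (pull H r) Y) \<cdot>\<^bsub>fib H P\<^esub> ar (pull H \<gamma>) (exch S H r' f q r Y)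
      \<cdot>\<^bsub>fib H P\<^esub> conn H \<gamma> r' (ob (pull H f) Y) \<cdot>\<^bsub>fib H P\<^esub> conn H (r' \<cdot>\<^bsub>S\<^esub> \<gamma>) f Y
    = ar (pull H p) (conn H \<delta> r Y) \<cdot>\<^bsub>fib H P\<^esub> conn H p (r \<cdot>\<^bsub>S\<^esub> \<delta>) Y"
proof -
  interpret P: category "fib H P" by (rule fib_category) (use hom_Ob[OF \<gamma>] in blast)
  let ?E = "exch S H \<gamma> q p \<delta> (ob (pull H r) Y)" and ?e = "exch S H r' f q r Y"
  have rY: "ob (pull H r) Y \<in> Ob (fib H W)" and fY: "ob (pull H f) Y \<in> Ob (fib H T)"
    using pull_ob r f Y by auto
  note E = exch_in[OF \<gamma> q p \<delta> eq(2) rY] and e = exch_in[OF r' f q r eq(1) Y]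
  have \<gamma>frY: "conn H \<gamma> (f \<cdot>\<^bsub>S\<^esub> r') Y \<in> hom (fib H P) (ob (pull H ((f \<cdot>\<^bsub>S\<^esub> r') \<cdot>\<^bsub>S\<^esub> \<gamma>)) Y)
      (ob (pull H \<gamma>) (ob (pull H (f \<cdot>\<^bsub>S\<^esub> r')) Y))"
    by (rule conn_in[OF \<gamma> comp_in_hom[OF r' f] Y])
  have qgr: "conn H (q \<cdot>\<^bsub>S\<^esub> \<gamma>) r Y \<in> hom (fib H P) (ob (pull H (r \<cdot>\<^bsub>S\<^esub> (q \<cdot>\<^bsub>S\<^esub> \<gamma>))) Y)
      (ob (pull H (q \<cdot>\<^bsub>S\<^esub> \<gamma>)) (ob (pull H r) Y))"
    by (rule conn_in[OF comp_in_hom[OF \<gamma> q] r Y])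
  have "ar (pull H \<gamma>) ?e \<cdot>\<^bsub>fib H P\<^esub> conn H \<gamma> r' (ob (pull H f) Y) \<cdot>\<^bsub>fib H P\<^esub> conn H (r' \<cdot>\<^bsub>S\<^esub> \<gamma>) f Y
      = ar (pull H \<gamma>) ?e \<cdot>\<^bsub>fib H P\<^esub> ar (pull H \<gamma>) (conn H r' f Y) \<cdot>\<^bsub>fib H P\<^esub> conn H \<gamma> (f \<cdot>\<^bsub>S\<^esub> r') Y"
    using conn_cocycle[OF \<gamma> r' f Y] by simp
  also have "\<dots> = ar (pull H \<gamma>) (conn H q r Y) \<cdot>\<^bsub>fib H P\<^esub> conn H \<gamma> (r \<cdot>\<^bsub>S\<^esub> q) Y"
    using P.comp_assoc[OF \<gamma>frY pull_ar[OF \<gamma> conn_in[OF r' f Y]] pull_ar[OF \<gamma> e]]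
      pull_comp[OF \<gamma> conn_in[OF r' f Y] e] exch_conn[OF r' f q r eq(1) Y] eq(1) by simp
  also have "\<dots> = conn H \<gamma> q (ob (pull H r) Y) \<cdot>\<^bsub>fib H P\<^esub> conn H (q \<cdot>\<^bsub>S\<^esub> \<gamma>) r Y"
    by (rule conn_cocycle[OF \<gamma> q r Y])
  finally have "?E \<cdot>\<^bsub>fib H P\<^esub> ar (pull H \<gamma>) ?e \<cdot>\<^bsub>fib H P\<^esub> conn H \<gamma> r' (ob (pull H f) Y)
      \<cdot>\<^bsub>fib H P\<^esub> conn H (r' \<cdot>\<^bsub>S\<^esub> \<gamma>) f Y
      = ?E \<cdot>\<^bsub>fib H P\<^esub> conn H \<gamma> q (ob (pull H r) Y) \<cdot>\<^bsub>fib H P\<^esub> conn H (q \<cdot>\<^bsub>S\<^esub> \<gamma>) r Y" by simp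
  also have "\<dots> = conn H p \<delta> (ob (pull H r) Y) \<cdot>\<^bsub>fib H P\<^esub> conn H (\<delta> \<cdot>\<^bsub>S\<^esub> p) r Y"
    using P.comp_assoc[OF qgr conn_in[OF \<gamma> q rY] E] exch_conn[OF \<gamma> q p \<delta> eq(2) rY] eq(2) by simp
  also have "\<dots> = ar (pull H p) (conn H \<delta> r Y) \<cdot>\<^bsub>fib H P\<^esub> conn H p (r \<cdot>\<^bsub>S\<^esub> \<delta>) Y"
    by (rule conn_cocycle[OF p \<delta> r Y, symmetric])
  finally show ?thesis .
qed

text \<open>
  If \<open>r\<close> has the section \<open>\<delta>\<close>, the two pasted squares have as outer square \<open>f u = p\<close> with \<open>u = r' \<gamma>\<close>, so an arrow
  \<open>\<phi> : X \<rightarrow> f\<^sup>*Y\<close> pulled back twice is, up to connection isomorphisms, \<open>u\<^sup>*\<phi>\<close> regarded as an arrow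
  \<open>\<chi> : u\<^sup>*X \<rightarrow> p\<^sup>*Y\<close>.
\<close>

lemma exch_restrict_twice:
  assumes f: "f \<in> hom S T V" and r: "r \<in> hom S W V" and r': "r' \<in> hom S Q T"
    and q: "q \<in> hom S Q W" and \<gamma>: "\<gamma> \<in> hom S P Q" and p: "p \<in> hom S P V" and \<delta>: "\<delta> \<in> hom S V W"
    and eq: "f \<cdot>\<^bsub>S\<^esub> r' = r \<cdot>\<^bsub>S\<^esub> q" "q \<cdot>\<^bsub>S\<^esub> \<gamma> = \<delta> \<cdot>\<^bsub>S\<^esub> p" "r \<cdot>\<^bsub>S\<^esub> \<delta> = Id S V"
    and Y: "Y \<in> Ob (fib H V)"
    and \<phi>: "\<phi> \<in> hom (fib H T) X (ob (pull H f) Y)"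
    and \<chi>: "\<chi> \<in> hom (fib H P) (ob (pull H (r' \<cdot>\<^bsub>S\<^esub> \<gamma>)) X) (ob (pull H p) Y)"
    and \<chi>_eq: "conn H (r' \<cdot>\<^bsub>S\<^esub> \<gamma>) f Y \<cdot>\<^bsub>fib H P\<^esub> \<chi> = ar (pull H (r' \<cdot>\<^bsub>S\<^esub> \<gamma>)) \<phi>"
  shows "(exch S H \<gamma> q p \<delta> (ob (pull H r) Y) \<cdot>\<^bsub>fib H P\<^esub>
      ar (pull H \<gamma>) (exch S H r' f q r Y \<cdot>\<^bsub>fib H Q\<^esub> ar (pull H r') \<phi>)) \<cdot>\<^bsub>fib H P\<^esub> conn H \<gamma> r' X
    = ar (pull H p) (conn H \<delta> r Y) \<cdot>\<^bsub>fib H P\<^esub> \<chi>"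
proof -
  interpret P: category "fib H P" by (rule fib_category) (use hom_Ob[OF \<gamma>] in blast)
  interpret T: category "fib H T" by (rule fib_category) (use hom_Ob[OF f] in blast)
  have X: "X \<in> Ob (fib H T)" using T.hom_Ob[OF \<phi>] by blast
  let ?E = "exch S H \<gamma> q p \<delta> (ob (pull H r) Y)" and ?e = "exch S H r' f q r Y"
  let ?c = "conn H \<gamma> r' (ob (pull H f) Y)"
  have rY: "ob (pull H r) Y \<in> Ob (fib H W)" and fY: "ob (pull H f) Y \<in> Ob (fib H T)"
    using pull_ob r f Y by auto
  have fu: "f \<cdot>\<^bsub>S\<^esub> (r' \<cdot>\<^bsub>S\<^esub> \<gamma>) = p"
    by (metis comp_assoc[OF \<gamma> r' f] comp_assoc[OF \<gamma> q r] comp_assoc[OF p \<delta> r] eq id_comp[OF p])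
  note E = exch_in[OF \<gamma> q p \<delta> eq(2) rY] and e = exch_in[OF r' f q r eq(1) Y]
  note u = comp_in_hom[OF \<gamma> r']
  have c2: "conn H (r' \<cdot>\<^bsub>S\<^esub> \<gamma>) f Y \<in> hom (fib H P) (ob (pull H p) Y)
     (ob (pull H (r' \<cdot>\<^bsub>S\<^esub> \<gamma>)) (ob (pull H f) Y))"
    using conn_in[OF u f Y] fu by simp
  note hs = E pull_ar[OF \<gamma> e] pull_ar[OF \<gamma> pull_ar[OF r' \<phi>]] conn_in[OF \<gamma> r' X]
    conn_in[OF \<gamma> r' fY] pull_ar[OF u \<phi>] \<chi> c2 pull_ar[OF p conn_in[OF \<delta> r Y]]
  note ty = hs[THEN P.homD(1)] hs[THEN P.homD(2)] hs[THEN P.homD(3)] P.comp_typing P.comp_assoc_Ar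
  have "(?E \<cdot>\<^bsub>fib H P\<^esub> ar (pull H \<gamma>) (?e \<cdot>\<^bsub>fib H Q\<^esub> ar (pull H r') \<phi>)) \<cdot>\<^bsub>fib H P\<^esub> conn H \<gamma> r' X
     = ?E \<cdot>\<^bsub>fib H P\<^esub> ar (pull H \<gamma>) ?e \<cdot>\<^bsub>fib H P\<^esub> ?c \<cdot>\<^bsub>fib H P\<^esub> ar (pull H (r' \<cdot>\<^bsub>S\<^esub> \<gamma>)) \<phi>"
    using conn_natural[OF \<gamma> r' \<phi>] pull_comp[OF \<gamma> pull_ar[OF r' \<phi>] e]
    by (simp add: ty)
  also have "\<dots> = (?E \<cdot>\<^bsub>fib H P\<^esub> ar (pull H \<gamma>) ?e \<cdot>\<^bsub>fib H P\<^esub> ?c \<cdot>\<^bsub>fib H P\<^esub> conn H (r' \<cdot>\<^bsub>S\<^esub> \<gamma>) f Y) \<cdot>\<^bsub>fib H P\<^esub> \<chi>"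
    unfolding \<chi>_eq[symmetric] by (simp add: ty)
  also have "\<dots> = ar (pull H p) (conn H \<delta> r Y) \<cdot>\<^bsub>fib H P\<^esub> \<chi>"
    unfolding exch_pasting[OF f r r' q \<gamma> p \<delta> eq(1,2) Y] eq(3) conn_id_right[OF p Y]
    using P.comp_id[OF pull_ar[OF p conn_in[OF \<delta> r Y]]] eq(3) pull_id_ob[OF _ Y] hom_Ob[OF p]
    by simp
  finally show ?thesis .
qed

end

section \<open>Base change of universal arrows\<close>

context geometric_fibered_category
begin

abbreviation universal where
  "universal p \<equiv> adjunction.universal (fib H (Cod S p)) (push L p) (eps L p)"

text \<open>
  The base change axiom is the case where \<open>\<phi>\<close> is a unit. Any universal \<open>\<phi>\<close> is the unit followed by \<open>p\<^sup>*y\<close> with \<open>y\<close>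
  invertible, and exchange isomorphisms are natural in \<open>y\<close>.
\<close>

lemma universal_base_change:
  assumes sq: "cartesian_square S p g p' g'" and p: "p \<in> Sm"
    and \<phi>: "\<phi> \<in> hom (fib H (Dom S p)) X (ob (pull H p) Y)" and Y: "Y \<in> Ob (fib H (Cod S p))"
    and univ: "universal p Y \<phi>"
  shows "universal p' (ob (pull H g) Y)
    (exch S H g' p p' g Y \<cdot>\<^bsub>fib H (Dom S p')\<^esub> ar (pull H g') \<phi>)"
proof -
  define P U P' U' where "P = Dom S p" and "U = Cod S p" and "P' = Dom S p'" and "U' = Cod S p'"
  have ph: "p \<in> hom S P U" and gh: "g \<in> hom S U' U" and ph': "p' \<in> hom S P' U'"
    and gh': "g' \<in> hom S P' P" and comm: "p \<cdot>\<^bsub>S\<^esub> g' = g \<cdot>\<^bsub>S\<^esub> p'"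
    using sq unfolding cartesian_square_def hom_def P_def U_def P'_def U'_def by auto
  have p': "p' \<in> Sm" using sm_base_change[OF sq p] .
  interpret p: adjunction "fib H P" "fib H U" "push L p" "pull H p" "eta L p" "eps L p"
    unfolding P_def U_def by (rule push_adjoint[OF p])
  interpret p': adjunction "fib H P'" "fib H U'" "push L p'" "pull H p'" "eta L p'" "eps L p'"
    unfolding P'_def U'_def by (rule push_adjoint[OF p'])
  note \<phi> = \<phi>[folded P_def] and Y = Y[folded U_def] and univ = univ[folded U_def]
  let ?Z = "ob (push L p) X" and ?y = "p.transpose Y \<phi>"
  let ?\<beta> = "exch S H g' p p' g ?Z \<cdot>\<^bsub>fib H P'\<^esub> ar (pull H g') (eta L p X)"
  let ?\<phi>' = "exch S H g' p p' g Y \<cdot>\<^bsub>fib H P'\<^esub> ar (pull H g') \<phi>"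
  have X: "X \<in> Ob (fib H P)" using p.unit.F.C.hom_Ob[OF \<phi>] by blast
  have Z: "?Z \<in> Ob (fib H U)" using p.L.ob_in[OF X] .
  note \<eta> = p.unit_in[OF X] and y = p.transpose_in[OF \<phi> Y]
  have iso_y: "iso (fib H U) ?y" using univ unfolding p.universal_def .
  note eZ = exch_in[OF gh' ph ph' gh comm Z] and eY = exch_in[OF gh' ph ph' gh comm Y]
  have \<beta>: "?\<beta> \<in> hom (fib H P') (ob (pull H g') X) (ob (pull H p') (ob (pull H g) ?Z))"
    using p'.unit.F.C.comp_in_hom[OF pull_ar[OF gh' \<eta>] eZ] .
  have \<phi>': "?\<phi>' \<in> hom (fib H P') (ob (pull H g') X) (ob (pull H p') (ob (pull H g) Y))"
    using p'.unit.F.C.comp_in_hom[OF pull_ar[OF gh' \<phi>] eY] .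
  have "base_change S H L p g p' g' X = p'.transpose (ob (pull H g) ?Z) ?\<beta>"
    unfolding base_change_def p'.transpose_def
    using p'.L.ar_comp[OF pull_ar[OF gh' \<eta>] eZ] by (simp add: Let_def U'_def[symmetric])
  moreover have "iso (fib H U') (base_change S H L p g p' g' X)"
    using natural_isomorphism.component_iso[OF base_change_iso[OF sq p]] X homD(2)[OF gh]
    unfolding P_def by simp
  ultimately have univ_\<beta>: "p'.universal (ob (pull H g) ?Z) ?\<beta>"
    unfolding p'.universal_def by simp
  have "?\<phi>' \<cdot>\<^bsub>fib H P'\<^esub> Id (fib H P') (ob (pull H g') X) = ?\<phi>'"
    using p'.unit.F.C.comp_id[OF \<phi>'] .
  also have "\<dots> = exch S H g' p p' g Y \<cdot>\<^bsub>fib H P'\<^esub>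
      (ar (pull H g') (ar (pull H p) ?y) \<cdot>\<^bsub>fib H P'\<^esub> ar (pull H g') (eta L p X))"
    using pull_comp[OF gh' \<eta> pull_ar[OF ph y]] p.untranspose[OF \<phi> Y] by simp
  also have "\<dots> = (exch S H g' p p' g Y \<cdot>\<^bsub>fib H P'\<^esub> ar (pull H g') (ar (pull H p) ?y))
      \<cdot>\<^bsub>fib H P'\<^esub> ar (pull H g') (eta L p X)"
    by (rule p'.unit.F.C.comp_assoc[OF pull_ar[OF gh' \<eta>] pull_ar[OF gh' pull_ar[OF ph y]] eY,
          symmetric])
  also have "\<dots> = ar (pull H p') (ar (pull H g) ?y) \<cdot>\<^bsub>fib H P'\<^esub> ?\<beta>"
    unfolding exch_natural[OF gh' ph ph' gh comm y, symmetric]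
    by (rule p'.unit.F.C.comp_assoc[OF pull_ar[OF gh' \<eta>] eZ pull_ar[OF ph' pull_ar[OF gh y]]])
  finally have eq: "?\<phi>' \<cdot>\<^bsub>fib H P'\<^esub> Id (fib H P') (ob (pull H g') X) = \<dots>" .
  have g'X: "ob (pull H g') X \<in> Ob (fib H P')" using pull_ob[OF gh' X] .
  have "p'.universal (ob (pull H g) Y) ?\<phi>'"
    using p'.universal_cong[OF \<beta> \<phi>' p'.unit.F.C.id_in_hom[OF g'X] p'.unit.F.C.iso_Id[OF g'X]
        pull_ar[OF gh y] pull_iso[OF gh y iso_y] eq] univ_\<beta> by simp
  then show ?thesis unfolding P'_def U'_def .
qed

end

section \<open>Internal tensor structures\<close>

context internal_tensor_structure
begin

lemma tensor_pullback_internal: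
  assumes f: "f \<in> hom S T U"
  shows "tensor_pullback (fib H T) (fib H T) (fib H T) (fib H U) (fib H U) (fib H U)
    (pull H f) (pull H f) (pull H f) (itens N T) (itens N U) (imon N f)"
  using pull_functor[OF f] itens_functor imon_iso[OF f] hom_Ob[OF f]
  unfolding tensor_pullback_def by blast

abbreviation ipairing where
  "ipairing T f \<equiv> pairing (fib H T) (itens N T) (imon N f)"

text \<open>
  Both composites \<open>b a\<close> and \<open>d c\<close> give the same \<open>m\<close>. Expanding it over each composite by multiplicativity
  shows that the exchange isomorphisms are compatible with \<open>\<otimes>\<close> (the auxiliary fact \<open>mult\<close>); naturality
  of \<open>m\<^sub>a\<close> then moves \<open>\<theta>1\<close> and \<open>\<theta>2\<close> into place.
\<close>

lemma pairing_base_change: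
  assumes a: "a \<in> hom S P Q" and b: "b \<in> hom S Q V" and c: "c \<in> hom S P R" and d: "d \<in> hom S R V"
    and comm: "b \<cdot>\<^bsub>S\<^esub> a = d \<cdot>\<^bsub>S\<^esub> c"
    and Z: "Z1 \<in> Ob (fib H V)" "Z2 \<in> Ob (fib H V)"
    and \<theta>: "\<theta>1 \<in> hom (fib H Q) X1 (ob (pull H b) Z1)" "\<theta>2 \<in> hom (fib H Q) X2 (ob (pull H b) Z2)"
  shows "(exch S H a b c d (ob (itens N V) (Z1, Z2)) \<cdot>\<^bsub>fib H P\<^esub>
      ar (pull H a) (ipairing Q b Z1 Z2 \<theta>1 \<theta>2)) \<cdot>\<^bsub>fib H P\<^esub> imon N a (X1, X2) =
    ar (pull H c) (imon N d (Z1, Z2)) \<cdot>\<^bsub>fib H P\<^esub>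
      ipairing P c (ob (pull H d) Z1) (ob (pull H d) Z2)
        (exch S H a b c d Z1 \<cdot>\<^bsub>fib H P\<^esub> ar (pull H a) \<theta>1)
        (exch S H a b c d Z2 \<cdot>\<^bsub>fib H P\<^esub> ar (pull H a) \<theta>2)"
proof -
  interpret P: category "fib H P" by (rule fib_category) (use hom_Ob[OF a] in blast)
  interpret Q: category "fib H Q" by (rule fib_category) (use hom_Ob[OF b] in blast)
  interpret a: tensor_pullback "fib H P" "fib H P" "fib H P" "fib H Q" "fib H Q" "fib H Q"
    "pull H a" "pull H a" "pull H a" "itens N P" "itens N Q" "imon N a"
    by (rule tensor_pullback_internal[OF a])
  interpret b: tensor_pullback "fib H Q" "fib H Q" "fib H Q" "fib H V" "fib H V" "fib H V"
    "pull H b" "pull H b" "pull H b" "itens N Q" "itens N V" "imon N b"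
    by (rule tensor_pullback_internal[OF b])
  interpret c: tensor_pullback "fib H P" "fib H P" "fib H P" "fib H R" "fib H R" "fib H R"
    "pull H c" "pull H c" "pull H c" "itens N P" "itens N R" "imon N c"
    by (rule tensor_pullback_internal[OF c])
  interpret d: tensor_pullback "fib H R" "fib H R" "fib H R" "fib H V" "fib H V" "fib H V"
    "pull H d" "pull H d" "pull H d" "itens N R" "itens N V" "imon N d"
    by (rule tensor_pullback_internal[OF d])
  interpret ba: tensor_pullback "fib H P" "fib H P" "fib H P" "fib H V" "fib H V" "fib H V"
    "pull H (b \<cdot>\<^bsub>S\<^esub> a)" "pull H (b \<cdot>\<^bsub>S\<^esub> a)" "pull H (b \<cdot>\<^bsub>S\<^esub> a)" "itens N P" "itens N V" "imon N (b \<cdot>\<^bsub>S\<^esub> a)"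
    by (rule tensor_pullback_internal[OF comp_in_hom[OF a b]])
  let ?Z = "ob (itens N V) (Z1, Z2)"
  let ?e = "exch S H a b c d" and ?T = "ar (itens N P)"
  have Z12: "?Z \<in> Ob (fib H V)" using b.U.ob_in[of "(Z1, Z2)"] Z by simp
  have X: "X1 \<in> Ob (fib H Q)" "X2 \<in> Ob (fib H Q)" using Q.hom_Ob[OF \<theta>(1)] Q.hom_Ob[OF \<theta>(2)] by auto
  have bZ: "ob (pull H b) Z1 \<in> Ob (fib H Q)" "ob (pull H b) Z2 \<in> Ob (fib H Q)"
    and dZ: "ob (pull H d) Z1 \<in> Ob (fib H R)" "ob (pull H d) Z2 \<in> Ob (fib H R)"
    using pull_ob b d Z by blast+
  note e = exch_in[OF a b c d comm]
  have ba: "imon N (b \<cdot>\<^bsub>S\<^esub> a) (Z1, Z2) \<in> hom (fib H P)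
      (ob (itens N P) (ob (pull H (b \<cdot>\<^bsub>S\<^esub> a)) Z1, ob (pull H (b \<cdot>\<^bsub>S\<^esub> a)) Z2))
      (ob (pull H (b \<cdot>\<^bsub>S\<^esub> a)) ?Z)"
    by (rule ba.mon_in[OF Z])
  note hs = e[OF Z12] pull_ar[OF a b.mon_in[OF Z]] pull_ar[OF a b.tensor_in[OF \<theta>]]
    a.mon_in[OF X] a.mon_in[OF bZ] pull_ar[OF c d.mon_in[OF Z]] c.mon_in[OF dZ]
    a.tensor_in[OF e[OF Z(1)] e[OF Z(2)]] a.tensor_in[OF pull_ar[OF a \<theta>(1)] pull_ar[OF a \<theta>(2)]]
    conn_in[OF a b Z12] a.tensor_in[OF conn_in[OF a b Z(1)] conn_in[OF a b Z(2)]] ba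
  note ty = hs[THEN P.homD(1)] hs[THEN P.homD(2)] hs[THEN P.homD(3)] P.comp_typing P.comp_assoc_Ar
  (* tested after precomposition with the product of the isomorphisms (b a)^* -> a^* b^* *)
  have mult: "?e ?Z \<cdot>\<^bsub>fib H P\<^esub> ar (pull H a) (imon N b (Z1, Z2)) \<cdot>\<^bsub>fib H P\<^esub>
      imon N a (ob (pull H b) Z1, ob (pull H b) Z2)
    = ar (pull H c) (imon N d (Z1, Z2)) \<cdot>\<^bsub>fib H P\<^esub>
      imon N c (ob (pull H d) Z1, ob (pull H d) Z2) \<cdot>\<^bsub>fib H P\<^esub> ?T (?e Z1, ?e Z2)" (is "?l = ?r")
  proof (rule P.iso_epi[OF a.tensor_in[OF conn_in[OF a b Z(1)] conn_in[OF a b Z(2)]]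
          a.tensor_iso[OF conn_in[OF a b Z(1)] conn_in[OF a b Z(2)] iso_conn[OF a b Z(1)] iso_conn[OF a b Z(2)]]])
    have "?l \<cdot>\<^bsub>fib H P\<^esub> ?T (conn H a b Z1, conn H a b Z2)
        = ?e ?Z \<cdot>\<^bsub>fib H P\<^esub> conn H a b ?Z \<cdot>\<^bsub>fib H P\<^esub> imon N (b \<cdot>\<^bsub>S\<^esub> a) (Z1, Z2)"
      using imon_comp[OF a b Z] by (simp add: ty)
    also have "\<dots> = (?e ?Z \<cdot>\<^bsub>fib H P\<^esub> conn H a b ?Z) \<cdot>\<^bsub>fib H P\<^esub> imon N (b \<cdot>\<^bsub>S\<^esub> a) (Z1, Z2)"
      by (simp add: ty)
    also have "\<dots> = ar (pull H c) (imon N d (Z1, Z2)) \<cdot>\<^bsub>fib H P\<^esub>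
        imon N c (ob (pull H d) Z1, ob (pull H d) Z2) \<cdot>\<^bsub>fib H P\<^esub> ?T (conn H c d Z1, conn H c d Z2)"
      using imon_comp[OF c d Z] exch_conn[OF a b c d comm Z12] comm by simp
    also have "?T (conn H c d Z1, conn H c d Z2)
        = ?T (?e Z1, ?e Z2) \<cdot>\<^bsub>fib H P\<^esub> ?T (conn H a b Z1, conn H a b Z2)"
      using a.tensor_comp[OF conn_in[OF a b Z(1)] conn_in[OF a b Z(2)] e[OF Z(1)] e[OF Z(2)]]
        exch_conn[OF a b c d comm] Z by simp
    also have "ar (pull H c) (imon N d (Z1, Z2)) \<cdot>\<^bsub>fib H P\<^esub>
        imon N c (ob (pull H d) Z1, ob (pull H d) Z2) \<cdot>\<^bsub>fib H P\<^esub> \<dots>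
        = ?r \<cdot>\<^bsub>fib H P\<^esub> ?T (conn H a b Z1, conn H a b Z2)"
      by (simp add: ty)
    finally show "?l \<cdot>\<^bsub>fib H P\<^esub> ?T (conn H a b Z1, conn H a b Z2)
        = ?r \<cdot>\<^bsub>fib H P\<^esub> ?T (conn H a b Z1, conn H a b Z2)" .
  qed (use P.comp_in_hom hs in blast)+
  have "(?e ?Z \<cdot>\<^bsub>fib H P\<^esub> ar (pull H a) (ipairing Q b Z1 Z2 \<theta>1 \<theta>2)) \<cdot>\<^bsub>fib H P\<^esub> imon N a (X1, X2)
      = ?l \<cdot>\<^bsub>fib H P\<^esub> ?T (ar (pull H a) \<theta>1, ar (pull H a) \<theta>2)"
    unfolding pairing_def
    using pull_comp[OF a b.tensor_in[OF \<theta>] b.mon_in[OF Z]] a.mon_natural[OF \<theta>] by (simp add: ty)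
  also have "\<dots> = ar (pull H c) (imon N d (Z1, Z2)) \<cdot>\<^bsub>fib H P\<^esub>
      imon N c (ob (pull H d) Z1, ob (pull H d) Z2) \<cdot>\<^bsub>fib H P\<^esub>
      (?T (?e Z1, ?e Z2) \<cdot>\<^bsub>fib H P\<^esub> ?T (ar (pull H a) \<theta>1, ar (pull H a) \<theta>2))"
    unfolding mult by (simp add: ty)
  also have "\<dots> = ar (pull H c) (imon N d (Z1, Z2)) \<cdot>\<^bsub>fib H P\<^esub>
      ipairing P c (ob (pull H d) Z1) (ob (pull H d) Z2)
        (?e Z1 \<cdot>\<^bsub>fib H P\<^esub> ar (pull H a) \<theta>1) (?e Z2 \<cdot>\<^bsub>fib H P\<^esub> ar (pull H a) \<theta>2)"
    unfolding pairing_def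
    using a.tensor_comp[OF pull_ar[OF a \<theta>(1)] pull_ar[OF a \<theta>(2)] e[OF Z(1)] e[OF Z(2)]] by simp
  finally show ?thesis .
qed

end

locale geometric_internal_data =
  geometric_fibered_category S Sm H L + internal_tensor_structure S H N
  for S :: "('s, 'm) cat" and Sm :: "'m set"
    and H :: "('s, 'm, 'o, 'a) fibered" and L :: "('m, 'o, 'a) adjoints"
    and N :: "('s, 'm, 'o, 'a) internal"
begin

lemma adjoint_tensor_pullback_internal:
  assumes "p \<in> Sm" "p \<in> hom S P U"
  shows "adjoint_tensor_pullback (fib H P) (fib H P) (fib H P) (fib H U) (fib H U) (fib H U)
    (pull H p) (pull H p) (pull H p) (itens N P) (itens N U) (imon N p)
    (push L p) (eta L p) (eps L p)"
  using tensor_pullback_internal[OF assms(2)] push_adjoint[OF assms(1)] homD[OF assms(2)]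
  unfolding adjoint_tensor_pullback_def by simp

lemma geometric_internal_iff:
  "geometric_internal S Sm H L N \<longleftrightarrow> (\<forall>p \<in> Sm.
    (\<forall>A \<in> Ob (fib H (Dom S p)). \<forall>B \<in> Ob (fib H (Cod S p)).
      universal p (ob (itens N (Cod S p)) (ob (push L p) A, B))
        (ipairing (Dom S p) p (ob (push L p) A) B
          (eta L p A) (Id (fib H (Dom S p)) (ob (pull H p) B)))) \<and>
    (\<forall>A \<in> Ob (fib H (Cod S p)). \<forall>B \<in> Ob (fib H (Dom S p)).
      universal p (ob (itens N (Cod S p)) (A, ob (push L p) B))
        (ipairing (Dom S p) p A (ob (push L p) B)
          (Id (fib H (Dom S p)) (ob (pull H p) A)) (eta L p B))))"
  (is "_ \<longleftrightarrow> (\<forall>p \<in> Sm. ?l p \<and> ?r p)")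
  unfolding geometric_internal_def Let_def
proof (rule ball_cong[OF refl], rule conj_cong)
  fix p assume p: "p \<in> Sm"
  define P U where "P = Dom S p" and "U = Cod S p"
  have ph: "p \<in> hom S P U" using p sm_ar by (auto simp: hom_def P_def U_def)
  interpret P: category "fib H P" by (rule fib_category) (use hom_Ob[OF ph] in blast)
  interpret U: category "fib H U" by (rule fib_category) (use hom_Ob[OF ph] in blast)
  interpret p: adjoint_tensor_pullback "fib H P" "fib H P" "fib H P" "fib H U" "fib H U" "fib H U"
    "pull H p" "pull H p" "pull H p" "itens N P" "itens N U" "imon N p"
    "push L p" "eta L p" "eps L p"
    by (rule adjoint_tensor_pullback_internal[OF p ph])
  note [simp] = pull_ob[OF ph] p.adj.L.ob_in p.adj.unit_in P.id_in_hom p.adj.L.ar_in pull_ar[OF ph]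
  have *: "f \<cdot>\<^bsub>fib H P\<^esub> Id (fib H P) A = Id (fib H P) B \<cdot>\<^bsub>fib H P\<^esub> f"
    if "f \<in> hom (fib H P) A B" for f A B using that P.comp_id P.id_comp by simp
  note idP = is_functor_id[OF P.category_axioms] and idU = is_functor_id[OF U.category_axioms]
    and pull = pull_functor[OF ph] and push = p.adj.L.is_functor_axioms
  note is_functors = is_functor_comp[OF is_functor_prod[OF idP pull] p.T.is_functor_axioms]
    is_functor_comp[OF is_functor_prod[OF push idU] p.U.is_functor_axioms]
    is_functor_comp[OF is_functor_prod[OF pull idP] p.T.is_functor_axioms]
    is_functor_comp[OF is_functor_prod[OF idU push] p.U.is_functor_axioms]
  show "natural_isomorphism (fib H (Dom S p) \<times>\<^sub>C fib H (Cod S p)) (fib H (Cod S p))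
       (push L p \<circ>\<^sub>F itens N (Dom S p) \<circ>\<^sub>F (id_funct \<times>\<^sub>F pull H p))
       (itens N (Cod S p) \<circ>\<^sub>F (push L p \<times>\<^sub>F id_funct))
       (projection_left S H L N p) \<longleftrightarrow> ?l p"
    unfolding P_def[symmetric] U_def[symmetric]
    apply (subst p.natural_isomorphism_pairing_iff[where
        ?X1.0 = fst and ?X2.0 = "\<lambda>Z. ob (pull H p) (snd Z)" and
        ?Y1.0 = "\<lambda>Z. ob (push L p) (fst Z)" and ?Y2.0 = snd and
        ?x1.0 = fst and ?x2.0 = "\<lambda>z. ar (pull H p) (snd z)" and
        ?y1.0 = "\<lambda>z. ar (push L p) (fst z)" and ?y2.0 = snd and
        ?\<phi>1.0 = "\<lambda>Z. eta L p (fst Z)" and ?\<phi>2.0 = "\<lambda>Z. Id (fib H P) (ob (pull H p) (snd Z))"])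
    by (auto intro!: is_functors simp: projection_left_def Let_def P_def[symmetric] U_def[symmetric]
          p.adj.unit_natural *[symmetric])
  show "natural_isomorphism (fib H (Cod S p) \<times>\<^sub>C fib H (Dom S p)) (fib H (Cod S p))
       (push L p \<circ>\<^sub>F itens N (Dom S p) \<circ>\<^sub>F (pull H p \<times>\<^sub>F id_funct))
       (itens N (Cod S p) \<circ>\<^sub>F (id_funct \<times>\<^sub>F push L p))
       (projection_right S H L N p) \<longleftrightarrow> ?r p"
    unfolding P_def[symmetric] U_def[symmetric]
    apply (subst p.natural_isomorphism_pairing_iff[where
        ?X2.0 = snd and ?X1.0 = "\<lambda>Z. ob (pull H p) (fst Z)" and
        ?Y2.0 = "\<lambda>Z. ob (push L p) (snd Z)" and ?Y1.0 = fst and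
        ?x2.0 = snd and ?x1.0 = "\<lambda>z. ar (pull H p) (fst z)" and
        ?y2.0 = "\<lambda>z. ar (push L p) (snd z)" and ?y1.0 = fst and
        ?\<phi>2.0 = "\<lambda>Z. eta L p (snd Z)" and ?\<phi>1.0 = "\<lambda>Z. Id (fib H P) (ob (pull H p) (fst Z))"])
    by (auto intro!: is_functors simp: projection_right_def Let_def P_def[symmetric] U_def[symmetric]
          p.adj.unit_natural *[symmetric])
qed

text \<open>
  The projection formula is the case where \<open>\<phi>1\<close> is the unit and \<open>\<phi>2\<close> the identity of \<open>p\<^sup>*Y2\<close>. The general
  case differs from it by the inverse of \<open>\<phi>2\<close> at the source and, at the target, by the isomorphism
  \<open>p\<^sub># X1 \<rightarrow> Y1\<close> that is the transpose of \<open>\<phi>1\<close>.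
\<close>

lemma universal_pairing_left:
  assumes geo: "geometric_internal S Sm H L N" and p: "p \<in> Sm" and ph: "p \<in> hom S P U"
    and Y: "Y1 \<in> Ob (fib H U)" "Y2 \<in> Ob (fib H U)"
    and \<phi>: "\<phi>1 \<in> hom (fib H P) X1 (ob (pull H p) Y1)" "\<phi>2 \<in> hom (fib H P) X2 (ob (pull H p) Y2)"
    and univ: "universal p Y1 \<phi>1" and iso: "iso (fib H P) \<phi>2"
  shows "universal p (ob (itens N U) (Y1, Y2)) (ipairing P p Y1 Y2 \<phi>1 \<phi>2)"
proof -
  interpret P: category "fib H P" by (rule fib_category) (use hom_Ob[OF ph] in blast)
  interpret U: category "fib H U" by (rule fib_category) (use hom_Ob[OF ph] in blast)
  interpret p: adjoint_tensor_pullback "fib H P" "fib H P" "fib H P" "fib H U" "fib H U" "fib H U"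
    "pull H p" "pull H p" "pull H p" "itens N P" "itens N U" "imon N p"
    "push L p" "eta L p" "eps L p"
    by (rule adjoint_tensor_pullback_internal[OF p ph])
  have PU: "Dom S p = P" "Cod S p = U" using homD[OF ph] by auto
  have X1: "X1 \<in> Ob (fib H P)" using P.hom_Ob[OF \<phi>(1)] by blast
  have pY2: "ob (pull H p) Y2 \<in> Ob (fib H P)" using pull_ob[OF ph Y(2)] .
  obtain y where y: "y \<in> hom (fib H U) (ob (push L p) X1) Y1" "iso (fib H U) y"
    "ar (pull H p) y \<cdot>\<^bsub>fib H P\<^esub> eta L p X1 = \<phi>1"
    using p.adj.universalE[OF \<phi>(1) Y(1)] univ PU by auto
  let ?i = "inv_ar (fib H P) \<phi>2"
  note i = P.inv_ar_inverse[OF \<phi>(2) iso]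
  have "p.adj.universal (ob (itens N U) (ob (push L p) X1, Y2))
      (ipairing P p (ob (push L p) X1) Y2 (eta L p X1) (Id (fib H P) (ob (pull H p) Y2)))"
    using geo p X1 Y(2) unfolding geometric_internal_iff PU[symmetric] by blast
  also have "?this \<longleftrightarrow> p.adj.universal (ob (itens N U) (Y1, Y2)) (ipairing P p Y1 Y2 \<phi>1 \<phi>2)"
  proof (rule p.universal_pairing_cong[OF p.adj.unit_in[OF X1] P.id_in_hom[OF pY2] \<phi>
        P.id_in_hom[OF X1] conjunct1[OF i] P.iso_Id[OF X1] P.iso_inv_ar[OF \<phi>(2) iso]
        y(1) U.id_in_hom[OF Y(2)] y(2) U.iso_Id[OF Y(2)]])
    show "\<phi>1 \<cdot>\<^bsub>fib H P\<^esub> Id (fib H P) X1 = ar (pull H p) y \<cdot>\<^bsub>fib H P\<^esub> eta L p X1"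
      using P.comp_id[OF \<phi>(1)] y(3) by simp
    show "\<phi>2 \<cdot>\<^bsub>fib H P\<^esub> ?i = ar (pull H p) (Id (fib H U) Y2) \<cdot>\<^bsub>fib H P\<^esub>
        Id (fib H P) (ob (pull H p) Y2)"
      using i pull_id[OF ph Y(2)] P.comp_id[OF P.id_in_hom[OF pY2]] by simp
  qed
  finally show ?thesis unfolding PU .
qed

lemma universal_pairing_right:
  assumes geo: "geometric_internal S Sm H L N" and p: "p \<in> Sm" and ph: "p \<in> hom S P U"
    and Y: "Y1 \<in> Ob (fib H U)" "Y2 \<in> Ob (fib H U)"
    and \<phi>: "\<phi>1 \<in> hom (fib H P) X1 (ob (pull H p) Y1)" "\<phi>2 \<in> hom (fib H P) X2 (ob (pull H p) Y2)"
    and univ: "universal p Y2 \<phi>2" and iso: "iso (fib H P) \<phi>1"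
  shows "universal p (ob (itens N U) (Y1, Y2)) (ipairing P p Y1 Y2 \<phi>1 \<phi>2)"
proof -
  interpret P: category "fib H P" by (rule fib_category) (use hom_Ob[OF ph] in blast)
  interpret U: category "fib H U" by (rule fib_category) (use hom_Ob[OF ph] in blast)
  interpret p: adjoint_tensor_pullback "fib H P" "fib H P" "fib H P" "fib H U" "fib H U" "fib H U"
    "pull H p" "pull H p" "pull H p" "itens N P" "itens N U" "imon N p"
    "push L p" "eta L p" "eps L p"
    by (rule adjoint_tensor_pullback_internal[OF p ph])
  have PU: "Dom S p = P" "Cod S p = U" using homD[OF ph] by auto
  have X2: "X2 \<in> Ob (fib H P)" using P.hom_Ob[OF \<phi>(2)] by blast
  have pY1: "ob (pull H p) Y1 \<in> Ob (fib H P)" using pull_ob[OF ph Y(1)] .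
  obtain y where y: "y \<in> hom (fib H U) (ob (push L p) X2) Y2" "iso (fib H U) y"
    "ar (pull H p) y \<cdot>\<^bsub>fib H P\<^esub> eta L p X2 = \<phi>2"
    using p.adj.universalE[OF \<phi>(2) Y(2)] univ PU by auto
  let ?i = "inv_ar (fib H P) \<phi>1"
  note i = P.inv_ar_inverse[OF \<phi>(1) iso]
  have "p.adj.universal (ob (itens N U) (Y1, ob (push L p) X2))
      (ipairing P p Y1 (ob (push L p) X2) (Id (fib H P) (ob (pull H p) Y1)) (eta L p X2))"
    using geo p X2 Y(1) unfolding geometric_internal_iff PU[symmetric] by blast
  also have "?this \<longleftrightarrow> p.adj.universal (ob (itens N U) (Y1, Y2)) (ipairing P p Y1 Y2 \<phi>1 \<phi>2)"
  proof (rule p.universal_pairing_cong[OF P.id_in_hom[OF pY1] p.adj.unit_in[OF X2] \<phi>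
        conjunct1[OF i] P.id_in_hom[OF X2] P.iso_inv_ar[OF \<phi>(1) iso] P.iso_Id[OF X2]
        U.id_in_hom[OF Y(1)] y(1) U.iso_Id[OF Y(1)] y(2)])
    show "\<phi>2 \<cdot>\<^bsub>fib H P\<^esub> Id (fib H P) X2 = ar (pull H p) y \<cdot>\<^bsub>fib H P\<^esub> eta L p X2"
      using P.comp_id[OF \<phi>(2)] y(3) by simp
    show "\<phi>1 \<cdot>\<^bsub>fib H P\<^esub> ?i = ar (pull H p) (Id (fib H U) Y1) \<cdot>\<^bsub>fib H P\<^esub>
        Id (fib H P) (ob (pull H p) Y1)"
      using i pull_id[OF ph Y(1)] P.comp_id[OF P.id_in_hom[OF pY1]] by simp
  qed
  finally show ?thesis unfolding PU .
qed

end

section \<open>Products and Cartesian squares\<close>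

context binary_products
begin

lemma prod_eqI:
  assumes h: "h \<in> hom S T (prd X S1 S2)" and h': "h' \<in> hom S T (prd X S1 S2)"
    and S: "S1 \<in> Ob S" "S2 \<in> Ob S"
    and eq: "pr1 X S1 S2 \<cdot>\<^bsub>S\<^esub> h = pr1 X S1 S2 \<cdot>\<^bsub>S\<^esub> h'" "pr2 X S1 S2 \<cdot>\<^bsub>S\<^esub> h = pr2 X S1 S2 \<cdot>\<^bsub>S\<^esub> h'"
  shows "h = h'"
  using universal[OF comp_in_hom[OF h pr1_in[OF S]] comp_in_hom[OF h pr2_in[OF S]]] h h' eq by metis

lemma pairE:
  assumes "f1 \<in> hom S T S1" "f2 \<in> hom S T S2"
  obtains h where "h \<in> hom S T (prd X S1 S2)" "pr1 X S1 S2 \<cdot>\<^bsub>S\<^esub> h = f1" "pr2 X S1 S2 \<cdot>\<^bsub>S\<^esub> h = f2"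
  using universal[OF assms] by blast

lemma prd_ar:
  assumes f1: "f1 \<in> hom S T1 S1" and f2: "f2 \<in> hom S T2 S2"
  shows prd_ar_in: "prd_ar S X f1 f2 \<in> hom S (prd X T1 T2) (prd X S1 S2)"
    and pr1_prd_ar: "pr1 X S1 S2 \<cdot>\<^bsub>S\<^esub> prd_ar S X f1 f2 = f1 \<cdot>\<^bsub>S\<^esub> pr1 X T1 T2"
    and pr2_prd_ar: "pr2 X S1 S2 \<cdot>\<^bsub>S\<^esub> prd_ar S X f1 f2 = f2 \<cdot>\<^bsub>S\<^esub> pr2 X T1 T2"
proof -
  have T: "T1 \<in> Ob S" "T2 \<in> Ob S" using hom_Ob[OF f1] hom_Ob[OF f2] by auto
  note ex = universal[OF comp_in_hom[OF pr1_in[OF T] f1] comp_in_hom[OF pr2_in[OF T] f2]]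
  show "prd_ar S X f1 f2 \<in> hom S (prd X T1 T2) (prd X S1 S2)"
    "pr1 X S1 S2 \<cdot>\<^bsub>S\<^esub> prd_ar S X f1 f2 = f1 \<cdot>\<^bsub>S\<^esub> pr1 X T1 T2"
    "pr2 X S1 S2 \<cdot>\<^bsub>S\<^esub> prd_ar S X f1 f2 = f2 \<cdot>\<^bsub>S\<^esub> pr2 X T1 T2"
    using theI'[OF ex] homD[OF f1] homD[OF f2] by (auto simp: prd_ar_def Let_def)
qed

lemma cartesian_squareI:
  assumes "p \<in> hom S P U" "g \<in> hom S U' U" "p' \<in> hom S P' U'" "g' \<in> hom S P' P"
    and "p \<cdot>\<^bsub>S\<^esub> g' = g \<cdot>\<^bsub>S\<^esub> p'"
    and "\<And>Q a b. a \<in> hom S Q P \<Longrightarrow> b \<in> hom S Q U' \<Longrightarrow> p \<cdot>\<^bsub>S\<^esub> a = g \<cdot>\<^bsub>S\<^esub> b \<Longrightarrow>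
      \<exists>h. h \<in> hom S Q P' \<and> g' \<cdot>\<^bsub>S\<^esub> h = a \<and> p' \<cdot>\<^bsub>S\<^esub> h = b"
    and "\<And>Q h k. h \<in> hom S Q P' \<Longrightarrow> k \<in> hom S Q P' \<Longrightarrow> g' \<cdot>\<^bsub>S\<^esub> h = g' \<cdot>\<^bsub>S\<^esub> k \<Longrightarrow>
      p' \<cdot>\<^bsub>S\<^esub> h = p' \<cdot>\<^bsub>S\<^esub> k \<Longrightarrow> h = k"
  shows "cartesian_square S p g p' g'"
proof -
  have "\<exists>!h. h \<in> hom S Q P' \<and> g' \<cdot>\<^bsub>S\<^esub> h = a \<and> p' \<cdot>\<^bsub>S\<^esub> h = b"
    if "a \<in> hom S Q P" "b \<in> hom S Q U'" "p \<cdot>\<^bsub>S\<^esub> a = g \<cdot>\<^bsub>S\<^esub> b" for Q a b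
    using assms(6)[OF that] assms(7) by metis
  then show ?thesis
    unfolding cartesian_square_def
    using assms(1-5) homD[OF assms(1)] homD[OF assms(2)] homD[OF assms(3)] homD[OF assms(4)]
    by simp
qed

text \<open>
  This square makes \<open>p \<times> id\<close> smooth and computes pullback along the projection of \<open>p\<^sub>#\<close>.
\<close>

lemma cartesian_prod_left:
  assumes p: "p \<in> hom S P U" and W: "W \<in> Ob S"
  shows "cartesian_square S p (pr1 X U W) (prd_ar S X p (Id S W)) (pr1 X P W)"
proof -
  note i = id_in_hom[OF W]
  have P: "P \<in> Ob S" and U: "U \<in> Ob S" using hom_Ob[OF p] by auto
  note q = prd_ar_in[OF p i] and q1 = pr1_prd_ar[OF p i] and q2 = pr2_prd_ar[OF p i]
  have q2: "pr2 X U W \<cdot>\<^bsub>S\<^esub> prd_ar S X p (Id S W) = pr2 X P W"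
    using q2 id_comp[OF pr2_in[OF P W]] by simp
  show ?thesis
  proof (rule cartesian_squareI[OF p pr1_in[OF U W] q pr1_in[OF P W] q1[symmetric]])
    fix Q a b
    assume a: "a \<in> hom S Q P" and b: "b \<in> hom S Q (prd X U W)" and eq: "p \<cdot>\<^bsub>S\<^esub> a = pr1 X U W \<cdot>\<^bsub>S\<^esub> b"
    obtain h where h: "h \<in> hom S Q (prd X P W)" "pr1 X P W \<cdot>\<^bsub>S\<^esub> h = a"
      "pr2 X P W \<cdot>\<^bsub>S\<^esub> h = pr2 X U W \<cdot>\<^bsub>S\<^esub> b"
      using pairE[OF a comp_in_hom[OF b pr2_in[OF U W]]] .
    have "prd_ar S X p (Id S W) \<cdot>\<^bsub>S\<^esub> h = b"
    proof (rule prod_eqI[OF comp_in_hom[OF h(1) q] b U W])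
      show "pr1 X U W \<cdot>\<^bsub>S\<^esub> prd_ar S X p (Id S W) \<cdot>\<^bsub>S\<^esub> h = pr1 X U W \<cdot>\<^bsub>S\<^esub> b"
        using comp_assoc[OF h(1) q pr1_in[OF U W]] comp_assoc[OF h(1) pr1_in[OF P W] p] q1 h eq
        by simp
      show "pr2 X U W \<cdot>\<^bsub>S\<^esub> prd_ar S X p (Id S W) \<cdot>\<^bsub>S\<^esub> h = pr2 X U W \<cdot>\<^bsub>S\<^esub> b"
        using comp_assoc[OF h(1) q pr2_in[OF U W]] q2 h by simp
    qed
    then show "\<exists>h. h \<in> hom S Q (prd X P W) \<and> pr1 X P W \<cdot>\<^bsub>S\<^esub> h = a \<and> prd_ar S X p (Id S W) \<cdot>\<^bsub>S\<^esub> h = b"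
      using h by blast
  next
    fix Q h k
    assume h: "h \<in> hom S Q (prd X P W)" and k: "k \<in> hom S Q (prd X P W)"
      and 1: "pr1 X P W \<cdot>\<^bsub>S\<^esub> h = pr1 X P W \<cdot>\<^bsub>S\<^esub> k"
      and 2: "prd_ar S X p (Id S W) \<cdot>\<^bsub>S\<^esub> h = prd_ar S X p (Id S W) \<cdot>\<^bsub>S\<^esub> k"
    show "h = k"
      by (rule prod_eqI[OF h k P W 1])
        (metis 2 q2 comp_assoc[OF h q pr2_in[OF U W]] comp_assoc[OF k q pr2_in[OF U W]])
  qed
qed

lemma cartesian_prod_right:
  assumes p: "p \<in> hom S P U" and W: "W \<in> Ob S"
  shows "cartesian_square S p (pr2 X W U) (prd_ar S X (Id S W) p) (pr2 X W P)"
proof -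
  note i = id_in_hom[OF W]
  have P: "P \<in> Ob S" and U: "U \<in> Ob S" using hom_Ob[OF p] by auto
  note q = prd_ar_in[OF i p] and q2 = pr2_prd_ar[OF i p]
  have q1: "pr1 X W U \<cdot>\<^bsub>S\<^esub> prd_ar S X (Id S W) p = pr1 X W P"
    using pr1_prd_ar[OF i p] id_comp[OF pr1_in[OF W P]] by simp
  show ?thesis
  proof (rule cartesian_squareI[OF p pr2_in[OF W U] q pr2_in[OF W P] q2[symmetric]])
    fix Q a b
    assume a: "a \<in> hom S Q P" and b: "b \<in> hom S Q (prd X W U)" and eq: "p \<cdot>\<^bsub>S\<^esub> a = pr2 X W U \<cdot>\<^bsub>S\<^esub> b"
    obtain h where h: "h \<in> hom S Q (prd X W P)" "pr1 X W P \<cdot>\<^bsub>S\<^esub> h = pr1 X W U \<cdot>\<^bsub>S\<^esub> b"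
      "pr2 X W P \<cdot>\<^bsub>S\<^esub> h = a"
      using pairE[OF comp_in_hom[OF b pr1_in[OF W U]] a] .
    have "prd_ar S X (Id S W) p \<cdot>\<^bsub>S\<^esub> h = b"
    proof (rule prod_eqI[OF comp_in_hom[OF h(1) q] b W U])
      show "pr2 X W U \<cdot>\<^bsub>S\<^esub> prd_ar S X (Id S W) p \<cdot>\<^bsub>S\<^esub> h = pr2 X W U \<cdot>\<^bsub>S\<^esub> b"
        using comp_assoc[OF h(1) q pr2_in[OF W U]] comp_assoc[OF h(1) pr2_in[OF W P] p] q2 h eq
        by simp
      show "pr1 X W U \<cdot>\<^bsub>S\<^esub> prd_ar S X (Id S W) p \<cdot>\<^bsub>S\<^esub> h = pr1 X W U \<cdot>\<^bsub>S\<^esub> b"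
        using comp_assoc[OF h(1) q pr1_in[OF W U]] q1 h by simp
    qed
    then show "\<exists>h. h \<in> hom S Q (prd X W P) \<and> pr2 X W P \<cdot>\<^bsub>S\<^esub> h = a \<and> prd_ar S X (Id S W) p \<cdot>\<^bsub>S\<^esub> h = b"
      using h by blast
  next
    fix Q h k
    assume h: "h \<in> hom S Q (prd X W P)" and k: "k \<in> hom S Q (prd X W P)"
      and 1: "pr2 X W P \<cdot>\<^bsub>S\<^esub> h = pr2 X W P \<cdot>\<^bsub>S\<^esub> k"
      and 2: "prd_ar S X (Id S W) p \<cdot>\<^bsub>S\<^esub> h = prd_ar S X (Id S W) p \<cdot>\<^bsub>S\<^esub> k"
    show "h = k"
      by (rule prod_eqI[OF h k W P _ 1])
        (metis 2 q1 comp_assoc[OF h q pr1_in[OF W U]] comp_assoc[OF k q pr1_in[OF W U]])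
  qed
qed

text \<open>
  The fibre product of \<open>f1\<close> and \<open>f2\<close> is the preimage of the diagonal of \<open>U\<close> under \<open>f1 \<times> f2\<close>. For \<open>f1 = p\<close> and \<open>f2 = id\<close> the
  map \<open>\<gamma>\<close> is the graph of \<open>p\<close>; exchanging the two factors gives the transposed graph, which is why the
  statement is about two arbitrary maps.
\<close>

lemma cartesian_diagonal:
  assumes f1: "f1 \<in> hom S P1 U" and f2: "f2 \<in> hom S P2 U"
    and u1: "u1 \<in> hom S P P1" and u2: "u2 \<in> hom S P P2"
    and sq: "cartesian_square S f1 f2 u2 u1" and p: "p = f1 \<cdot>\<^bsub>S\<^esub> u1"
    and \<gamma>: "\<gamma> \<in> hom S P (prd X P1 P2)" "pr1 X P1 P2 \<cdot>\<^bsub>S\<^esub> \<gamma> = u1" "pr2 X P1 P2 \<cdot>\<^bsub>S\<^esub> \<gamma> = u2"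
    and \<delta>: "\<delta> \<in> hom S U (prd X U U)" "pr1 X U U \<cdot>\<^bsub>S\<^esub> \<delta> = Id S U" "pr2 X U U \<cdot>\<^bsub>S\<^esub> \<delta> = Id S U"
  shows "cartesian_square S (prd_ar S X f1 f2) \<delta> p \<gamma>"
proof -
  have Ob: "P1 \<in> Ob S" "P2 \<in> Ob S" "U \<in> Ob S" using hom_Ob[OF f1] hom_Ob[OF f2] by auto
  note r = pr1_in[OF Ob(3,3)] pr2_in[OF Ob(3,3)] and r' = pr1_in[OF Ob(1,2)] pr2_in[OF Ob(1,2)]
  note q = prd_ar_in[OF f1 f2] and q12 = pr1_prd_ar[OF f1 f2] pr2_prd_ar[OF f1 f2]
  have ph: "p \<in> hom S P U" using comp_in_hom[OF u1 f1] p by simp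
  have p2: "p = f2 \<cdot>\<^bsub>S\<^esub> u2" using sq p unfolding cartesian_square_def by simp
  have q1: "pr1 X U U \<cdot>\<^bsub>S\<^esub> prd_ar S X f1 f2 \<cdot>\<^bsub>S\<^esub> a = f1 \<cdot>\<^bsub>S\<^esub> pr1 X P1 P2 \<cdot>\<^bsub>S\<^esub> a"
    and q2: "pr2 X U U \<cdot>\<^bsub>S\<^esub> prd_ar S X f1 f2 \<cdot>\<^bsub>S\<^esub> a = f2 \<cdot>\<^bsub>S\<^esub> pr2 X P1 P2 \<cdot>\<^bsub>S\<^esub> a"
    if a: "a \<in> hom S Q (prd X P1 P2)" for a Q
    using comp_assoc[OF a q r(1)] comp_assoc[OF a q r(2)] comp_assoc[OF a r'(1) f1]
      comp_assoc[OF a r'(2) f2] q12 by auto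
  have d: "pr1 X U U \<cdot>\<^bsub>S\<^esub> \<delta> \<cdot>\<^bsub>S\<^esub> b = b" "pr2 X U U \<cdot>\<^bsub>S\<^esub> \<delta> \<cdot>\<^bsub>S\<^esub> b = b" if b: "b \<in> hom S Q U" for b Q
    using comp_assoc[OF b \<delta>(1) r(1)] comp_assoc[OF b \<delta>(1) r(2)] \<delta> id_comp[OF b] by auto
  have g: "pr1 X P1 P2 \<cdot>\<^bsub>S\<^esub> \<gamma> \<cdot>\<^bsub>S\<^esub> h = u1 \<cdot>\<^bsub>S\<^esub> h" "pr2 X P1 P2 \<cdot>\<^bsub>S\<^esub> \<gamma> \<cdot>\<^bsub>S\<^esub> h = u2 \<cdot>\<^bsub>S\<^esub> h"
    if h: "h \<in> hom S Q P" for h Q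
    using comp_assoc[OF h \<gamma>(1) r'(1)] comp_assoc[OF h \<gamma>(1) r'(2)] \<gamma> by auto
  have comm: "prd_ar S X f1 f2 \<cdot>\<^bsub>S\<^esub> \<gamma> = \<delta> \<cdot>\<^bsub>S\<^esub> p"
    by (rule prod_eqI[OF comp_in_hom[OF \<gamma>(1) q] comp_in_hom[OF ph \<delta>(1)] Ob(3,3)])
      (use q1[OF \<gamma>(1)] q2[OF \<gamma>(1)] d[OF ph] \<gamma> p p2 in simp_all)
  show ?thesis
  proof (rule cartesian_squareI[OF q \<delta>(1) ph \<gamma>(1) comm])
    fix Q a b
    assume a: "a \<in> hom S Q (prd X P1 P2)" and b: "b \<in> hom S Q U"
      and eq: "prd_ar S X f1 f2 \<cdot>\<^bsub>S\<^esub> a = \<delta> \<cdot>\<^bsub>S\<^esub> b"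
    have e: "f1 \<cdot>\<^bsub>S\<^esub> pr1 X P1 P2 \<cdot>\<^bsub>S\<^esub> a = b" "f2 \<cdot>\<^bsub>S\<^esub> pr2 X P1 P2 \<cdot>\<^bsub>S\<^esub> a = b"
      using q1[OF a] q2[OF a] d[OF b] eq by auto
    have "\<exists>!h. h \<in> hom S Q (Dom S u1) \<and> u1 \<cdot>\<^bsub>S\<^esub> h = pr1 X P1 P2 \<cdot>\<^bsub>S\<^esub> a \<and> u2 \<cdot>\<^bsub>S\<^esub> h = pr2 X P1 P2 \<cdot>\<^bsub>S\<^esub> a"
      using sq comp_in_hom[OF a r'(1)] comp_in_hom[OF a r'(2)] e homD[OF f1] homD[OF f2]
      unfolding cartesian_square_def by simp
    then obtain h where h: "h \<in> hom S Q P" "u1 \<cdot>\<^bsub>S\<^esub> h = pr1 X P1 P2 \<cdot>\<^bsub>S\<^esub> a"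
      "u2 \<cdot>\<^bsub>S\<^esub> h = pr2 X P1 P2 \<cdot>\<^bsub>S\<^esub> a" using homD[OF u1] by auto
    have "\<gamma> \<cdot>\<^bsub>S\<^esub> h = a"
      by (rule prod_eqI[OF comp_in_hom[OF h(1) \<gamma>(1)] a Ob(1,2)]) (use g[OF h(1)] h in simp_all)
    moreover have "p \<cdot>\<^bsub>S\<^esub> h = b" unfolding p using comp_assoc[OF h(1) u1 f1] h e by simp
    ultimately show "\<exists>h. h \<in> hom S Q P \<and> \<gamma> \<cdot>\<^bsub>S\<^esub> h = a \<and> p \<cdot>\<^bsub>S\<^esub> h = b" using h by blast
  next
    fix Q h k
    assume h: "h \<in> hom S Q P" and k: "k \<in> hom S Q P" and eq: "\<gamma> \<cdot>\<^bsub>S\<^esub> h = \<gamma> \<cdot>\<^bsub>S\<^esub> k"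
    have e: "u1 \<cdot>\<^bsub>S\<^esub> h = u1 \<cdot>\<^bsub>S\<^esub> k" "u2 \<cdot>\<^bsub>S\<^esub> h = u2 \<cdot>\<^bsub>S\<^esub> k" using g[OF h] g[OF k] eq by auto
    have "f1 \<cdot>\<^bsub>S\<^esub> u1 \<cdot>\<^bsub>S\<^esub> k = f2 \<cdot>\<^bsub>S\<^esub> u2 \<cdot>\<^bsub>S\<^esub> k"
      using comp_assoc[OF k u1 f1] comp_assoc[OF k u2 f2] p p2 by simp
    then have "\<exists>!h. h \<in> hom S Q (Dom S u1) \<and> u1 \<cdot>\<^bsub>S\<^esub> h = u1 \<cdot>\<^bsub>S\<^esub> k \<and> u2 \<cdot>\<^bsub>S\<^esub> h = u2 \<cdot>\<^bsub>S\<^esub> k"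
      using sq comp_in_hom[OF k u1] comp_in_hom[OF k u2] homD[OF f1] homD[OF f2]
      unfolding cartesian_square_def by simp
    then show "h = k" using e h k homD[OF u1] by auto
  qed
qed

lemma cartesian_id_right: "p \<in> hom S P U \<Longrightarrow> cartesian_square S p (Id S U) p (Id S P)"
  using hom_Ob[of p P U] by (intro cartesian_squareI[of _ P U _ U _ P])
    (auto simp: id_in_hom id_comp comp_id)

lemma cartesian_id_left: "p \<in> hom S P U \<Longrightarrow> cartesian_square S (Id S U) p (Id S P) p"
  using hom_Ob[of p P U] by (intro cartesian_squareI[of _ U U _ P _ P])
    (auto simp: id_in_hom id_comp comp_id)

end

section \<open>External tensor structures\<close>

context external_tensor_structure
begin

lemma tensor_pullback_external:
  assumes f: "f1 \<in> hom S T1 S1" "f2 \<in> hom S T2 S2"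
  shows "tensor_pullback (fib H T1) (fib H T2) (fib H (prd X T1 T2))
    (fib H S1) (fib H S2) (fib H (prd X S1 S2))
    (pull H f1) (pull H f2) (pull H (prd_ar S X f1 f2)) (etens M T1 T2) (etens M S1 S2) (emon M f1 f2)"
  using pull_functor[OF f(1)] pull_functor[OF f(2)] pull_functor[OF prd_ar_in[OF f]]
    etens_functor emon_iso[OF f] hom_Ob[OF f(1)] hom_Ob[OF f(2)]
  unfolding tensor_pullback_def by blast

abbreviation epairing where
  "epairing T1 T2 f1 f2 \<equiv> pairing (fib H (prd X T1 T2)) (etens M T1 T2) (emon M f1 f2)"

end

locale geometric_external_data =
  geometric_fibered_category S Sm H L + external_tensor_structure S X H M
  for S :: "('s, 'm) cat" and X :: "('s, 'm) products" and Sm :: "'m set"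
    and H :: "('s, 'm, 'o, 'a) fibered" and L :: "('m, 'o, 'a) adjoints"
    and M :: "('s, 'm, 'o, 'a) external"
begin

lemma smooth_prod_left:
  assumes "p \<in> Sm" "p \<in> hom S P U" "W \<in> Ob S"
  shows "prd_ar S X p (Id S W) \<in> Sm"
  using sm_base_change[OF cartesian_prod_left[OF assms(2,3)] assms(1)] .

lemma smooth_prod_right:
  assumes "p \<in> Sm" "p \<in> hom S P U" "W \<in> Ob S"
  shows "prd_ar S X (Id S W) p \<in> Sm"
  using sm_base_change[OF cartesian_prod_right[OF assms(2,3)] assms(1)] .

lemma adjoint_tensor_pullback_external:
  assumes f: "f1 \<in> hom S T1 S1" "f2 \<in> hom S T2 S2" and q: "q = prd_ar S X f1 f2" "q \<in> Sm"
  shows "adjoint_tensor_pullback (fib H T1) (fib H T2) (fib H (prd X T1 T2))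
    (fib H S1) (fib H S2) (fib H (prd X S1 S2))
    (pull H f1) (pull H f2) (pull H q) (etens M T1 T2) (etens M S1 S2) (emon M f1 f2)
    (push L q) (eta L q) (eps L q)"
  using tensor_pullback_external[OF f] push_adjoint[OF q(2)] homD[OF prd_ar_in[OF f]] q(1)
  unfolding adjoint_tensor_pullback_def by simp

lemma geometric_external_iff:
  "geometric_external S X Sm H L M \<longleftrightarrow> (\<forall>p1 \<in> Sm. \<forall>p2 \<in> Sm.
    (\<forall>A1 \<in> Ob (fib H (Dom S p1)). \<forall>A2 \<in> Ob (fib H (Cod S p2)).
      universal (prd_ar S X p1 (Id S (Cod S p2)))
        (ob (etens M (Cod S p1) (Cod S p2)) (ob (push L p1) A1, A2))
        (epairing (Dom S p1) (Cod S p2) p1 (Id S (Cod S p2)) (ob (push L p1) A1) A2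
          (eta L p1 A1) (Id (fib H (Cod S p2)) A2))) \<and>
    (\<forall>A1 \<in> Ob (fib H (Cod S p1)). \<forall>A2 \<in> Ob (fib H (Dom S p2)).
      universal (prd_ar S X (Id S (Cod S p1)) p2)
        (ob (etens M (Cod S p1) (Cod S p2)) (A1, ob (push L p2) A2))
        (epairing (Cod S p1) (Dom S p2) (Id S (Cod S p1)) p2 A1 (ob (push L p2) A2)
          (Id (fib H (Cod S p1)) A1) (eta L p2 A2))))"
  (is "_ \<longleftrightarrow> (\<forall>p1 \<in> Sm. \<forall>p2 \<in> Sm. ?l p1 p2 \<and> ?r p1 p2)")
  unfolding geometric_external_def Let_def
proof (rule ball_cong[OF refl], rule ball_cong[OF refl], rule conj_cong)
  fix p1 p2 assume p1: "p1 \<in> Sm" and p2: "p2 \<in> Sm"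
  define P1 S1 P2 S2 where "P1 = Dom S p1" and "S1 = Cod S p1" and "P2 = Dom S p2" and "S2 = Cod S p2"
  note defs = P1_def[symmetric] S1_def[symmetric] P2_def[symmetric] S2_def[symmetric]
  have h1: "p1 \<in> hom S P1 S1" and h2: "p2 \<in> hom S P2 S2"
    using p1 p2 sm_ar by (auto simp: hom_def P1_def S1_def P2_def S2_def)
  have S: "S1 \<in> Ob S" "S2 \<in> Ob S" using hom_Ob[OF h1] hom_Ob[OF h2] by auto
  interpret P1: category "fib H P1" by (rule fib_category) (use hom_Ob[OF h1] in blast)
  interpret P2: category "fib H P2" by (rule fib_category) (use hom_Ob[OF h2] in blast)
  interpret S1: category "fib H S1" by (rule fib_category[OF S(1)])
  interpret S2: category "fib H S2" by (rule fib_category[OF S(2)])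
  define ql qr where "ql = prd_ar S X p1 (Id S S2)" and "qr = prd_ar S X (Id S S1) p2"
  have ql: "ql \<in> Sm" and qr: "qr \<in> Sm"
    unfolding ql_def qr_def using smooth_prod_left[OF p1 h1 S(2)] smooth_prod_right[OF p2 h2 S(1)] by auto
  interpret l: adjoint_tensor_pullback "fib H P1" "fib H S2" "fib H (prd X P1 S2)"
    "fib H S1" "fib H S2" "fib H (prd X S1 S2)"
    "pull H p1" "pull H (Id S S2)" "pull H ql" "etens M P1 S2" "etens M S1 S2" "emon M p1 (Id S S2)"
    "push L ql" "eta L ql" "eps L ql"
    by (rule adjoint_tensor_pullback_external[OF h1 id_in_hom[OF S(2)] ql_def ql])
  interpret r: adjoint_tensor_pullback "fib H S1" "fib H P2" "fib H (prd X S1 P2)"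
    "fib H S1" "fib H S2" "fib H (prd X S1 S2)"
    "pull H (Id S S1)" "pull H p2" "pull H qr" "etens M S1 P2" "etens M S1 S2" "emon M (Id S S1) p2"
    "push L qr" "eta L qr" "eps L qr"
    by (rule adjoint_tensor_pullback_external[OF id_in_hom[OF S(1)] h2 qr_def qr])
  interpret p1: adjunction "fib H P1" "fib H S1" "push L p1" "pull H p1" "eta L p1" "eps L p1"
    using push_adjoint[OF p1] unfolding defs .
  interpret p2: adjunction "fib H P2" "fib H S2" "push L p2" "pull H p2" "eta L p2" "eps L p2"
    using push_adjoint[OF p2] unfolding defs .
  have push1: "is_functor (fib H P1) (fib H S1) (push L p1)"
    and push2: "is_functor (fib H P2) (fib H S2) (push L p2)" by unfold_locales
  note is_functors = l.T.is_functor_axioms r.T.is_functor_axioms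
    is_functor_comp[OF is_functor_prod[OF push1 is_functor_id[OF S2.category_axioms]] l.U.is_functor_axioms]
    is_functor_comp[OF is_functor_prod[OF is_functor_id[OF S1.category_axioms] push2] l.U.is_functor_axioms]
  have id1: "f \<cdot>\<^bsub>fib H S1\<^esub> Id (fib H S1) A = Id (fib H S1) B \<cdot>\<^bsub>fib H S1\<^esub> f"
    "ar (pull H (Id S S1)) f = f" if "f \<in> hom (fib H S1) A B" for f A B
    using that S1.comp_id S1.id_comp pull_id_ar[OF S(1)] S1.homD(1) by auto
  have id2: "f \<cdot>\<^bsub>fib H S2\<^esub> Id (fib H S2) A = Id (fib H S2) B \<cdot>\<^bsub>fib H S2\<^esub> f"
    "ar (pull H (Id S S2)) f = f" if "f \<in> hom (fib H S2) A B" for f A B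
    using that S2.comp_id S2.id_comp pull_id_ar[OF S(2)] S2.homD(1) by auto
  note [simp] = p1.L.ob_in p2.L.ob_in p1.unit_in p2.unit_in S1.id_in_hom S2.id_in_hom
    pull_id_ob[OF S(1)] pull_id_ob[OF S(2)] p1.L.ar_in p2.L.ar_in
  show "natural_isomorphism (fib H (Dom S p1) \<times>\<^sub>C fib H (Cod S p2)) (fib H (prd X (Cod S p1) (Cod S p2)))
       (push L (prd_ar S X p1 (Id S (Cod S p2))) \<circ>\<^sub>F etens M (Dom S p1) (Cod S p2))
       (etens M (Cod S p1) (Cod S p2) \<circ>\<^sub>F (push L p1 \<times>\<^sub>F id_funct))
       (external_projection_left S X H L M p1 (Cod S p2)) \<longleftrightarrow> ?l p1 p2"
    unfolding defs ql_def[symmetric]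
    apply (subst l.natural_isomorphism_pairing_iff[where
        ?X1.0 = fst and ?X2.0 = snd and
        ?Y1.0 = "\<lambda>Z. ob (push L p1) (fst Z)" and ?Y2.0 = snd and
        ?x1.0 = fst and ?x2.0 = snd and
        ?y1.0 = "\<lambda>z. ar (push L p1) (fst z)" and ?y2.0 = snd and
        ?\<phi>1.0 = "\<lambda>Z. eta L p1 (fst Z)" and ?\<phi>2.0 = "\<lambda>Z. Id (fib H S2) (snd Z)"])
    using homD[OF prd_ar_in[OF h1 id_in_hom[OF S(2)]]]
    by (auto intro!: is_functors simp: external_projection_left_def Let_def defs ql_def[symmetric]
          p1.unit_natural id2)
  show "natural_isomorphism (fib H (Cod S p1) \<times>\<^sub>C fib H (Dom S p2)) (fib H (prd X (Cod S p1) (Cod S p2)))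
       (push L (prd_ar S X (Id S (Cod S p1)) p2) \<circ>\<^sub>F etens M (Cod S p1) (Dom S p2))
       (etens M (Cod S p1) (Cod S p2) \<circ>\<^sub>F (id_funct \<times>\<^sub>F push L p2))
       (external_projection_right S X H L M (Cod S p1) p2) \<longleftrightarrow> ?r p1 p2"
    unfolding defs qr_def[symmetric]
    apply (subst r.natural_isomorphism_pairing_iff[where
        ?X1.0 = fst and ?X2.0 = snd and
        ?Y2.0 = "\<lambda>Z. ob (push L p2) (snd Z)" and ?Y1.0 = fst and
        ?x1.0 = fst and ?x2.0 = snd and
        ?y2.0 = "\<lambda>z. ar (push L p2) (snd z)" and ?y1.0 = fst and
        ?\<phi>2.0 = "\<lambda>Z. eta L p2 (snd Z)" and ?\<phi>1.0 = "\<lambda>Z. Id (fib H S1) (fst Z)"])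
    using homD[OF prd_ar_in[OF id_in_hom[OF S(1)] h2]]
    by (auto intro!: is_functors simp: external_projection_right_def Let_def defs qr_def[symmetric]
          p2.unit_natural id1)
qed

end

section \<open>Comparison of the two projection formulas\<close>

locale geometric_tensor_data =
  geometric_internal_data S Sm H L N + geometric_external_data S X Sm H L M
  for S :: "('s, 'm) cat" and X :: "('s, 'm) products" and Sm :: "'m set"
    and H :: "('s, 'm, 'o, 'a) fibered" and L :: "('m, 'o, 'a) adjoints"
    and N :: "('s, 'm, 'o, 'a) internal" and M :: "('s, 'm, 'o, 'a) external"
begin

text \<open>
  The arrow \<open>\<phi> : A \<rightarrow> f\<^sub>1\<^sup>*Y\<close> pulled back to \<open>pr\<^sub>1\<^sup>*A \<rightarrow> (f\<^sub>1 \<times> f\<^sub>2)\<^sup>*pr\<^sub>1\<^sup>*Y\<close>; likewise for the second factor.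
\<close>

abbreviation restricted1 where
  "restricted1 f1 f2 Y \<phi> \<equiv>
    exch S H (pr1 X (Dom S f1) (Dom S f2)) f1 (prd_ar S X f1 f2) (pr1 X (Cod S f1) (Cod S f2)) Y
      \<cdot>\<^bsub>fib H (prd X (Dom S f1) (Dom S f2))\<^esub> ar (pull H (pr1 X (Dom S f1) (Dom S f2))) \<phi>"

abbreviation restricted2 where
  "restricted2 f1 f2 Y \<phi> \<equiv>
    exch S H (pr2 X (Dom S f1) (Dom S f2)) f2 (prd_ar S X f1 f2) (pr2 X (Cod S f1) (Cod S f2)) Y
      \<cdot>\<^bsub>fib H (prd X (Dom S f1) (Dom S f2))\<^esub> ar (pull H (pr2 X (Dom S f1) (Dom S f2))) \<phi>"

text \<open>
  The product of \<open>\<phi>1\<close> and \<open>\<phi>2\<close> in the external structure \<open>pr\<^sub>1\<^sup>*(_) \<otimes> pr\<^sub>2\<^sup>*(_)\<close> attached to the internal one,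
  written as an internal product over the single map \<open>f\<^sub>1 \<times> f\<^sub>2\<close>.
\<close>

definition induced_pairing where
  "induced_pairing f1 f2 Y1 Y2 \<phi>1 \<phi>2 =
    ipairing (prd X (Dom S f1) (Dom S f2)) (prd_ar S X f1 f2)
      (ob (pull H (pr1 X (Cod S f1) (Cod S f2))) Y1) (ob (pull H (pr2 X (Cod S f1) (Cod S f2))) Y2)
      (restricted1 f1 f2 Y1 \<phi>1) (restricted2 f1 f2 Y2 \<phi>2)"

context
  fixes f1 f2 T1 T2 S1 S2
  assumes f1: "f1 \<in> hom S T1 S1" and f2: "f2 \<in> hom S T2 S2"
begin

lemma T_in: "T1 \<in> Ob S" "T2 \<in> Ob S" and S_in: "S1 \<in> Ob S" "S2 \<in> Ob S"
  using hom_Ob[OF f1] hom_Ob[OF f2] by auto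

lemma Dom_Cod: "Dom S f1 = T1" "Dom S f2 = T2" "Cod S f1 = S1" "Cod S f2 = S2"
  using homD[OF f1] homD[OF f2] by auto

lemmas
  exch1_in = exch_in[OF pr1_in[OF T_in] f1 prd_ar_in[OF f1 f2] pr1_in[OF S_in]
    pr1_prd_ar[OF f1 f2, symmetric]] and
  exch2_in = exch_in[OF pr2_in[OF T_in] f2 prd_ar_in[OF f1 f2] pr2_in[OF S_in]
    pr2_prd_ar[OF f1 f2, symmetric]]

lemma restricted1_in:
  assumes "Y \<in> Ob (fib H S1)" "\<phi> \<in> hom (fib H T1) A (ob (pull H f1) Y)"
  shows "restricted1 f1 f2 Y \<phi> \<in> hom (fib H (prd X T1 T2)) (ob (pull H (pr1 X T1 T2)) A)
    (ob (pull H (prd_ar S X f1 f2)) (ob (pull H (pr1 X S1 S2)) Y))"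
  unfolding Dom_Cod
  using category.comp_in_hom[OF fib_category[OF prd_in[OF T_in]]]
    pull_ar[OF pr1_in[OF T_in] assms(2)] exch1_in[OF assms(1)] by blast

lemma restricted2_in:
  assumes "Y \<in> Ob (fib H S2)" "\<phi> \<in> hom (fib H T2) A (ob (pull H f2) Y)"
  shows "restricted2 f1 f2 Y \<phi> \<in> hom (fib H (prd X T1 T2)) (ob (pull H (pr2 X T1 T2)) A)
    (ob (pull H (prd_ar S X f1 f2)) (ob (pull H (pr2 X S1 S2)) Y))"
  unfolding Dom_Cod
  using category.comp_in_hom[OF fib_category[OF prd_in[OF T_in]]]
    pull_ar[OF pr2_in[OF T_in] assms(2)] exch2_in[OF assms(1)] by blast

lemma iso_restricted1:
  assumes "Y \<in> Ob (fib H S1)" "\<phi> \<in> hom (fib H T1) A (ob (pull H f1) Y)" "iso (fib H T1) \<phi>"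
  shows "iso (fib H (prd X T1 T2)) (restricted1 f1 f2 Y \<phi>)"
  unfolding Dom_Cod
  using category.iso_comp[OF fib_category[OF prd_in[OF T_in]]]
    pull_ar[OF pr1_in[OF T_in] assms(2)] pull_iso[OF pr1_in[OF T_in] assms(2,3)] exch1_in[OF assms(1)]
    iso_exch[OF pr1_in[OF T_in] f1 prd_ar_in[OF f1 f2] pr1_in[OF S_in]
      pr1_prd_ar[OF f1 f2, symmetric] assms(1)] by blast

lemma iso_restricted2:
  assumes "Y \<in> Ob (fib H S2)" "\<phi> \<in> hom (fib H T2) A (ob (pull H f2) Y)" "iso (fib H T2) \<phi>"
  shows "iso (fib H (prd X T1 T2)) (restricted2 f1 f2 Y \<phi>)"
  unfolding Dom_Cod
  using category.iso_comp[OF fib_category[OF prd_in[OF T_in]]]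
    pull_ar[OF pr2_in[OF T_in] assms(2)] pull_iso[OF pr2_in[OF T_in] assms(2,3)] exch2_in[OF assms(1)]
    iso_exch[OF pr2_in[OF T_in] f2 prd_ar_in[OF f1 f2] pr2_in[OF S_in]
      pr2_prd_ar[OF f1 f2, symmetric] assms(1)] by blast

text \<open>
  The equivalence \<open>e\<close> is moved past \<open>\<phi>1\<close> and \<open>\<phi>2\<close> by naturality and past the comparison isomorphism by
  its compatibility with pullback; what remains is the structure attached to the internal one, whose two
  exchange isomorphisms are absorbed into the factors.
\<close>

lemma epairing_equivalence:
  assumes e: "external_equivalence S X H (ext_of_int S X H N) M e"
    and Y: "Y1 \<in> Ob (fib H S1)" "Y2 \<in> Ob (fib H S2)"
    and \<phi>: "\<phi>1 \<in> hom (fib H T1) X1 (ob (pull H f1) Y1)" "\<phi>2 \<in> hom (fib H T2) X2 (ob (pull H f2) Y2)"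
  shows "epairing T1 T2 f1 f2 Y1 Y2 \<phi>1 \<phi>2 \<cdot>\<^bsub>fib H (prd X T1 T2)\<^esub> e T1 T2 (X1, X2) =
    ar (pull H (prd_ar S X f1 f2)) (e S1 S2 (Y1, Y2)) \<cdot>\<^bsub>fib H (prd X T1 T2)\<^esub>
      induced_pairing f1 f2 Y1 Y2 \<phi>1 \<phi>2"
proof -
  let ?W = "prd X T1 T2" and ?V = "prd X S1 S2" and ?q = "prd_ar S X f1 f2" and ?E = "ext_of_int S X H N"
  interpret W: category "fib H ?W" by (rule fib_category[OF prd_in[OF T_in]])
  interpret M: tensor_pullback "fib H T1" "fib H T2" "fib H ?W" "fib H S1" "fib H S2" "fib H ?V"
    "pull H f1" "pull H f2" "pull H ?q" "etens M T1 T2" "etens M S1 S2" "emon M f1 f2"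
    by (rule tensor_pullback_external[OF f1 f2])
  interpret q: tensor_pullback "fib H ?W" "fib H ?W" "fib H ?W" "fib H ?V" "fib H ?V" "fib H ?V"
    "pull H ?q" "pull H ?q" "pull H ?q" "itens N ?W" "itens N ?V" "imon N ?q"
    by (rule tensor_pullback_internal[OF prd_ar_in[OF f1 f2]])
  interpret eT: natural_isomorphism "fib H T1 \<times>\<^sub>C fib H T2" "fib H ?W" "etens ?E T1 T2" "etens M T1 T2" "e T1 T2"
    using e T_in unfolding external_equivalence_def by blast
  interpret eS: natural_isomorphism "fib H S1 \<times>\<^sub>C fib H S2" "fib H ?V" "etens ?E S1 S2" "etens M S1 S2" "e S1 S2"
    using e S_in unfolding external_equivalence_def by blast
  have fY: "ob (pull H f1) Y1 \<in> Ob (fib H T1)" "ob (pull H f2) Y2 \<in> Ob (fib H T2)"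
    using pull_ob f1 f2 Y by auto
  have X12: "X1 \<in> Ob (fib H T1)" "X2 \<in> Ob (fib H T2)"
    using category.hom_Ob[OF fib_category[OF T_in(1)] \<phi>(1)]
      category.hom_Ob[OF fib_category[OF T_in(2)] \<phi>(2)] by auto
  have rY: "ob (pull H (pr1 X S1 S2)) Y1 \<in> Ob (fib H ?V)" "ob (pull H (pr2 X S1 S2)) Y2 \<in> Ob (fib H ?V)"
    using pull_ob pr1_in[OF S_in] pr2_in[OF S_in] Y by auto
  note r\<phi> = pull_ar[OF pr1_in[OF T_in] \<phi>(1)] pull_ar[OF pr2_in[OF T_in] \<phi>(2)]
  have eX: "e T1 T2 (X1, X2) \<in> hom (fib H ?W) (ob (etens ?E T1 T2) (X1, X2)) (ob (etens M T1 T2) (X1, X2))"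
    using eT.component_in[of "(X1, X2)"] X12 by simp
  have efY: "e T1 T2 (ob (pull H f1) Y1, ob (pull H f2) Y2) \<in> hom (fib H ?W)
      (ob (etens ?E T1 T2) (ob (pull H f1) Y1, ob (pull H f2) Y2)) (ob (etens M T1 T2) (ob (pull H f1) Y1, ob (pull H f2) Y2))"
    using eT.component_in[of "(ob (pull H f1) Y1, ob (pull H f2) Y2)"] fY by simp
  have eY: "e S1 S2 (Y1, Y2) \<in> hom (fib H ?V) (ob (etens ?E S1 S2) (Y1, Y2)) (ob (etens M S1 S2) (Y1, Y2))"
    using eS.component_in[of "(Y1, Y2)"] Y by simp
  have E\<phi>: "ar (etens ?E T1 T2) (\<phi>1, \<phi>2) \<in> hom (fib H ?W) (ob (etens ?E T1 T2) (X1, X2))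
      (ob (etens ?E T1 T2) (ob (pull H f1) Y1, ob (pull H f2) Y2))"
    using eT.F.ar_in[of "(\<phi>1, \<phi>2)" "(X1, X2)" "(ob (pull H f1) Y1, ob (pull H f2) Y2)"] \<phi> by simp
  have emonE: "emon ?E f1 f2 (Y1, Y2) = imon N ?q (ob (pull H (pr1 X S1 S2)) Y1, ob (pull H (pr2 X S1 S2)) Y2)
      \<cdot>\<^bsub>fib H ?W\<^esub> ar (itens N ?W) (exch S H (pr1 X T1 T2) f1 ?q (pr1 X S1 S2) Y1,
        exch S H (pr2 X T1 T2) f2 ?q (pr2 X S1 S2) Y2)"
    by (simp add: ext_of_int_def Let_def Dom_Cod)
  note m = q.mon_in[OF rY] and ex = q.tensor_in[OF exch1_in[OF Y(1)] exch2_in[OF Y(2)]]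
    and T\<phi> = q.tensor_in[OF r\<phi>]
  have mex: "emon ?E f1 f2 (Y1, Y2) \<in> hom (fib H ?W)
      (ob (etens ?E T1 T2) (ob (pull H f1) Y1, ob (pull H f2) Y2)) (ob (pull H ?q) (ob (etens ?E S1 S2) (Y1, Y2)))"
    unfolding emonE using W.comp_in_hom[OF ex m] by (simp add: ext_of_int_def)
  have "epairing T1 T2 f1 f2 Y1 Y2 \<phi>1 \<phi>2 \<cdot>\<^bsub>fib H ?W\<^esub> e T1 T2 (X1, X2)
      = emon M f1 f2 (Y1, Y2) \<cdot>\<^bsub>fib H ?W\<^esub> (ar (etens M T1 T2) (\<phi>1, \<phi>2) \<cdot>\<^bsub>fib H ?W\<^esub> e T1 T2 (X1, X2))"
    unfolding pairing_def by (rule W.comp_assoc[OF eX M.tensor_in[OF \<phi>] M.mon_in[OF Y]])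
  also have "\<dots> = emon M f1 f2 (Y1, Y2) \<cdot>\<^bsub>fib H ?W\<^esub>
      (e T1 T2 (ob (pull H f1) Y1, ob (pull H f2) Y2) \<cdot>\<^bsub>fib H ?W\<^esub> ar (etens ?E T1 T2) (\<phi>1, \<phi>2))"
    using eT.naturality[of "(\<phi>1, \<phi>2)" "(X1, X2)" "(ob (pull H f1) Y1, ob (pull H f2) Y2)"] \<phi> by simp
  also have "\<dots> = (ar (pull H ?q) (e S1 S2 (Y1, Y2)) \<cdot>\<^bsub>fib H ?W\<^esub> emon ?E f1 f2 (Y1, Y2))
      \<cdot>\<^bsub>fib H ?W\<^esub> ar (etens ?E T1 T2) (\<phi>1, \<phi>2)"
    using W.comp_assoc[OF E\<phi> efY M.mon_in[OF Y]] e f1 f2 Y unfolding external_equivalence_def by simp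
  also have "\<dots> = ar (pull H ?q) (e S1 S2 (Y1, Y2)) \<cdot>\<^bsub>fib H ?W\<^esub>
      (emon ?E f1 f2 (Y1, Y2) \<cdot>\<^bsub>fib H ?W\<^esub> ar (etens ?E T1 T2) (\<phi>1, \<phi>2))"
    by (rule W.comp_assoc[OF E\<phi> mex pull_ar[OF prd_ar_in[OF f1 f2] eY]])
  also have "emon ?E f1 f2 (Y1, Y2) \<cdot>\<^bsub>fib H ?W\<^esub> ar (etens ?E T1 T2) (\<phi>1, \<phi>2)
      = induced_pairing f1 f2 Y1 Y2 \<phi>1 \<phi>2"
    unfolding emonE induced_pairing_def Dom_Cod pairing_def
    using W.comp_assoc[OF T\<phi> ex m] q.tensor_comp[OF r\<phi> exch1_in[OF Y(1)] exch2_in[OF Y(2)]]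
    by (simp add: ext_of_int_def)
  finally show ?thesis .
qed

lemma universal_epairing_iff:
  assumes e: "external_equivalent S X H (ext_of_int S X H N) M" and q: "prd_ar S X f1 f2 \<in> Sm"
    and Y: "Y1 \<in> Ob (fib H S1)" "Y2 \<in> Ob (fib H S2)"
    and \<phi>: "\<phi>1 \<in> hom (fib H T1) X1 (ob (pull H f1) Y1)" "\<phi>2 \<in> hom (fib H T2) X2 (ob (pull H f2) Y2)"
  shows "universal (prd_ar S X f1 f2) (ob (etens M S1 S2) (Y1, Y2)) (epairing T1 T2 f1 f2 Y1 Y2 \<phi>1 \<phi>2) \<longleftrightarrow>
    universal (prd_ar S X f1 f2)
      (ob (itens N (prd X S1 S2)) (ob (pull H (pr1 X S1 S2)) Y1, ob (pull H (pr2 X S1 S2)) Y2))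
      (induced_pairing f1 f2 Y1 Y2 \<phi>1 \<phi>2)"
proof -
  let ?W = "prd X T1 T2" and ?V = "prd X S1 S2" and ?q = "prd_ar S X f1 f2" and ?E = "ext_of_int S X H N"
  obtain e where e: "external_equivalence S X H ?E M e"
    using e unfolding external_equivalent_def by blast
  interpret M: tensor_pullback "fib H T1" "fib H T2" "fib H ?W" "fib H S1" "fib H S2" "fib H ?V"
    "pull H f1" "pull H f2" "pull H ?q" "etens M T1 T2" "etens M S1 S2" "emon M f1 f2"
    by (rule tensor_pullback_external[OF f1 f2])
  interpret q: tensor_pullback "fib H ?W" "fib H ?W" "fib H ?W" "fib H ?V" "fib H ?V" "fib H ?V"
    "pull H ?q" "pull H ?q" "pull H ?q" "itens N ?W" "itens N ?V" "imon N ?q"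
    by (rule tensor_pullback_internal[OF prd_ar_in[OF f1 f2]])
  interpret adj: adjunction "fib H ?W" "fib H ?V" "push L ?q" "pull H ?q" "eta L ?q" "eps L ?q"
    using push_adjoint[OF q] homD[OF prd_ar_in[OF f1 f2]] by simp
  have rY: "ob (pull H (pr1 X S1 S2)) Y1 \<in> Ob (fib H ?V)" "ob (pull H (pr2 X S1 S2)) Y2 \<in> Ob (fib H ?V)"
    using pull_ob pr1_in[OF S_in] pr2_in[OF S_in] Y by auto
  have X12: "X1 \<in> Ob (fib H T1)" "X2 \<in> Ob (fib H T2)"
    using category.hom_Ob[OF fib_category[OF T_in(1)] \<phi>(1)]
      category.hom_Ob[OF fib_category[OF T_in(2)] \<phi>(2)] by auto
  have eT: "natural_isomorphism (fib H T1 \<times>\<^sub>C fib H T2) (fib H ?W) (etens ?E T1 T2) (etens M T1 T2) (e T1 T2)"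
    and eS: "natural_isomorphism (fib H S1 \<times>\<^sub>C fib H S2) (fib H ?V) (etens ?E S1 S2) (etens M S1 S2) (e S1 S2)"
    using e T_in S_in unfolding external_equivalence_def by blast+
  have eX: "e T1 T2 (X1, X2) \<in> hom (fib H ?W) (ob (etens ?E T1 T2) (X1, X2)) (ob (etens M T1 T2) (X1, X2))"
      "iso (fib H ?W) (e T1 T2 (X1, X2))"
    using natural_transformation.component_in[OF natural_isomorphism.axioms(1)[OF eT], of "(X1, X2)"]
      natural_isomorphism.component_iso[OF eT, of "(X1, X2)"] X12 by auto
  have eY: "e S1 S2 (Y1, Y2) \<in> hom (fib H ?V) (ob (etens ?E S1 S2) (Y1, Y2)) (ob (etens M S1 S2) (Y1, Y2))"
      "iso (fib H ?V) (e S1 S2 (Y1, Y2))"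
    using natural_transformation.component_in[OF natural_isomorphism.axioms(1)[OF eS], of "(Y1, Y2)"]
      natural_isomorphism.component_iso[OF eS, of "(Y1, Y2)"] Y by auto
  have ind: "induced_pairing f1 f2 Y1 Y2 \<phi>1 \<phi>2 \<in> hom (fib H ?W) (ob (etens ?E T1 T2) (X1, X2))
      (ob (pull H ?q) (ob (etens ?E S1 S2) (Y1, Y2)))"
    unfolding induced_pairing_def
    using q.pairing_in[OF restricted1_in[OF Y(1) \<phi>(1)] restricted2_in[OF Y(2) \<phi>(2)] rY]
    by (simp add: Dom_Cod ext_of_int_def)
  show ?thesis
    using adj.universal_cong[OF ind M.pairing_in[OF \<phi> Y] eX eY epairing_equivalence[OF e Y \<phi>]]
      homD[OF prd_ar_in[OF f1 f2]] by (simp add: ext_of_int_def)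
qed

end

text \<open>
  Pull the universal arrow on \<open>P1 \<times> P2\<close> back along the square of \<open>cartesian_diagonal\<close>. It stays universal and,
  by \<open>pairing_base_change\<close>, becomes the internal product of the pulled-back factors; by
  \<open>exch_restrict_twice\<close> these factors are \<open>\<chi>1\<close> and \<open>\<chi>2\<close> up to connection isomorphisms.
\<close>

lemma universal_diagonal_restriction:
  assumes f1: "f1 \<in> hom S P1 U" and f2: "f2 \<in> hom S P2 U"
    and u1: "u1 \<in> hom S P P1" and u2: "u2 \<in> hom S P P2"
    and sq: "cartesian_square S f1 f2 u2 u1" and p: "p = f1 \<cdot>\<^bsub>S\<^esub> u1"
    and q: "prd_ar S X f1 f2 \<in> Sm"
    and Y: "Y1 \<in> Ob (fib H U)" "Y2 \<in> Ob (fib H U)"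
    and \<phi>: "\<phi>1 \<in> hom (fib H P1) X1 (ob (pull H f1) Y1)" "\<phi>2 \<in> hom (fib H P2) X2 (ob (pull H f2) Y2)"
    and \<chi>1: "\<chi>1 \<in> hom (fib H P) (ob (pull H u1) X1) (ob (pull H p) Y1)"
      "conn H u1 f1 Y1 \<cdot>\<^bsub>fib H P\<^esub> \<chi>1 = ar (pull H u1) \<phi>1"
    and \<chi>2: "\<chi>2 \<in> hom (fib H P) (ob (pull H u2) X2) (ob (pull H p) Y2)"
      "conn H u2 f2 Y2 \<cdot>\<^bsub>fib H P\<^esub> \<chi>2 = ar (pull H u2) \<phi>2"
    and univ: "universal (prd_ar S X f1 f2)
      (ob (itens N (prd X U U)) (ob (pull H (pr1 X U U)) Y1, ob (pull H (pr2 X U U)) Y2))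
      (induced_pairing f1 f2 Y1 Y2 \<phi>1 \<phi>2)"
  shows "universal p (ob (itens N U) (Y1, Y2)) (ipairing P p Y1 Y2 \<chi>1 \<chi>2)"
proof -
  have Ob: "P1 \<in> Ob S" "P2 \<in> Ob S" "U \<in> Ob S" "P \<in> Ob S"
    using hom_Ob[OF f1] hom_Ob[OF f2] hom_Ob[OF u1] by auto
  obtain \<gamma> where \<gamma>: "\<gamma> \<in> hom S P (prd X P1 P2)" "pr1 X P1 P2 \<cdot>\<^bsub>S\<^esub> \<gamma> = u1" "pr2 X P1 P2 \<cdot>\<^bsub>S\<^esub> \<gamma> = u2"
    using pairE[OF u1 u2] .
  obtain \<delta> where \<delta>: "\<delta> \<in> hom S U (prd X U U)" "pr1 X U U \<cdot>\<^bsub>S\<^esub> \<delta> = Id S U" "pr2 X U U \<cdot>\<^bsub>S\<^esub> \<delta> = Id S U"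
    using pairE[OF id_in_hom[OF Ob(3)] id_in_hom[OF Ob(3)]] .
  define Q V q where "Q = prd X P1 P2" and "V = prd X U U" and "q = prd_ar S X f1 f2"
  have square: "cartesian_square S q \<delta> p \<gamma>"
    unfolding q_def by (rule cartesian_diagonal[OF f1 f2 u1 u2 sq p \<gamma> \<delta>])
  have ph: "p \<in> hom S P U" using comp_in_hom[OF u1 f1] p by simp
  have q: "q \<in> Sm" and qh: "q \<in> hom S Q V"
    using q prd_ar_in[OF f1 f2] by (auto simp: q_def Q_def V_def)
  have p_Sm: "p \<in> Sm" by (rule sm_base_change[OF square q])
  have comm: "q \<cdot>\<^bsub>S\<^esub> \<gamma> = \<delta> \<cdot>\<^bsub>S\<^esub> p" using square unfolding cartesian_square_def by simp
  have \<gamma>h: "\<gamma> \<in> hom S P Q" and \<delta>h: "\<delta> \<in> hom S U V" using \<gamma> \<delta> by (auto simp: Q_def V_def)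
  note r = pr1_in[OF Ob(3,3), folded V_def] pr2_in[OF Ob(3,3), folded V_def]
  note r' = pr1_in[OF Ob(1,2), folded Q_def] pr2_in[OF Ob(1,2), folded Q_def]
  note rq = pr1_prd_ar[OF f1 f2, symmetric, folded q_def] pr2_prd_ar[OF f1 f2, symmetric, folded q_def]
  interpret P: category "fib H P" by (rule fib_category[OF Ob(4)])
  interpret U: category "fib H U" by (rule fib_category[OF Ob(3)])
  interpret Q: category "fib H Q" by (rule fib_category) (use hom_Ob[OF qh] in blast)
  interpret V: category "fib H V" by (rule fib_category) (use hom_Ob[OF qh] in blast)
  interpret \<gamma>: tensor_pullback "fib H P" "fib H P" "fib H P" "fib H Q" "fib H Q" "fib H Q"
    "pull H \<gamma>" "pull H \<gamma>" "pull H \<gamma>" "itens N P" "itens N Q" "imon N \<gamma>"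
    by (rule tensor_pullback_internal[OF \<gamma>h])
  interpret \<delta>: tensor_pullback "fib H U" "fib H U" "fib H U" "fib H V" "fib H V" "fib H V"
    "pull H \<delta>" "pull H \<delta>" "pull H \<delta>" "itens N U" "itens N V" "imon N \<delta>"
    by (rule tensor_pullback_internal[OF \<delta>h])
  interpret q: tensor_pullback "fib H Q" "fib H Q" "fib H Q" "fib H V" "fib H V" "fib H V"
    "pull H q" "pull H q" "pull H q" "itens N Q" "itens N V" "imon N q"
    by (rule tensor_pullback_internal[OF qh])
  interpret p: adjoint_tensor_pullback "fib H P" "fib H P" "fib H P" "fib H U" "fib H U" "fib H U"
    "pull H p" "pull H p" "pull H p" "itens N P" "itens N U" "imon N p"
    "push L p" "eta L p" "eps L p"
    by (rule adjoint_tensor_pullback_internal[OF p_Sm ph])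
  let ?Z1 = "ob (pull H (pr1 X U U)) Y1" and ?Z2 = "ob (pull H (pr2 X U U)) Y2"
  let ?\<theta>1 = "restricted1 f1 f2 Y1 \<phi>1" and ?\<theta>2 = "restricted2 f1 f2 Y2 \<phi>2"
  let ?R1 = "ob (pull H (pr1 X P1 P2)) X1" and ?R2 = "ob (pull H (pr2 X P1 P2)) X2"
  let ?Z = "ob (itens N V) (?Z1, ?Z2)"
  let ?\<theta> = "ipairing Q q ?Z1 ?Z2 ?\<theta>1 ?\<theta>2"
  let ?\<omega> = "exch S H \<gamma> q p \<delta> ?Z \<cdot>\<^bsub>fib H P\<^esub> ar (pull H \<gamma>) ?\<theta>"
  let ?\<omega>1 = "exch S H \<gamma> q p \<delta> ?Z1 \<cdot>\<^bsub>fib H P\<^esub> ar (pull H \<gamma>) ?\<theta>1"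
  let ?\<omega>2 = "exch S H \<gamma> q p \<delta> ?Z2 \<cdot>\<^bsub>fib H P\<^esub> ar (pull H \<gamma>) ?\<theta>2"
  note dc = Dom_Cod[OF f1 f2]
  have Z: "?Z1 \<in> Ob (fib H V)" "?Z2 \<in> Ob (fib H V)" using pull_ob r Y by auto
  have Z12: "?Z \<in> Ob (fib H V)" using \<delta>.U.ob_in[of "(?Z1, ?Z2)"] Z by simp
  have X12: "X1 \<in> Ob (fib H P1)" "X2 \<in> Ob (fib H P2)"
    using category.hom_Ob[OF fib_category[OF Ob(1)] \<phi>(1)]
      category.hom_Ob[OF fib_category[OF Ob(2)] \<phi>(2)] by auto
  have R: "?R1 \<in> Ob (fib H Q)" "?R2 \<in> Ob (fib H Q)" using pull_ob r' X12 by auto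
  have \<theta>12: "?\<theta>1 \<in> hom (fib H Q) ?R1 (ob (pull H q) ?Z1)" "?\<theta>2 \<in> hom (fib H Q) ?R2 (ob (pull H q) ?Z2)"
    using restricted1_in[OF f1 f2 Y(1) \<phi>(1)] restricted2_in[OF f1 f2 Y(2) \<phi>(2)]
    unfolding Q_def V_def q_def by auto
  note \<theta> = q.pairing_in[OF \<theta>12 Z]
  note ex = exch_in[OF \<gamma>h qh ph \<delta>h comm]
  have \<omega>: "?\<omega> \<in> hom (fib H P) (ob (pull H \<gamma>) (ob (itens N Q) (?R1, ?R2))) (ob (pull H p) (ob (pull H \<delta>) ?Z))"
    using P.comp_in_hom[OF pull_ar[OF \<gamma>h \<theta>] ex[OF Z12]] .
  have \<omega>12: "?\<omega>1 \<in> hom (fib H P) (ob (pull H \<gamma>) ?R1) (ob (pull H p) (ob (pull H \<delta>) ?Z1))"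
    "?\<omega>2 \<in> hom (fib H P) (ob (pull H \<gamma>) ?R2) (ob (pull H p) (ob (pull H \<delta>) ?Z2))"
    using P.comp_in_hom[OF pull_ar[OF \<gamma>h \<theta>12(1)] ex[OF Z(1)]]
      P.comp_in_hom[OF pull_ar[OF \<gamma>h \<theta>12(2)] ex[OF Z(2)]] by auto
  have \<delta>Z: "ob (pull H \<delta>) ?Z1 \<in> Ob (fib H U)" "ob (pull H \<delta>) ?Z2 \<in> Ob (fib H U)"
    using pull_ob \<delta>h Z by auto
  (* base change along the diagonal of U *)
  have "universal p (ob (pull H \<delta>) ?Z) ?\<omega>"
    using universal_base_change[OF square q, of ?\<theta> _ ?Z] univ \<theta> Z12 homD[OF qh] homD[OF ph]
    unfolding induced_pairing_def dc Q_def V_def q_def by simp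
  then have 1: "p.adj.universal (ob (pull H \<delta>) ?Z) ?\<omega>" using homD[OF ph] by simp
  have m\<gamma>: "imon N \<gamma> (?R1, ?R2) \<in> hom (fib H P) (ob (itens N P) (ob (pull H \<gamma>) ?R1, ob (pull H \<gamma>) ?R2))
      (ob (pull H \<gamma>) (ob (itens N Q) (?R1, ?R2)))" "iso (fib H P) (imon N \<gamma> (?R1, ?R2))"
    using \<gamma>.mon_in[OF R] \<gamma>.\<mu>.component_iso[of "(?R1, ?R2)"] R by auto
  have m\<delta>: "imon N \<delta> (?Z1, ?Z2) \<in> hom (fib H U) (ob (itens N U) (ob (pull H \<delta>) ?Z1, ob (pull H \<delta>) ?Z2))
      (ob (pull H \<delta>) ?Z)" "iso (fib H U) (imon N \<delta> (?Z1, ?Z2))"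
    using \<delta>.mon_in[OF Z] \<delta>.\<mu>.component_iso[of "(?Z1, ?Z2)"] Z by auto
  (* from the pulled-back product to the product of the pulled-back factors *)
  have 2: "p.adj.universal (ob (itens N U) (ob (pull H \<delta>) ?Z1, ob (pull H \<delta>) ?Z2))
      (ipairing P p (ob (pull H \<delta>) ?Z1) (ob (pull H \<delta>) ?Z2) ?\<omega>1 ?\<omega>2)"
    using p.adj.universal_cong[OF p.pairing_in[OF \<omega>12 \<delta>Z] \<omega> m\<gamma> m\<delta>
        pairing_base_change[OF \<gamma>h qh ph \<delta>h comm Z \<theta>12]] 1 by simp
  have c\<gamma>: "conn H \<gamma> (pr1 X P1 P2) X1 \<in> hom (fib H P) (ob (pull H u1) X1) (ob (pull H \<gamma>) ?R1)"
    "conn H \<gamma> (pr2 X P1 P2) X2 \<in> hom (fib H P) (ob (pull H u2) X2) (ob (pull H \<gamma>) ?R2)"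
    "iso (fib H P) (conn H \<gamma> (pr1 X P1 P2) X1)" "iso (fib H P) (conn H \<gamma> (pr2 X P1 P2) X2)"
    using conn_in[OF \<gamma>h r'(1) X12(1)] conn_in[OF \<gamma>h r'(2) X12(2)] \<gamma>
      iso_conn[OF \<gamma>h r'(1) X12(1)] iso_conn[OF \<gamma>h r'(2) X12(2)] by auto
  have c\<delta>: "conn H \<delta> (pr1 X U U) Y1 \<in> hom (fib H U) Y1 (ob (pull H \<delta>) ?Z1)"
    "conn H \<delta> (pr2 X U U) Y2 \<in> hom (fib H U) Y2 (ob (pull H \<delta>) ?Z2)"
    "iso (fib H U) (conn H \<delta> (pr1 X U U) Y1)" "iso (fib H U) (conn H \<delta> (pr2 X U U) Y2)"
    using conn_in[OF \<delta>h r(1) Y(1)] conn_in[OF \<delta>h r(2) Y(2)] \<delta> pull_id_ob[OF Ob(3)] Y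
      iso_conn[OF \<delta>h r(1) Y(1)] iso_conn[OF \<delta>h r(2) Y(2)] by auto
  have "?\<omega>1 \<cdot>\<^bsub>fib H P\<^esub> conn H \<gamma> (pr1 X P1 P2) X1 = ar (pull H p) (conn H \<delta> (pr1 X U U) Y1) \<cdot>\<^bsub>fib H P\<^esub> \<chi>1"
    using exch_restrict_twice[OF f1 r(1) r'(1) qh \<gamma>h ph \<delta>h rq(1) comm \<delta>(2) Y(1) \<phi>(1), unfolded \<gamma>(2), OF \<chi>1]
    unfolding dc Q_def V_def q_def .
  moreover have "?\<omega>2 \<cdot>\<^bsub>fib H P\<^esub> conn H \<gamma> (pr2 X P1 P2) X2 = ar (pull H p) (conn H \<delta> (pr2 X U U) Y2) \<cdot>\<^bsub>fib H P\<^esub> \<chi>2"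
    using exch_restrict_twice[OF f2 r(2) r'(2) qh \<gamma>h ph \<delta>h rq(2) comm \<delta>(3) Y(2) \<phi>(2), unfolded \<gamma>(3), OF \<chi>2]
    unfolding dc Q_def V_def q_def .
  ultimately have "p.adj.universal (ob (itens N U) (Y1, Y2)) (ipairing P p Y1 Y2 \<chi>1 \<chi>2)"
    using p.universal_pairing_cong[OF \<chi>1(1) \<chi>2(1) \<omega>12 c\<gamma> c\<delta>] 2 by simp
  then show ?thesis using homD[OF ph] by simp
qed

text \<open>
  In each of the two maps one factor is a unit, which stays universal on the product by base change
  along a projection, and the other is an isomorphism.
\<close>

lemma geometric_internal_imp_external:
  assumes equiv: "external_equivalent S X H (ext_of_int S X H N) M"
    and geo: "geometric_internal S Sm H L N"
  shows "geometric_external S X Sm H L M"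
  unfolding geometric_external_iff
proof (intro ballI conjI)
  fix p1 p2 assume p1: "p1 \<in> Sm" and p2: "p2 \<in> Sm"
  define P1 S1 P2 S2 where "P1 = Dom S p1" and "S1 = Cod S p1" and "P2 = Dom S p2" and "S2 = Cod S p2"
  note defs = P1_def[symmetric] S1_def[symmetric] P2_def[symmetric] S2_def[symmetric]
  have h1: "p1 \<in> hom S P1 S1" and h2: "p2 \<in> hom S P2 S2"
    using p1 p2 sm_ar by (auto simp: hom_def P1_def S1_def P2_def S2_def)
  have S: "S1 \<in> Ob S" "S2 \<in> Ob S" using hom_Ob[OF h1] hom_Ob[OF h2] by auto
  note r = pr1_in[OF S] pr2_in[OF S]
  {
    fix A1 A2 assume A: "A1 \<in> Ob (fib H (Dom S p1))" "A2 \<in> Ob (fib H (Cod S p2))"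
    interpret p1: adjunction "fib H P1" "fib H S1" "push L p1" "pull H p1" "eta L p1" "eps L p1"
      using push_adjoint[OF p1] unfolding defs .
    interpret S2: category "fib H S2" by (rule fib_category[OF S(2)])
    note A = A[unfolded defs]
    note i = id_in_hom[OF S(2)] and q = smooth_prod_left[OF p1 h1 S(2)]
    note qh = prd_ar_in[OF h1 i]
    have Y: "ob (push L p1) A1 \<in> Ob (fib H S1)" "A2 \<in> Ob (fib H S2)" using p1.L.ob_in A by auto
    have \<phi>: "eta L p1 A1 \<in> hom (fib H P1) A1 (ob (pull H p1) (ob (push L p1) A1))"
      "Id (fib H S2) A2 \<in> hom (fib H S2) A2 (ob (pull H (Id S S2)) A2)"
      using p1.unit_in[OF A(1)] S2.id_in_hom[OF A(2)] pull_id_ob[OF S(2) A(2)] by auto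
    have "universal (prd_ar S X p1 (Id S S2)) (ob (pull H (pr1 X S1 S2)) (ob (push L p1) A1))
        (restricted1 p1 (Id S S2) (ob (push L p1) A1) (eta L p1 A1))"
      using universal_base_change[OF cartesian_prod_left[OF h1 S(2)] p1, of "eta L p1 A1" A1]
        \<phi>(1) Y(1) p1.universal_unit[OF A(1)] homD[OF qh] Dom_Cod[OF h1 i] by simp
    then show "universal (prd_ar S X p1 (Id S (Cod S p2)))
        (ob (etens M (Cod S p1) (Cod S p2)) (ob (push L p1) A1, A2))
        (epairing (Dom S p1) (Cod S p2) p1 (Id S (Cod S p2)) (ob (push L p1) A1) A2
          (eta L p1 A1) (Id (fib H (Cod S p2)) A2))"
      unfolding defs universal_epairing_iff[OF h1 i equiv q Y \<phi>] induced_pairing_def Dom_Cod[OF h1 i]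
      using universal_pairing_left[OF geo q qh pull_ob[OF r(1) Y(1)] pull_ob[OF r(2) Y(2)]
          restricted1_in[OF h1 i Y(1) \<phi>(1)] restricted2_in[OF h1 i Y(2) \<phi>(2)] _
          iso_restricted2[OF h1 i Y(2) \<phi>(2) S2.iso_Id[OF A(2)]]] Dom_Cod[OF h1 i] by simp
  next
    fix A1 A2 assume A: "A1 \<in> Ob (fib H (Cod S p1))" "A2 \<in> Ob (fib H (Dom S p2))"
    interpret p2: adjunction "fib H P2" "fib H S2" "push L p2" "pull H p2" "eta L p2" "eps L p2"
      using push_adjoint[OF p2] unfolding defs .
    interpret S1: category "fib H S1" by (rule fib_category[OF S(1)])
    note A = A[unfolded defs]
    note i = id_in_hom[OF S(1)] and q = smooth_prod_right[OF p2 h2 S(1)]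
    note qh = prd_ar_in[OF i h2]
    have Y: "A1 \<in> Ob (fib H S1)" "ob (push L p2) A2 \<in> Ob (fib H S2)" using p2.L.ob_in A by auto
    have \<phi>: "Id (fib H S1) A1 \<in> hom (fib H S1) A1 (ob (pull H (Id S S1)) A1)"
      "eta L p2 A2 \<in> hom (fib H P2) A2 (ob (pull H p2) (ob (push L p2) A2))"
      using p2.unit_in[OF A(2)] S1.id_in_hom[OF A(1)] pull_id_ob[OF S(1) A(1)] by auto
    have "universal (prd_ar S X (Id S S1) p2) (ob (pull H (pr2 X S1 S2)) (ob (push L p2) A2))
        (restricted2 (Id S S1) p2 (ob (push L p2) A2) (eta L p2 A2))"
      using universal_base_change[OF cartesian_prod_right[OF h2 S(1)] p2, of "eta L p2 A2" A2]
        \<phi>(2) Y(2) p2.universal_unit[OF A(2)] homD[OF qh] Dom_Cod[OF i h2] by simp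
    then show "universal (prd_ar S X (Id S (Cod S p1)) p2)
        (ob (etens M (Cod S p1) (Cod S p2)) (A1, ob (push L p2) A2))
        (epairing (Cod S p1) (Dom S p2) (Id S (Cod S p1)) p2 A1 (ob (push L p2) A2)
          (Id (fib H (Cod S p1)) A1) (eta L p2 A2))"
      unfolding defs universal_epairing_iff[OF i h2 equiv q Y \<phi>] induced_pairing_def Dom_Cod[OF i h2]
      using universal_pairing_right[OF geo q qh pull_ob[OF r(1) Y(1)] pull_ob[OF r(2) Y(2)]
          restricted1_in[OF i h2 Y(1) \<phi>(1)] restricted2_in[OF i h2 Y(2) \<phi>(2)] _
          iso_restricted1[OF i h2 Y(1) \<phi>(1) S1.iso_Id[OF A(1)]]] Dom_Cod[OF i h2] by simp
  }
qed

text \<open>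
  The two maps use the graph of \<open>p\<close> and its transpose: one factor is restricted along the identity of \<open>P\<close>,
  the other along \<open>p\<close> itself. By strict unitality the connection isomorphisms occurring here are
  identities.
\<close>

lemma geometric_external_imp_internal:
  assumes equiv: "external_equivalent S X H (ext_of_int S X H N) M"
    and geo: "geometric_external S X Sm H L M"
  shows "geometric_internal S Sm H L N"
  unfolding geometric_internal_iff
proof (intro ballI conjI)
  fix p assume p: "p \<in> Sm"
  define P U where "P = Dom S p" and "U = Cod S p"
  note defs = P_def[symmetric] U_def[symmetric]
  have h: "p \<in> hom S P U" using p sm_ar by (auto simp: hom_def P_def U_def)
  have PU: "P \<in> Ob S" "U \<in> Ob S" using hom_Ob[OF h] by auto
  note i = id_in_hom[OF PU(2)] and j = id_in_hom[OF PU(1)]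
  interpret P: category "fib H P" by (rule fib_category[OF PU(1)])
  interpret U: category "fib H U" by (rule fib_category[OF PU(2)])
  interpret p: adjunction "fib H P" "fib H U" "push L p" "pull H p" "eta L p" "eps L p"
    using push_adjoint[OF p] unfolding defs .
  have unit: "eta L p A \<in> hom (fib H P) A (ob (pull H p) (ob (push L p) A))"
    "eta L p A \<in> hom (fib H P) (ob (pull H (Id S P)) A) (ob (pull H p) (ob (push L p) A))"
    "conn H (Id S P) p (ob (push L p) A) \<cdot>\<^bsub>fib H P\<^esub> eta L p A = ar (pull H (Id S P)) (eta L p A)"
    "ob (push L p) A \<in> Ob (fib H U)"
    if A: "A \<in> Ob (fib H P)" for A
    using p.unit_in[OF A] pull_id_ob[OF PU(1) A] conn_id_left[OF h p.L.ob_in[OF A]] P.id_comp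
      pull_id_ar[OF PU(1)] P.homD(1) p.L.ob_in[OF A] by auto
  have identity: "Id (fib H U) B \<in> hom (fib H U) B (ob (pull H (Id S U)) B)"
    "Id (fib H P) (ob (pull H p) B) \<in> hom (fib H P) (ob (pull H p) B) (ob (pull H p) B)"
    "conn H p (Id S U) B \<cdot>\<^bsub>fib H P\<^esub> Id (fib H P) (ob (pull H p) B) = ar (pull H p) (Id (fib H U) B)"
    if B: "B \<in> Ob (fib H U)" for B
    using U.id_in_hom[OF B] P.id_in_hom[OF pull_ob[OF h B]] pull_id_ob[OF PU(2) B]
      conn_id_right[OF h B] P.id_comp pull_id[OF h B] by auto
  {
    fix A B assume A: "A \<in> Ob (fib H (Dom S p))" and B: "B \<in> Ob (fib H (Cod S p))"
    note A = A[unfolded defs] and B = B[unfolded defs]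
    (* the external condition for the pair (p, p), since the second factor is over the codomain U *)
    have "universal (prd_ar S X p (Id S U)) (ob (etens M U U) (ob (push L p) A, B))
        (epairing P U p (Id S U) (ob (push L p) A) B (eta L p A) (Id (fib H U) B))"
      using geo p A B unfolding geometric_external_iff P_def U_def by blast
    then have "universal (prd_ar S X p (Id S U)) (ob (itens N (prd X U U))
          (ob (pull H (pr1 X U U)) (ob (push L p) A), ob (pull H (pr2 X U U)) B))
        (induced_pairing p (Id S U) (ob (push L p) A) B (eta L p A) (Id (fib H U) B))"
      using universal_epairing_iff[OF h i equiv smooth_prod_left[OF p h PU(2)] unit(4)[OF A] B
          unit(1)[OF A] identity(1)[OF B]] by simp
    then show "universal p (ob (itens N (Cod S p)) (ob (push L p) A, B))
        (ipairing (Dom S p) p (ob (push L p) A) B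
          (eta L p A) (Id (fib H (Dom S p)) (ob (pull H p) B)))"
      using universal_diagonal_restriction[OF h i j h cartesian_id_right[OF h]
            comp_id[OF h, symmetric] smooth_prod_left[OF p h PU(2)] unit(4)[OF A] B
            unit(1)[OF A] identity(1)[OF B] unit(2,3)[OF A] identity(2,3)[OF B]]
      unfolding defs by blast
  next
    fix A B assume A: "A \<in> Ob (fib H (Cod S p))" and B: "B \<in> Ob (fib H (Dom S p))"
    note A = A[unfolded defs] and B = B[unfolded defs]
    have "universal (prd_ar S X (Id S U) p) (ob (etens M U U) (A, ob (push L p) B))
        (epairing U P (Id S U) p A (ob (push L p) B) (Id (fib H U) A) (eta L p B))"
      using geo p A B unfolding geometric_external_iff P_def U_def by blast
    then have "universal (prd_ar S X (Id S U) p) (ob (itens N (prd X U U))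
          (ob (pull H (pr1 X U U)) A, ob (pull H (pr2 X U U)) (ob (push L p) B)))
        (induced_pairing (Id S U) p A (ob (push L p) B) (Id (fib H U) A) (eta L p B))"
      using universal_epairing_iff[OF i h equiv smooth_prod_right[OF p h PU(2)] A unit(4)[OF B]
          identity(1)[OF A] unit(1)[OF B]] by simp
    then show "universal p (ob (itens N (Cod S p)) (A, ob (push L p) B))
        (ipairing (Dom S p) p A (ob (push L p) B)
          (Id (fib H (Dom S p)) (ob (pull H p) A)) (eta L p B))"
      using universal_diagonal_restriction[OF i h h j cartesian_id_left[OF h]
            id_comp[OF h, symmetric] smooth_prod_right[OF p h PU(2)] A unit(4)[OF B]
            identity(1)[OF A] unit(1)[OF B] identity(2,3)[OF A] unit(2,3)[OF B]]
      unfolding defs by blast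
  }
qed

end

theorem proposition7p7:
  fixes S :: "('s, 'm) cat" and X :: "('s, 'm) products" and Sm :: "'m set"
    and H :: "('s, 'm, 'o, 'a) fibered" and L :: "('m, 'o, 'a) adjoints"
    and N :: "('s, 'm, 'o, 'a) internal" and M :: "('s, 'm, 'o, 'a) external"
  assumes "binary_products S X"
    and "smooth_subcategory S Sm"
    and "geometric_fibered_category S Sm H L"
    and "internal_tensor_structure S H N"
    and "external_tensor_structure S X H M"
    and "external_equivalent S X H (ext_of_int S X H N) M"
  shows "geometric_internal S Sm H L N \<longleftrightarrow> geometric_external S X Sm H L M"
proof -
  interpret geometric_tensor_data S X Sm H L N M
    by (intro geometric_tensor_data.intro geometric_internal_data.intro
        geometric_external_data.intro assms)
  show ?thesis
    using geometric_internal_imp_external geometric_external_imp_internal assms(6) by blast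
qed

end
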